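(* There exists an absolute constant $c > 0$ such that the following holds. Let $n, m, k \in \mathbb{N}$ be arbitrary, let $A = (a_{ij}) \in \mathbb{R}_{\ge 0}^{m \times n}$, let $\mathbf{p} = (p_1,\dots,p_n) \in [0,1]^n$ and let $\mathbf{\Delta} = (\Delta_1,\dots,\Delta_m) \in \mathbb{R}_{>0}^m$. For each $i \in [m]$ define \[ \mathrm{prob}^{bad}_i := c \exp\!\left( -\frac{1}{c} \min\!\left( \frac{\Delta_i^2}{\sum_{j \in [n]} p_j a_{ij} \,(\max_{j \in [n]} a_{ij})},\; \frac{\Delta_i}{\max_{j \in [n]} a_{ij}},\; \frac{\Delta_i k}{\sum_{j \in [n]} p_j a_{ij}} \right) \right). \] Then there exists a deterministic parallel algorithm with $\tilde{O}(\max(\mathrm{nnz}(A), n, m)\operatorname{poly}(k))$ work and $\operatorname{poly}(\log(nm), k)$ depth that outputs a vector $\mathbf{q} \in \{0,1\}^n$ and a set $I^{bad} \subseteq [m]$ with $|I^{bad}| \le \sum_{i \in [m]} \mathrm{prob}^{bad}_i$ such that for every $i \in [m] \setminus I^{bad}$, \[ \Big| \sum_{j \in [n]} a_{ij}(p_j - q_j) \Big| \le \Delta_i. \]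
   Context: $[n] = \{1,\dots,n\}$. $\mathrm{nnz}(A)$ denotes the number of nonzero entries of the matrix $A$. Parallel algorithms are measured in the work/depth (PRAM) model: work is the total number of operations and depth is the length of the longest chain of sequentially dependent operations. $\tilde{O}(\cdot)$ hides factors polylogarithmic in the input size (in $n$ and $m$). *)

theory Defs
  imports "HOL-Library.Extended_Real"
begin

section \<open>A real-number PRAM with work and depth\<close>

text \<open>
  Programs are in the work-time presentation of PRAM algorithms: a sequential control program whose
  basic step is a synchronous parallel step, in which processors \<open>0, \<dots>, N - 1\<close> execute the same
  guarded assignment on a shared memory. Reads are concurrent and see the memory before the step;
  two active processors must not write to the same cell (CREW).

  The shared memory consists of integer arrays and real arrays. Reals are exact, with unit-cost
  \<open>+\<close>, \<open>-\<close>, \<open>*\<close>, \<open>/\<close> and comparison only (no rounding, and no conversion from reals to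
  integers), and the only constants in a program are natural numbers. Integer cells are machine
  words: a program has a meaning only if every integer it computes is at most the word bound \<open>W\<close>.
\<close>

datatype iexp =
    IConst nat
  | Pid
  | ILoad nat iexp
  | IAdd iexp iexp
  | ISub iexp iexp
  | IMul iexp iexp
  | IDiv iexp iexp

datatype rexp =
    RLoad nat iexp
  | ROfNat iexp
  | RAdd rexp rexp
  | RSub rexp rexp
  | RMul rexp rexp
  | RDiv rexp rexp

datatype bexp =
    ILess iexp iexp
  | RLess rexp rexp
  | BNot bexp
  | BAnd bexp bexp

datatype com =
    Skip
  | ParI iexp bexp nat iexp iexp  \<comment> \<open>number of processors, guard, array, index, new value\<close>
  | ParR iexp bexp nat iexp rexp
  | Seq com com
  | If bexp com com
  | While bexp com

record mem =
  imem :: "nat \<Rightarrow> nat \<Rightarrow> nat"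
  rmem :: "nat \<Rightarrow> nat \<Rightarrow> real"

text \<open>
  The second argument of the evaluation functions is the processor number; the control program
  evaluates with processor number 0. Subtraction of integers is truncated and dividing by 0
  yields 0.
\<close>

fun ival :: "mem \<Rightarrow> nat \<Rightarrow> iexp \<Rightarrow> nat" where
  "ival s i (IConst v) = v"
| "ival s i Pid = i"
| "ival s i (ILoad x e) = imem s x (ival s i e)"
| "ival s i (IAdd e f) = ival s i e + ival s i f"
| "ival s i (ISub e f) = ival s i e - ival s i f"
| "ival s i (IMul e f) = ival s i e * ival s i f"
| "ival s i (IDiv e f) = ival s i e div ival s i f"

fun rval :: "mem \<Rightarrow> nat \<Rightarrow> rexp \<Rightarrow> real" where
  "rval s i (RLoad x e) = rmem s x (ival s i e)"
| "rval s i (ROfNat e) = real (ival s i e)"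
| "rval s i (RAdd e f) = rval s i e + rval s i f"
| "rval s i (RSub e f) = rval s i e - rval s i f"
| "rval s i (RMul e f) = rval s i e * rval s i f"
| "rval s i (RDiv e f) = rval s i e / rval s i f"

fun bval :: "mem \<Rightarrow> nat \<Rightarrow> bexp \<Rightarrow> bool" where
  "bval s i (ILess e f) \<longleftrightarrow> ival s i e < ival s i f"
| "bval s i (RLess e f) \<longleftrightarrow> rval s i e < rval s i f"
| "bval s i (BNot b) \<longleftrightarrow> \<not> bval s i b"
| "bval s i (BAnd b c) \<longleftrightarrow> bval s i b \<and> bval s i c"

text \<open>The word bound has to hold for all intermediate results, in particular for addresses.\<close>

fun ifits :: "nat \<Rightarrow> mem \<Rightarrow> nat \<Rightarrow> iexp \<Rightarrow> bool" where
  "ifits W s i (IConst v) \<longleftrightarrow> v \<le> W"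
| "ifits W s i Pid \<longleftrightarrow> i \<le> W"
| "ifits W s i (ILoad x e) \<longleftrightarrow> ifits W s i e \<and> ival s i (ILoad x e) \<le> W"
| "ifits W s i (IAdd e f) \<longleftrightarrow> ifits W s i e \<and> ifits W s i f \<and> ival s i (IAdd e f) \<le> W"
| "ifits W s i (ISub e f) \<longleftrightarrow> ifits W s i e \<and> ifits W s i f"
| "ifits W s i (IMul e f) \<longleftrightarrow> ifits W s i e \<and> ifits W s i f \<and> ival s i (IMul e f) \<le> W"
| "ifits W s i (IDiv e f) \<longleftrightarrow> ifits W s i e \<and> ifits W s i f"

fun rfits :: "nat \<Rightarrow> mem \<Rightarrow> nat \<Rightarrow> rexp \<Rightarrow> bool" where
  "rfits W s i (RLoad x e) \<longleftrightarrow> ifits W s i e"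
| "rfits W s i (ROfNat e) \<longleftrightarrow> ifits W s i e"
| "rfits W s i (RAdd e f) \<longleftrightarrow> rfits W s i e \<and> rfits W s i f"
| "rfits W s i (RSub e f) \<longleftrightarrow> rfits W s i e \<and> rfits W s i f"
| "rfits W s i (RMul e f) \<longleftrightarrow> rfits W s i e \<and> rfits W s i f"
| "rfits W s i (RDiv e f) \<longleftrightarrow> rfits W s i e \<and> rfits W s i f"

fun bfits :: "nat \<Rightarrow> mem \<Rightarrow> nat \<Rightarrow> bexp \<Rightarrow> bool" where
  "bfits W s i (ILess e f) \<longleftrightarrow> ifits W s i e \<and> ifits W s i f"
| "bfits W s i (RLess e f) \<longleftrightarrow> rfits W s i e \<and> rfits W s i f"
| "bfits W s i (BNot b) \<longleftrightarrow> bfits W s i b"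
| "bfits W s i (BAnd b c) \<longleftrightarrow> bfits W s i b \<and> bfits W s i c"

text \<open>Every node of an expression counts as one operation.\<close>

fun icost :: "iexp \<Rightarrow> nat" where
  "icost (IConst v) = 1"
| "icost Pid = 1"
| "icost (ILoad x e) = icost e + 1"
| "icost (IAdd e f) = icost e + icost f + 1"
| "icost (ISub e f) = icost e + icost f + 1"
| "icost (IMul e f) = icost e + icost f + 1"
| "icost (IDiv e f) = icost e + icost f + 1"

fun rcost :: "rexp \<Rightarrow> nat" where
  "rcost (RLoad x e) = icost e + 1"
| "rcost (ROfNat e) = icost e + 1"
| "rcost (RAdd e f) = rcost e + rcost f + 1"
| "rcost (RSub e f) = rcost e + rcost f + 1"
| "rcost (RMul e f) = rcost e + rcost f + 1"
| "rcost (RDiv e f) = rcost e + rcost f + 1"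

fun bcost :: "bexp \<Rightarrow> nat" where
  "bcost (ILess e f) = icost e + icost f + 1"
| "bcost (RLess e f) = rcost e + rcost f + 1"
| "bcost (BNot b) = bcost b + 1"
| "bcost (BAnd b c) = bcost b + bcost c + 1"

definition active :: "mem \<Rightarrow> nat \<Rightarrow> bexp \<Rightarrow> nat set" where
  "active s N g = {i. i < N \<and> bval s i g}"

definition scatter :: "nat set \<Rightarrow> (nat \<Rightarrow> nat) \<Rightarrow> (nat \<Rightarrow> 'a) \<Rightarrow> (nat \<Rightarrow> 'a) \<Rightarrow> nat \<Rightarrow> 'a" where
  "scatter P addr v old a = (if a \<in> addr ` P then v (the_inv_into P addr a) else old a)"

text \<open>
  \<open>exec W c s w d t\<close>: started in memory \<open>s\<close>, program \<open>c\<close> terminates in memory \<open>t\<close> with work \<open>w\<close> and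
  depth \<open>d\<close>. In a parallel step all processors below \<open>N\<close>, active or not, are charged for the whole
  guarded assignment, one after the other in the work and simultaneously in the depth.
\<close>

inductive exec :: "nat \<Rightarrow> com \<Rightarrow> mem \<Rightarrow> nat \<Rightarrow> nat \<Rightarrow> mem \<Rightarrow> bool" for W :: nat where
  exec_Skip: "exec W Skip s 0 0 s"
| exec_ParI:
    "\<lbrakk> ifits W s 0 e; N = ival s 0 e; \<forall>i<N. bfits W s i g; P = active s N g;
       \<forall>i\<in>P. ifits W s i a \<and> ifits W s i v; inj_on (\<lambda>i. ival s i a) P;
       t = s\<lparr>imem := (imem s)(x := scatter P (\<lambda>i. ival s i a) (\<lambda>i. ival s i v) (imem s x))\<rparr>;
       r = bcost g + icost a + icost v + 1 \<rbrakk>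
     \<Longrightarrow> exec W (ParI e g x a v) s (icost e + 1 + N * r) (icost e + 1 + r) t"
| exec_ParR:
    "\<lbrakk> ifits W s 0 e; N = ival s 0 e; \<forall>i<N. bfits W s i g; P = active s N g;
       \<forall>i\<in>P. ifits W s i a \<and> rfits W s i v; inj_on (\<lambda>i. ival s i a) P;
       t = s\<lparr>rmem := (rmem s)(x := scatter P (\<lambda>i. ival s i a) (\<lambda>i. rval s i v) (rmem s x))\<rparr>;
       r = bcost g + icost a + rcost v + 1 \<rbrakk>
     \<Longrightarrow> exec W (ParR e g x a v) s (icost e + 1 + N * r) (icost e + 1 + r) t"
| exec_Seq:
    "\<lbrakk> exec W c1 s w1 d1 s'; exec W c2 s' w2 d2 t \<rbrakk>
     \<Longrightarrow> exec W (Seq c1 c2) s (w1 + w2) (d1 + d2) t"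
| exec_IfTrue:
    "\<lbrakk> bfits W s 0 b; bval s 0 b; exec W c1 s w d t \<rbrakk>
     \<Longrightarrow> exec W (If b c1 c2) s (bcost b + 1 + w) (bcost b + 1 + d) t"
| exec_IfFalse:
    "\<lbrakk> bfits W s 0 b; \<not> bval s 0 b; exec W c2 s w d t \<rbrakk>
     \<Longrightarrow> exec W (If b c1 c2) s (bcost b + 1 + w) (bcost b + 1 + d) t"
| exec_WhileFalse:
    "\<lbrakk> bfits W s 0 b; \<not> bval s 0 b \<rbrakk>
     \<Longrightarrow> exec W (While b c) s (bcost b + 1) (bcost b + 1) s"
| exec_WhileTrue:
    "\<lbrakk> bfits W s 0 b; bval s 0 b; exec W c s w1 d1 s'; exec W (While b c) s' w2 d2 t \<rbrakk>
     \<Longrightarrow> exec W (While b c) s (bcost b + 1 + w1 + w2) (bcost b + 1 + d1 + d2) t"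

lemma exec_deterministic:
  "exec W c s w d t \<Longrightarrow> exec W c s w' d' t' \<Longrightarrow> w' = w \<and> d' = d \<and> t' = t"
proof (induction arbitrary: w' d' t' rule: exec.induct)
  case (exec_Skip s)
  from exec_Skip.prems show ?case by cases simp
next
  case (exec_ParI s e N g P a v t x r)
  from exec_ParI.prems show ?case
    by cases (simp add: exec_ParI.hyps)
next
  case (exec_ParR s e N g P a v t x r)
  from exec_ParR.prems show ?case
    by cases (simp add: exec_ParR.hyps)
next
  case (exec_Seq c1 s w1 d1 s' c2 w2 d2 t)
  from exec_Seq.prems show ?case
    by cases (auto dest!: exec_Seq.IH)
next
  case (exec_IfTrue s b c1 w d t c2)
  from exec_IfTrue.prems show ?case
    by cases (auto simp: exec_IfTrue.hyps(2) dest: exec_IfTrue.IH)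
next
  case (exec_IfFalse s b c2 w d t c1)
  from exec_IfFalse.prems show ?case
    by cases (auto simp: exec_IfFalse.hyps(2) dest: exec_IfFalse.IH)
next
  case (exec_WhileFalse s b c)
  from exec_WhileFalse.prems show ?case
    by cases (auto simp: exec_WhileFalse.hyps(2))
next
  case (exec_WhileTrue s b c w1 d1 s' w2 d2 t)
  from exec_WhileTrue.prems show ?case
    by cases (auto simp: exec_WhileTrue.hyps(2) dest!: exec_WhileTrue.IH)
qed


section \<open>Instances, outputs and failure probabilities\<close>

text \<open>
  The index sets \<open>[m]\<close> and \<open>[n]\<close> are \<open>{..<m}\<close> and \<open>{..<n}\<close>. The matrix is given by its nonzero
  entries, in arbitrary order.
\<close>

definition nonzeros :: "nat \<Rightarrow> nat \<Rightarrow> (nat \<Rightarrow> nat \<Rightarrow> real) \<Rightarrow> (nat \<times> nat) set" where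
  "nonzeros m n A = {(i, j). i < m \<and> j < n \<and> A i j \<noteq> 0}"

definition nnz :: "nat \<Rightarrow> nat \<Rightarrow> (nat \<Rightarrow> nat \<Rightarrow> real) \<Rightarrow> nat" where
  "nnz m n A = card (nonzeros m n A)"

definition enumerates_nonzeros ::
    "nat \<Rightarrow> nat \<Rightarrow> (nat \<Rightarrow> nat \<Rightarrow> real) \<Rightarrow> (nat \<times> nat) list \<Rightarrow> bool" where
  "enumerates_nonzeros m n A es \<longleftrightarrow> distinct es \<and> set es = nonzeros m n A"

text \<open>
  Input: integer array 0 holds \<open>n\<close>, \<open>m\<close>, \<open>k\<close> and the number of nonzero entries; integer arrays 1
  and 2 hold their rows and columns and real array 0 their values; real arrays 1 and 2 hold \<open>p\<close> and
  \<open>\<Delta>\<close>. All other cells are 0.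
\<close>

definition array_of :: "'a::zero list \<Rightarrow> nat \<Rightarrow> 'a" where
  "array_of xs a = (if a < length xs then xs ! a else 0)"

definition initial_mem ::
    "nat \<Rightarrow> nat \<Rightarrow> nat \<Rightarrow> (nat \<Rightarrow> nat \<Rightarrow> real) \<Rightarrow> (nat \<Rightarrow> real) \<Rightarrow> (nat \<Rightarrow> real) \<Rightarrow>
     (nat \<times> nat) list \<Rightarrow> mem" where
  "initial_mem n m k A p \<Delta> es =
     \<lparr>imem = (\<lambda>_ _. 0)(0 := array_of [n, m, k, length es],
                       1 := array_of (map fst es),
                       2 := array_of (map snd es)),
      rmem = (\<lambda>_ _. 0)(0 := array_of (map (\<lambda>(i, j). A i j) es),
                       1 := array_of (map p [0..<n]),
                       2 := array_of (map \<Delta> [0..<m]))\<rparr>"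

text \<open>Output: integer array 3 holds \<open>q\<close>, integer array 4 the characteristic vector of \<open>Ibad\<close>.\<close>

definition outputs :: "nat \<Rightarrow> nat \<Rightarrow> mem \<Rightarrow> (nat \<Rightarrow> real) \<Rightarrow> nat set \<Rightarrow> bool" where
  "outputs n m t q Ibad \<longleftrightarrow>
     (\<forall>j<n. q j = real (imem t 3 j)) \<and> Ibad = {i. i < m \<and> imem t 4 i = 1}"

text \<open>Maximum of a row of a nonnegative matrix; the added 0 matters only for \<open>n = 0\<close>.\<close>

definition row_max :: "nat \<Rightarrow> (nat \<Rightarrow> nat \<Rightarrow> real) \<Rightarrow> nat \<Rightarrow> real" where
  "row_max n A i = Max (insert 0 (A i ` {..<n}))"

definition row_mean :: "nat \<Rightarrow> (nat \<Rightarrow> nat \<Rightarrow> real) \<Rightarrow> (nat \<Rightarrow> real) \<Rightarrow> nat \<Rightarrow> real" where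
  "row_mean n A p i = (\<Sum>j<n. p j * A i j)"

text \<open>
  Quotients are taken in the extended reals, so that a positive number divided by 0 is \<open>\<infinity>\<close>.
\<close>

definition bad_exponent ::
    "nat \<Rightarrow> nat \<Rightarrow> (nat \<Rightarrow> nat \<Rightarrow> real) \<Rightarrow> (nat \<Rightarrow> real) \<Rightarrow> (nat \<Rightarrow> real) \<Rightarrow> nat \<Rightarrow> ereal" where
  "bad_exponent n k A p \<Delta> i =
     min (ereal ((\<Delta> i)\<^sup>2) / ereal (row_mean n A p i * row_max n A i))
         (min (ereal (\<Delta> i) / ereal (row_max n A i))
              (ereal (\<Delta> i * real k) / ereal (row_mean n A p i)))"

definition prob_bad ::
    "real \<Rightarrow> nat \<Rightarrow> nat \<Rightarrow> (nat \<Rightarrow> nat \<Rightarrow> real) \<Rightarrow> (nat \<Rightarrow> real) \<Rightarrow> (nat \<Rightarrow> real) \<Rightarrow> nat \<Rightarrow> real" where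
  "prob_bad c n k A p \<Delta> i =
     (let x = bad_exponent n k A p \<Delta> i
      in if x = \<infinity> then 0 else c * exp (- (1 / c) * real_of_ereal x))"

text \<open>
  \<open>log (n m)\<close>, with \<open>1\<close> added because polylogarithmic bounds are stated as powers of it.
\<close>

definition log_size :: "nat \<Rightarrow> nat \<Rightarrow> real" where
  "log_size n m = 1 + log 2 (real (max 1 (n * m)))"

end

theory Submission
  imports Defs
begin

text \<open>
  Every coordinate performs a walk \<open>x \<mapsto> x \<plusminus> x (1 - x) / E\<close> with \<open>E = 32 (k + L)\<close> and \<open>L\<close> about
  \<open>log (n m)\<close>. A single step changes a row sum by at most a fraction \<open>1 / E\<close> of it, so for a rate \<open>l\<close>
  of the size of the exponent divided by \<open>\<Delta>\<close> the exponentials \<open>exp (\<plusminus> l S - 4 l\<^sup>2 R)\<close> of the deviation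
  \<open>S = \<Sum> a (x - p)\<close>, corrected by \<open>R = \<Sum> a\<^sup>2 (x\<^sup>2 - p\<^sup>2)\<close>, can be replaced by quadratic polynomials; this is
  where the term \<open>\<Delta> k / \<Sum> p a\<close> of the exponent comes from. The sum of these potentials over all rows bounds
  the number of failed rows, and a potential above \<open>sqrt (x (1 - x))\<close> for every column, inflated in every
  step, forces all coordinates close to 0 or 1 after polylogarithmically many steps.

  The signs of a step have to satisfy one inequality: a weighted sum of squares of row sums \<open>\<Sum> \<sigma> v\<close> must not
  exceed the same sum of \<open>\<Sum> v\<^sup>2\<close>. For \<open>\<sigma> j\<close> the product of \<open>r b\<close> over the binary digits \<open>b\<close> set in \<open>j\<close>
  the signs \<open>r b\<close> are found greedily: merging the classes of columns pairwise, one digit at a time, only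
  adds a cross term, and \<open>r b\<close> is chosen to make it nonpositive. A last global sign takes care of the
  terms that are linear in \<open>\<sigma>\<close>.
\<close>

section \<open>Depth and work of programs\<close>

text \<open>The machine has no exponential and cannot convert a real to an integer, so the exponent
  of a row enters only through an integer found by counting: the first \<open>h\<close> for which
  \<open>256 * (h + 1)\<close> is too large for one of the three quotients, or \<open>L\<close> if
  that comes earlier. The row gets \<open>l = 8 * h / \<Delta>\<close> and starts with
  \<open>1 / 2 ^ h\<close> on either side, which has grown to 1 when its deviation exceeds
  \<open>\<Delta> / 2\<close>; the other half of \<open>\<Delta>\<close> is kept for the final
  rounding. The total potential starts at the sum of \<open>2 / 2 ^ h\<close> plus
  \<open>1 / 4\<close> for all columns and does not grow. Two additive errors remain: this
  \<open>1 / 4\<close>, and the rows with \<open>h = L\<close>, whose failure probability may be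
  tiny but which contribute at most \<open>1 / 32\<close>, as \<open>64 * n * m \<le> 2 ^ L\<close>.
  They disappear because the number of failed rows is an integer and \<open>c = 1024\<close> makes
  all other probabilities at least twice the start potentials. The work bound allows one processor
  per nonzero entry, row or column, which is why sibling classes are found through a sparse
  table.\<close>

fun imods :: "com \<Rightarrow> nat set" where
  "imods Skip = {}"
| "imods (ParI e g x a v) = {x}"
| "imods (ParR e g x a v) = {}"
| "imods (Seq c d) = imods c \<union> imods d"
| "imods (If b c d) = imods c \<union> imods d"
| "imods (While b c) = imods c"

fun rmods :: "com \<Rightarrow> nat set" where
  "rmods Skip = {}"
| "rmods (ParI e g x a v) = {}"
| "rmods (ParR e g x a v) = {x}"
| "rmods (Seq c d) = rmods c \<union> rmods d"
| "rmods (If b c d) = rmods c \<union> rmods d"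
| "rmods (While b c) = rmods c"

lemma exec_frame:
  "exec W c s w d t \<Longrightarrow>
    (\<forall>x. x \<notin> imods c \<longrightarrow> imem t x = imem s x) \<and> (\<forall>x. x \<notin> rmods c \<longrightarrow> rmem t x = rmem s x)"
  by (induction rule: exec.induct) auto

text \<open>If no step uses more than \<open>N\<close> processors, the work is at most \<open>N\<close> times the depth, so
  that one number \<open>D\<close> bounds both costs.\<close>

definition run :: "nat \<Rightarrow> nat \<Rightarrow> com \<Rightarrow> nat \<Rightarrow> mem \<Rightarrow> mem \<Rightarrow> bool" where
  "run W N c D s t \<longleftrightarrow> (\<exists>w d. exec W c s w d t \<and> d \<le> D \<and> w \<le> N * D)"

lemma run_imem: "run W N c D s t \<Longrightarrow> x \<notin> imods c \<Longrightarrow> imem t x = imem s x"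
  and run_rmem: "run W N c D s t \<Longrightarrow> x \<notin> rmods c \<Longrightarrow> rmem t x = rmem s x"
  by (auto simp: run_def dest: exec_frame)

lemma run_mono: "run W N c D s t \<Longrightarrow> D \<le> D' \<Longrightarrow> run W N c D' s t"
  unfolding run_def by (meson le_trans mult_le_mono2)

lemma run_Skip: "run W N Skip D s s"
  unfolding run_def using exec_Skip by fastforce

lemma run_Seq:
  assumes "run W N c1 D1 s s'" "run W N c2 D2 s' t" "D1 + D2 \<le> D"
  shows "run W N (Seq c1 c2) D s t"
proof -
  obtain w1 d1 w2 d2 where *: "exec W c1 s w1 d1 s'" "d1 \<le> D1" "w1 \<le> N * D1"
      "exec W c2 s' w2 d2 t" "d2 \<le> D2" "w2 \<le> N * D2"
    using assms unfolding run_def by blast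
  have "w1 + w2 \<le> N * (D1 + D2)" using * by (simp add: algebra_simps)
  also have "\<dots> \<le> N * D" using assms(3) by simp
  finally show ?thesis unfolding run_def using * assms(3) exec_Seq[OF *(1) *(4)]
    by (intro exI[of _ "w1+w2"] exI[of _ "d1+d2"]) auto
qed

text \<open>Control operations are charged once in the work and once in the depth; since
  \<open>1 \<le> N\<close> they do not break the bound of the work by \<open>N\<close> times the
  depth.\<close>

lemma add_le_mult:
  fixes a D N w :: nat
  assumes "1 \<le> N" "w \<le> N * D"
  shows "a + w \<le> N * (a + D)"
proof -
  have "1 * a \<le> N * a" using assms(1) by (rule mult_le_mono1)
  from add_mono[OF this assms(2)] show ?thesis by (simp only: mult_1 distrib_left)
qed

lemma run_If:
  assumes "1 \<le> N" "bfits W s 0 b"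
    "bval s 0 b \<Longrightarrow> run W N c1 D s t" "\<not> bval s 0 b \<Longrightarrow> run W N c2 D s t"
    "bcost b + 1 + D \<le> D'"
  shows "run W N (If b c1 c2) D' s t"
proof -
  have "run W N (If b c1 c2) (bcost b + 1 + D) s t"
  proof (cases "bval s 0 b")
    case True
    then obtain w d where *: "exec W c1 s w d t" "d \<le> D" "w \<le> N * D"
      using assms unfolding run_def by blast
    show ?thesis unfolding run_def
      using exec_IfTrue[OF assms(2) True *(1), of c2] *(2) add_le_mult[OF assms(1) *(3), of "bcost
        b + 1"]
      by (intro exI[of _ "bcost b + 1 + w"] exI[of _ "bcost b + 1 + d"]) auto
  next
    case False
    then obtain w d where *: "exec W c2 s w d t" "d \<le> D" "w \<le> N * D"
      using assms unfolding run_def by blast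
    show ?thesis unfolding run_def
      using exec_IfFalse[OF assms(2) False *(1), of c1] *(2) add_le_mult[OF assms(1) *(3), of
        "bcost b + 1"]
      by (intro exI[of _ "bcost b + 1 + w"] exI[of _ "bcost b + 1 + d"]) auto
  qed
  thus ?thesis using run_mono assms(5) by blast
qed

text \<open>The invariant carries the number of finished iterations, so one argument yields
  termination after \<open>K\<close> rounds, correctness and cost. The guard is evaluated once more
  than the body, hence the separate \<open>bcost b + 1\<close>.\<close>

lemma run_While_count:
  assumes N: "1 \<le> N"
    and step: "\<And>i s. i < K \<Longrightarrow> J i s \<Longrightarrow>
      bfits W s 0 b \<and> bval s 0 b \<and> (\<exists>t. run W N c D s t \<and> J (Suc i) t)"
    and fin: "\<And>s. J K s \<Longrightarrow> bfits W s 0 b \<and> \<not> bval s 0 b"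
    and init: "J 0 s"
    and D': "K * (D + bcost b + 1) + bcost b + 1 \<le> D'"
  shows "\<exists>t. run W N (While b c) D' s t \<and> J K t"
proof -
  have "i \<le> K \<Longrightarrow> J i s \<Longrightarrow>
    \<exists>t. run W N (While b c) ((K - i) * (D + bcost b + 1) + bcost b + 1) s t \<and> J K t" for i s
  proof (induction "K - i" arbitrary: i s)
    case 0
    hence [simp]: "i = K" by simp
    have "bcost b + 1 \<le> N * (bcost b + 1)" using add_le_mult[OF N, of 0 0 "bcost b + 1"] by simp
    thus ?case using exec_WhileFalse[of W s b c] fin[of s] 0 unfolding run_def
      by (intro exI[of _ s]) auto
  next
    case (Suc q)
    have iK: "i < K" using Suc.hyps(2) by simp
    obtain s' where s': "run W N c D s s'" "J (Suc i) s'" "bfits W s 0 b" "bval s 0 b"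
      using step[OF iK Suc.prems(2)] by blast
    have q: "q = K - Suc i" "K - i = Suc q" using Suc.hyps(2) by auto
    obtain t where t: "run W N (While b c) (q * (D + bcost b + 1) + bcost b + 1) s' t" "J K t"
      using Suc.hyps(1)[OF q(1) _ s'(2)] iK q by (auto simp: Suc_le_eq)
    obtain w1 d1 where 1: "exec W c s w1 d1 s'" "d1 \<le> D" "w1 \<le> N * D"
      using s' unfolding run_def by blast
    obtain w2 d2 where 2: "exec W (While b c) s' w2 d2 t" "d2 \<le> q * (D + bcost b + 1) + bcost b + 1"
        "w2 \<le> N * (q * (D + bcost b + 1) + bcost b + 1)"
      using t unfolding run_def by blast
    let ?R = "q * (D + bcost b + 1) + bcost b + 1"
    have "bcost b + 1 + (w1 + w2) \<le> N * (bcost b + 1 + (D + ?R))"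
      using 1 2 by (intro add_le_mult[OF N]) (simp add: distrib_left)
    hence "run W N (While b c) (bcost b + 1 + (D + ?R)) s t"
      unfolding run_def using exec_WhileTrue[OF s'(3,4) 1(1) 2(1)] 1 2
      by (intro exI[of _ "bcost b + 1 + w1 + w2"] exI[of _ "bcost b + 1 + d1 + d2"]) auto
    moreover have "bcost b + 1 + (D + ?R) = (K - i) * (D + bcost b + 1) + bcost b + 1"
      unfolding q by (simp add: algebra_simps)
    ultimately show ?case using t(2) by metis
  qed
  from this[of 0 s] init D' show ?thesis by (auto intro: run_mono)
qed

lemma run_ParI:
  assumes "1 \<le> N" "ifits W s 0 e" "ival s 0 e = c" "c \<le> N" "\<And>i. i < c \<Longrightarrow> bfits W s i g"
    "\<And>i. i < c \<Longrightarrow> bval s i g \<Longrightarrow> ifits W s i a \<and> ifits W s i v"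
    "inj_on (\<lambda>i. ival s i a) {i. i < c \<and> bval s i g}"
    "icost e + bcost g + icost a + icost v + 2 \<le> D"
  shows "run W N (ParI e g x a v) D s
    (s\<lparr>imem := (imem s)(x := scatter {i. i < c \<and>
      bval s i g} (\<lambda>i. ival s i a) (\<lambda>i. ival s i v) (imem s x))\<rparr>)"
proof -
  let ?r = "bcost g + icost a + icost v + 1"
  have "icost e + 1 + c * ?r \<le> N * (icost e + 1 + ?r)"
    using assms(1,4) by (intro add_le_mult mult_le_mono1)
  also have "\<dots> \<le> N * D" using assms(8) by (intro mult_le_mono2) simp
  finally have w: "icost e + 1 + c * ?r \<le> N * D" .
  have "exec W (ParI e g x a v) s (icost e + 1 + c * ?r) (icost e + 1 + ?r)
    (s\<lparr>imem := (imem s)(x := scatter {i. i < c \<and>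
      bval s i g} (\<lambda>i. ival s i a) (\<lambda>i. ival s i v) (imem s x))\<rparr>)"
    by (rule exec_ParI[OF assms(2) assms(3)[symmetric] _ _ _ assms(7)])
      (use assms in \<open>auto simp: active_def\<close>)
  with w assms(8) show ?thesis unfolding run_def by fastforce
qed

lemma run_ParR:
  assumes "1 \<le> N" "ifits W s 0 e" "ival s 0 e = c" "c \<le> N" "\<And>i. i < c \<Longrightarrow> bfits W s i g"
    "\<And>i. i < c \<Longrightarrow> bval s i g \<Longrightarrow> ifits W s i a \<and> rfits W s i v"
    "inj_on (\<lambda>i. ival s i a) {i. i < c \<and> bval s i g}"
    "icost e + bcost g + icost a + rcost v + 2 \<le> D"
  shows "run W N (ParR e g x a v) D s
    (s\<lparr>rmem := (rmem s)(x := scatter {i. i < c \<and>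
      bval s i g} (\<lambda>i. ival s i a) (\<lambda>i. rval s i v) (rmem s x))\<rparr>)"
proof -
  let ?r = "bcost g + icost a + rcost v + 1"
  have "icost e + 1 + c * ?r \<le> N * (icost e + 1 + ?r)"
    using assms(1,4) by (intro add_le_mult mult_le_mono1)
  also have "\<dots> \<le> N * D" using assms(8) by (intro mult_le_mono2) simp
  finally have w: "icost e + 1 + c * ?r \<le> N * D" .
  have "exec W (ParR e g x a v) s (icost e + 1 + c * ?r) (icost e + 1 + ?r)
    (s\<lparr>rmem := (rmem s)(x := scatter {i. i < c \<and>
      bval s i g} (\<lambda>i. ival s i a) (\<lambda>i. rval s i v) (rmem s x))\<rparr>)"
    by (rule exec_ParR[OF assms(2) assms(3)[symmetric] _ _ _ assms(7)])
      (use assms in \<open>auto simp: active_def\<close>)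
  with w assms(8) show ?thesis unfolding run_def by fastforce
qed

lemma scatter_addr: "inj_on addr P \<Longrightarrow> i \<in> P \<Longrightarrow> scatter P addr v old (addr i) = v i"
  by (simp add: scatter_def the_inv_into_f_f)

lemma scatter_other: "a \<notin> addr ` P \<Longrightarrow> scatter P addr v old a = old a"
  by (simp add: scatter_def)

lemma scatter_id: "scatter P (\<lambda>i. i) v old = (\<lambda>a. if a \<in> P then v a else old a)"
proof
  fix a show "scatter P (\<lambda>i. i) v old a = (if a \<in> P then v a else old a)"
    using scatter_addr[of "\<lambda>i. i" P a v old] scatter_other[of a "\<lambda>i. i" P v old] by auto
qed

lemma scatter_Suc:
  "scatter P Suc v old = (\<lambda>a. if 0 < a \<and> a - 1 \<in> P then v (a - 1) else old a)"
proof
  fix a show "scatter P Suc v old a = (if 0 < a \<and> a - 1 \<in> P then v (a - 1) else old a)"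
    using scatter_addr[of Suc P "a - 1" v old] scatter_other[of a Suc P v old]
    by (cases a) auto
qed

section \<open>Scalar assignments and parallel maps\<close>

abbreviation TT :: bexp where "TT \<equiv> ILess (IConst 0) (IConst 1)"
abbreviation sc :: "nat \<Rightarrow> iexp" where "sc x \<equiv> ILoad x (IConst 0)"
abbreviation P1 :: iexp where "P1 \<equiv> IAdd Pid (IConst 1)"
abbreviation RN :: "nat \<Rightarrow> rexp" where "RN c \<equiv> ROfNat (IConst c)"

text \<open>The language has no sequential assignment: a scalar is cell 0 of an array, written by a
  parallel step with a single processor.\<close>

definition setI :: "nat \<Rightarrow> iexp \<Rightarrow> com" where
  "setI x v = ParI (IConst 1) TT x (IConst 0) v"
definition parI :: "iexp \<Rightarrow> bexp \<Rightarrow> nat \<Rightarrow> iexp \<Rightarrow> com" where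
  "parI e g x v = ParI e g x Pid v"
definition parR :: "iexp \<Rightarrow> bexp \<Rightarrow> nat \<Rightarrow> rexp \<Rightarrow> com" where
  "parR e g x v = ParR e g x Pid v"
text \<open>Processor \<open>e\<close> owns cell \<open>e + 1\<close>; cell 0 is never written in
  this way and stands for the value of an empty class.\<close>

definition parR1 :: "iexp \<Rightarrow> bexp \<Rightarrow> nat \<Rightarrow> rexp \<Rightarrow> com" where
  "parR1 e g x v = ParR e g x P1 v"

lemmas com_defs = setI_def parI_def parR_def parR1_def

lemma mods_simps [simp]:
  "imods (setI x v) = {x}" "rmods (setI x v) = {}"
  "imods (parI e g x v) = {x}" "rmods (parI e g x v) = {}"
  "imods (parR e g x w) = {}" "rmods (parR e g x w) = {x}"
  "imods (parR1 e g x w) = {}" "rmods (parR1 e g x w) = {x}"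
  by (simp_all add: com_defs)

lemma run_setI:
  assumes "1 \<le> N" "1 \<le> W" "ifits W s 0 v" "icost v + 7 \<le> D"
  shows "\<exists>t. run W N (setI x v) D s t \<and> imem t = (imem s)(x := (imem s x)(0 := ival s 0 v)) \<and>
    rmem t = rmem s"
proof -
  have "run W N (setI x v) D s
    (s\<lparr>imem := (imem s)(x := scatter {i. i < 1 \<and>
      bval s i TT} (\<lambda>i. ival s i (IConst 0)) (\<lambda>i. ival s i v) (imem s x))\<rparr>)"
    unfolding setI_def by (rule run_ParI[OF assms(1)]) (use assms in auto)
  moreover have "scatter {i. i < 1 \<and> bval s i TT} (\<lambda>i. ival s i (IConst 0)) (\<lambda>i. ival s i v) (imem s x)
      = (imem s x)(0 := ival s 0 v)"
  proof -
    have "{i. i < 1 \<and> bval s i TT} = {0::nat}" by auto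
    thus ?thesis
      using scatter_addr[of "\<lambda>i. 0::nat" "{0}" 0 "\<lambda>i. ival s i v" "imem s x"]
      by (auto simp: fun_eq_iff scatter_other)
  qed
  ultimately show ?thesis by fastforce
qed

lemma run_parI:
  assumes "1 \<le> N" "c \<le> W" "ifits W s 0 e" "ival s 0 e = c" "c \<le> N"
    "\<And>i. i < c \<Longrightarrow> bfits W s i g \<and> bval s i g = G i"
    "\<And>i. i < c \<Longrightarrow> G i \<Longrightarrow> ifits W s i v \<and> ival s i v = V i"
    "icost e + bcost g + icost v + 3 \<le> D"
  shows "\<exists>t. run W N (parI e g x v) D s t \<and> rmem t = rmem s \<and>
    imem t = (imem s)(x := (\<lambda>a. if a < c \<and> G a then V a else imem s x a))"
proof -
  have "run W N (parI e g x v) D s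
    (s\<lparr>imem := (imem s)(x := scatter {i. i < c \<and>
      bval s i g} (\<lambda>i. ival s i Pid) (\<lambda>i. ival s i v) (imem s x))\<rparr>)"
    unfolding parI_def by (rule run_ParI) (use assms in \<open>auto intro: inj_onI\<close>)
  moreover have "scatter {i. i < c \<and> bval s i g} (\<lambda>i. ival s i Pid) (\<lambda>i. ival s i v) (imem s x)
      = (\<lambda>a. if a < c \<and> G a then V a else imem s x a)"
    using assms(6,7) by (auto simp: fun_eq_iff scatter_id)
  ultimately show ?thesis by (intro exI) auto
qed

lemma run_parR:
  assumes "1 \<le> N" "c \<le> W" "ifits W s 0 e" "ival s 0 e = c" "c \<le> N"
    "\<And>i. i < c \<Longrightarrow> bfits W s i g \<and> bval s i g = G i"
    "\<And>i. i < c \<Longrightarrow> G i \<Longrightarrow> rfits W s i v \<and> rval s i v = V i"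
    "icost e + bcost g + rcost v + 3 \<le> D"
  shows "\<exists>t. run W N (parR e g x v) D s t \<and> imem t = imem s \<and>
    rmem t = (rmem s)(x := (\<lambda>a. if a < c \<and> G a then V a else rmem s x a))"
proof -
  have "run W N (parR e g x v) D s
    (s\<lparr>rmem := (rmem s)(x := scatter {i. i < c \<and>
      bval s i g} (\<lambda>i. ival s i Pid) (\<lambda>i. rval s i v) (rmem s x))\<rparr>)"
    unfolding parR_def by (rule run_ParR) (use assms in \<open>auto intro: inj_onI\<close>)
  moreover have "scatter {i. i < c \<and> bval s i g} (\<lambda>i. ival s i Pid) (\<lambda>i. rval s i v) (rmem s x)
      = (\<lambda>a. if a < c \<and> G a then V a else rmem s x a)"
    using assms(6,7) by (auto simp: fun_eq_iff scatter_id)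
  ultimately show ?thesis by (intro exI) auto
qed

lemma run_parR1:
  assumes "1 \<le> N" "c < W" "ifits W s 0 e" "ival s 0 e = c" "c \<le> N"
    "\<And>i. i < c \<Longrightarrow> bfits W s i g \<and> bval s i g = G i"
    "\<And>i. i < c \<Longrightarrow> G i \<Longrightarrow> rfits W s i v \<and> rval s i v = V i"
    "icost e + bcost g + rcost v + 5 \<le> D"
  shows "\<exists>t. run W N (parR1 e g x v) D s t \<and> imem t = imem s \<and>
    rmem t = (rmem s)(x := (\<lambda>a. if 0 < a \<and> a - 1 < c \<and> G (a - 1) then V (a - 1) else rmem s x a))"
proof -
  have "run W N (parR1 e g x v) D s
    (s\<lparr>rmem := (rmem s)(x := scatter {i. i < c \<and>
      bval s i g} (\<lambda>i. ival s i P1) (\<lambda>i. rval s i v) (rmem s x))\<rparr>)"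
    unfolding parR1_def by (rule run_ParR) (use assms in \<open>auto intro: inj_onI\<close>)
  moreover have S: "(\<lambda>i. ival s i P1) = Suc" by auto
  have "scatter {i. i < c \<and> bval s i g} (\<lambda>i. ival s i P1) (\<lambda>i. rval s i v) (rmem s x)
      = (\<lambda>a. if 0 < a \<and> a - 1 < c \<and> G (a - 1) then V (a - 1) else rmem s x a)"
    unfolding S scatter_Suc using assms(6,7) by (auto simp: fun_eq_iff)
  ultimately show ?thesis by (intro exI) auto
qed

section \<open>Counted loops and sums in logarithmic depth\<close>

definition for_loop :: "nat \<Rightarrow> nat \<Rightarrow> nat \<Rightarrow> com \<Rightarrow> com" where
  "for_loop l b pw c = Seq (setI b (IConst 0)) (Seq (setI pw (IConst 1))
     (While (ILess (sc b) (sc l))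
        (Seq c (Seq (setI b (IAdd (sc b) (IConst 1))) (setI pw (IMul (IConst 2) (sc pw)))))))"

lemma for_loop_mods [simp]:
  "imods (for_loop l b pw c) = imods c \<union> {b, pw}" "rmods (for_loop l b pw c) = rmods c"
  by (auto simp: for_loop_def)

text \<open>As there is no exponentiation, \<open>2 ^ b\<close> is kept in \<open>pw\<close> by
  doubling; bodies use it as an offset or as a class size. The assumption \<open>stable\<close> says
  that \<open>J\<close> ignores the two loop registers, so that their updates between rounds do not
  concern the caller.\<close>

lemma run_for:
  assumes N: "1 \<le> N" and W: "2 * 2 ^ L \<le> W"
    and dist: "b \<noteq> pw" "l \<noteq> b" "l \<noteq> pw" "b \<notin> imods c" "pw \<notin> imods c" "l \<notin> imods c"
    and init: "J 0 s" "imem s l 0 = L"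
    and stable: "\<And>i s s'. J i s \<Longrightarrow> (\<And>x. x \<noteq> b \<Longrightarrow> x \<noteq> pw \<Longrightarrow> imem s' x = imem s x) \<Longrightarrow>
        rmem s' = rmem s \<Longrightarrow> J i s'"
    and step: "\<And>i s. i < L \<Longrightarrow> J i s \<Longrightarrow> imem s b 0 = i \<Longrightarrow> imem s pw 0 = 2 ^ i \<Longrightarrow> imem s l 0 = L \<Longrightarrow>
        \<exists>t. run W N c D s t \<and> J (Suc i) t"
    and D': "22 + L * (D + 28) \<le> D'"
  shows "\<exists>t. run W N (for_loop l b pw c) D' s t \<and> J L t"
proof -
  have W1: "1 \<le> W" "2 \<le> W" "L < W"
    using W one_le_power[of "2::nat" L] less_exp[of L] by linarith+
  obtain s1 where s1: "run W N (setI b (IConst 0)) 8 s s1"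
      "imem s1 = (imem s)(b := (imem s b)(0 := 0))" "rmem s1 = rmem s"
    using run_setI[OF N W1(1), of s "IConst 0" 8 b] by auto
  obtain s2 where s2: "run W N (setI pw (IConst 1)) 8 s1 s2"
      "imem s2 = (imem s1)(pw := (imem s1 pw)(0 := 1))" "rmem s2 = rmem s1"
    using run_setI[OF N W1(1), of s1 "IConst 1" 8 pw] W1 by auto
  define K where "K i s \<longleftrightarrow> J i s \<and> imem s b 0 = i \<and> imem s pw 0 = 2 ^ i \<and> imem s l 0 = L" for i s
  have pwL: "i < L \<Longrightarrow> 2 * 2 ^ i \<le> W" for i
    using W power_increasing[of i L "2::nat"] by linarith
  have "\<exists>t. run W N (While (ILess (sc b) (sc l))
        (Seq c (Seq (setI b (IAdd (sc b) (IConst 1))) (setI pw (IMul (IConst 2) (sc pw))))))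
        (L * (D + 28) + 6) s2 t \<and> K L t"
  proof (rule run_While_count[OF N, where D = "D + 22"])
    show "K 0 s2" unfolding K_def
    proof (intro conjI)
      show "J 0 s2" by (rule stable[OF init(1)]) (auto simp: s1 s2)
    qed (use dist init in \<open>auto simp: s1 s2\<close>)
  next
    fix i s assume i: "i < L" and K: "K i s"
    hence K': "J i s" "imem s b 0 = i" "imem s pw 0 = 2 ^ i" "imem s l 0 = L" by (auto simp: K_def)
    obtain t where t: "run W N c D s t" "J (Suc i) t" using step[OF i K'] by blast
    have tf: "imem t b = imem s b" "imem t pw = imem s pw" "imem t l = imem s l"
      using run_imem[OF t(1)] dist by auto
    obtain t1 where t1: "run W N (setI b (IAdd (sc b) (IConst 1))) 11 t t1"
      "imem t1 = (imem t)(b := (imem t b)(0 := ival t 0 (IAdd (sc b) (IConst 1))))" "rmem t1 = rmem t"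
      using run_setI[OF N W1(1), of t "IAdd (sc b) (IConst 1)" 11 b] K' tf i W1 by (auto simp: le_simps)
    have tf1: "imem t1 pw = imem t pw" "imem t1 l = imem t l" using dist by (auto simp: t1)
    have "ifits W t1 0 (IMul (IConst 2) (sc pw))"
      using W1 pwL[OF i] K' tf tf1 by simp
    then obtain t2 where t2: "run W N (setI pw (IMul (IConst 2) (sc pw))) 11 t1 t2"
      "imem t2 = (imem t1)(pw := (imem t1 pw)(0 := ival t1 0 (IMul (IConst 2) (sc pw))))"
        "rmem t2 = rmem t1"
      using run_setI[OF N W1(1), of t1 "IMul (IConst 2) (sc pw)" 11 pw] by auto
    have "run W N (Seq c (Seq (setI b (IAdd (sc b) (IConst 1))) (setI pw (IMul (IConst 2) (sc pw)))))
        (D + 22) s t2"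
      by (rule run_Seq[OF t(1) run_Seq[OF t1(1) t2(1)], of 22]) auto
    moreover have "K (Suc i) t2" unfolding K_def
    proof (intro conjI)
      show "J (Suc i) t2" by (rule stable[OF t(2)]) (auto simp: t1 t2)
    qed (use dist K' tf in \<open>auto simp: t1 t2\<close>)
    moreover have "bfits W s 0 (ILess (sc b) (sc l)) \<and> bval s 0 (ILess (sc b) (sc l))"
      using K' i W1 by auto
    ultimately show "bfits W s 0 (ILess (sc b) (sc l)) \<and> bval s 0 (ILess (sc b) (sc l)) \<and>
      (\<exists>t. run W N (Seq c (Seq (setI b (IAdd (sc b) (IConst 1))) (setI pw (IMul (IConst 2) (sc pw)))))
        (D + 22) s t \<and> K (Suc i) t)" by blast
  next
    fix s assume "K L s"
    thus "bfits W s 0 (ILess (sc b) (sc l)) \<and> \<not> bval s 0 (ILess (sc b) (sc l))"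
      using W1 by (auto simp: K_def)
  qed simp
  then obtain t where t: "run W N (While (ILess (sc b) (sc l))
        (Seq c (Seq (setI b (IAdd (sc b) (IConst 1))) (setI pw (IMul (IConst 2) (sc pw))))))
        (L * (D + 28) + 6) s2 t" "J L t" by (auto simp: K_def)
  have "run W N (for_loop l b pw c) D' s t" unfolding for_loop_def
    by (rule run_Seq[OF s1(1) run_Seq[OF s2(1) t(1) order_refl]]) (use D' in simp)
  with t(2) show ?thesis by blast
qed

definition reduce :: "nat \<Rightarrow> nat \<Rightarrow> nat \<Rightarrow> iexp \<Rightarrow> nat \<Rightarrow> com" where
  "reduce l b pw e x = for_loop l b pw
     (parR e TT x (RAdd (RLoad x Pid) (RLoad x (IAdd Pid (sc pw)))))"

lemma reduce_mods [simp]: "imods (reduce l b pw e x) = {b, pw}" "rmods (reduce l b pw e x) = {x}"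
  by (auto simp: reduce_def)

lemma sum_lessThan_add: "(\<Sum>r<p + q. f r) = (\<Sum>r<p. f r) + (\<Sum>r<q. f (p + r :: nat))" for f :: "nat \<Rightarrow> real"
  by (induction q) auto

text \<open>Doubling of windows: before round \<open>i\<close> every cell \<open>a\<close> holds the
  sum of the \<open>2 ^ i\<close> original cells from \<open>a\<close> on. Reading past the end is
  harmless because the cells from \<open>c\<close> on are 0; they stay 0, so the array can be used
  for the next sum. After \<open>L\<close> rounds the window of cell 0 covers all
  \<open>c \<le> 2 ^ L\<close> summands.\<close>

lemma run_reduce:
  assumes N: "1 \<le> N" and W: "2 * 2 ^ L \<le> W" "c + 2 ^ L \<le> W"
    and dist: "b \<noteq> pw" "l \<noteq> b" "l \<noteq> pw"
    and init: "imem s l 0 = L" "\<And>a. c \<le> a \<Longrightarrow> rmem s x a = 0"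
    and c: "c \<le> N" "c \<le> 2 ^ L"
    and e: "\<And>s'. (\<And>y. y \<noteq> b \<Longrightarrow> y \<noteq> pw \<Longrightarrow> imem s' y = imem s y) \<Longrightarrow> ifits W s' 0 e \<and> ival s' 0 e = c"
    and D: "22 + L * (icost e + 50) \<le> D"
  shows "\<exists>t. run W N (reduce l b pw e x) D s t \<and> rmem t x 0 = (\<Sum>a<c. rmem s x a) \<and>
    (\<forall>a\<ge>c. rmem t x a = 0)"
proof -
  define f where "f = rmem s x"
  have f0: "c \<le> a \<Longrightarrow> f a = 0" for a using init by (simp add: f_def)
  define J where "J i s' \<longleftrightarrow> (\<forall>y. y \<noteq> b \<longrightarrow> y \<noteq> pw \<longrightarrow> imem s' y = imem s y) \<and>
     (\<forall>a. rmem s' x a = (\<Sum>r<2^i. f (a + r)))" for i :: nat and s' :: mem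
  have "\<exists>t. run W N (reduce l b pw e x) D s t \<and> J L t"
    unfolding reduce_def
  proof (rule run_for[OF N W(1) dist(1-3)])
    show "J 0 s" by (simp add: J_def f_def)
  next
    fix i and s' s'' :: mem assume "J i s'" "\<And>x. x \<noteq> b \<Longrightarrow> x \<noteq> pw \<Longrightarrow> imem s'' x = imem s' x"
      "rmem s'' = rmem s'"
    thus "J i s''" by (simp add: J_def)
  next
    fix i and s' :: mem assume i: "i < L" and J: "J i s'" and s': "imem s' b 0 = i"
      "imem s' pw 0 = 2 ^ i"
    have pw: "(2::nat) ^ i \<le> 2 ^ L" using i by (intro power_increasing) auto
    have ee: "ifits W s' 0 e" "ival s' 0 e = c" using e J by (auto simp: J_def)
    have W1: "1 \<le> W" using W one_le_power[of "2::nat" L] by linarith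
    have pwW: "2 ^ i \<le> W" "a < c \<Longrightarrow> a + 2 ^ i \<le> W" for a using pw W by linarith+
    have "\<exists>t. run W N (parR e TT x (RAdd (RLoad x Pid) (RLoad x (IAdd Pid (sc pw))))) (icost e +
      22) s' t \<and> imem t = imem s' \<and>
      rmem t = (rmem s')(x := (\<lambda>a. if a < c \<and>
        True then rmem s' x a + rmem s' x (a + 2 ^ i) else rmem s' x a))"
      by (rule run_parR[OF N _ ee(1,2)]) (use c W W1 s' pwW in auto)
    then obtain t where t: "run W N (parR e TT x (RAdd (RLoad x Pid) (RLoad x (IAdd Pid (sc pw)))))
      (icost e + 22) s' t"
        "imem t = imem s'"
        "rmem t = (rmem s')(x := (\<lambda>a. if a < c then rmem s' x a + rmem s' x (a +
          2 ^ i) else rmem s' x a))"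
      by auto
    have "rmem t x a = (\<Sum>r<2^Suc i. f (a + r))" for a
    proof -
      have "(\<Sum>r<2^Suc i. f (a + r)) = (\<Sum>r<2^i + 2^i. f (a + r))" by (simp add: mult_2)
      also have "\<dots> = (\<Sum>r<2^i. f (a + r)) + (\<Sum>r<2^i. f (a + 2 ^ i + r))"
        by (subst sum_lessThan_add) (simp add: add.assoc)
      finally have *: "(\<Sum>r<2^Suc i. f (a + r)) = (\<Sum>r<2^i. f (a + r)) + (\<Sum>r<2^i. f (a + 2 ^ i + r))" .
      show ?thesis
      proof (cases "a < c")
        case True thus ?thesis using J by (simp only: * J_def t) simp
      next
        case False
        hence "rmem t x a = (\<Sum>r<2^i. f (a + r))" using J by (simp add: t J_def)
        also have "\<dots> = 0" using False f0 by (intro sum.neutral) auto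
        also have "0 = (\<Sum>r<2^Suc i. f (a + r))" using False f0 by (intro sum.neutral[symmetric]) auto
        finally show ?thesis .
      qed
    qed
    hence "J (Suc i) t" using J t(2) by (simp add: J_def)
    with t(1) show "\<exists>t. run W N (parR e TT x (RAdd (RLoad x Pid) (RLoad x (IAdd Pid (sc pw)))))
      (icost e + 22) s' t \<and> J (Suc i) t"
      by blast
  qed (use init D in \<open>auto simp: add.commute\<close>)
  then obtain t where t: "run W N (reduce l b pw e x) D s t" "J L t" by blast
  have "rmem t x 0 = (\<Sum>r<2^L. f r)" using t by (simp add: J_def)
  also have "\<dots> = (\<Sum>r<c. f r)" using c f0 by (intro sum.mono_neutral_right) auto
  finally have "rmem t x 0 = (\<Sum>r<c. f r)" .
  moreover have "\<forall>a\<ge>c. rmem t x a = 0"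
    using t(2) f0 by (auto simp: J_def intro!: sum.neutral)
  ultimately show ?thesis using t(1) by (auto simp: f_def)
qed

section \<open>Column classes and their leaders\<close>

locale entries =
  fixes n m z :: nat and rw cl :: "nat \<Rightarrow> nat"
  assumes rw: "e < z \<Longrightarrow> rw e < m" and cl: "e < z \<Longrightarrow> cl e < n"
    and inj: "e < z \<Longrightarrow> e' < z \<Longrightarrow> rw e = rw e' \<Longrightarrow> cl e = cl e' \<Longrightarrow> e = e'"
begin

text \<open>At level \<open>b\<close>, the columns \<open>j\<close> of a row are grouped by \<open>j div 2 ^ b\<close>. The leader of a nonempty
  class is one of its entries, shifted by one so that 0 means that the class is empty.\<close>

definition cls :: "nat \<Rightarrow> nat \<Rightarrow> nat \<Rightarrow> nat set" where
  "cls b i c = {e. e < z \<and> rw e = i \<and> cl e div 2 ^ b = c}"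

fun lead :: "nat \<Rightarrow> nat \<Rightarrow> nat \<Rightarrow> nat" where
  "lead 0 i c = (if cls 0 i c = {} then 0 else Suc (the_elem (cls 0 i c)))"
| "lead (Suc b) i c = (if lead b i (2 * c) \<noteq> 0 then lead b i (2 * c) else lead b i (2 * c + 1))"

lemma finite_cls [simp]: "finite (cls b i c)"
  unfolding cls_def by (rule finite_subset[of _ "{..<z}"]) auto

lemma cls_Suc: "cls (Suc b) i c = cls b i (2 * c) \<union> cls b i (2 * c + 1)"
proof -
  have half: "x div 2 = c \<longleftrightarrow> x = 2 * c \<or> x = 2 * c + 1" for x :: nat by presburger
  have "j div 2 ^ Suc b = c \<longleftrightarrow> j div 2 ^ b = 2 * c \<or> j div 2 ^ b = 2 * c + 1" for j :: nat
    unfolding power_Suc2 div_mult2_eq by (rule half)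
  thus ?thesis by (auto simp: cls_def)
qed

lemma cls_disjoint: "c \<noteq> c' \<Longrightarrow> cls b i c \<inter> cls b i c' = {}"
  by (auto simp: cls_def)

lemma cls_0: assumes "e < z" shows "cls 0 (rw e) (cl e) = {e}"
  using assms inj by (auto simp: cls_def)

lemma lead_cases: "(lead b i c = 0 \<and> cls b i c = {}) \<or> (\<exists>e\<in>cls b i c. lead b i c = Suc e)"
proof (induction b arbitrary: c)
  case 0
  show ?case
  proof (cases "cls 0 i c = {}")
    case False
    then obtain e where "e \<in> cls 0 i c" by blast
    hence "cls 0 i c = {e}" using cls_0 by (auto simp: cls_def)
    thus ?thesis by simp
  qed simp
next
  case (Suc b)
  show ?case using Suc[of "2 * c"] Suc[of "2 * c + 1"] by (auto simp: cls_Suc)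
qed

lemma lead_eq_0: "lead b i c = 0 \<longleftrightarrow> cls b i c = {}"
  using lead_cases[of b i c] by auto

lemma lead_SucD: "lead b i c = Suc e \<Longrightarrow> e < z \<and> rw e = i \<and> cl e div 2 ^ b = c"
  using lead_cases[of b i c] by (auto simp: cls_def)

lemma lead_0_entry: "e < z \<Longrightarrow> lead 0 (rw e) (cl e) = Suc e"
  using cls_0[of e] by simp

lemma lead_le: "lead b i c \<le> z"
  using lead_SucD[of b i c] by (cases "lead b i c") (auto simp: Suc_le_eq)

lemma lead_out: "n \<le> c \<Longrightarrow> b = 0 \<or> n \<le> c \<Longrightarrow> lead b i c = 0"
proof (rule ccontr)
  assume "n \<le> c" "lead b i c \<noteq> 0"
  then obtain e where "lead b i c = Suc e" by (cases "lead b i c") auto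
  hence "e < z" "cl e div 2 ^ b = c" using lead_SucD by auto
  thus False using cl[of e] \<open>n \<le> c\<close> div_le_dividend[of "cl e" "2 ^ b"] by linarith
qed

lemma cls_out: "n \<le> c \<Longrightarrow> cls b i c = {}"
  using lead_out[of c b i] by (simp add: lead_eq_0)

lemma cls_root: assumes "n \<le> 2 ^ L" shows "cls L i 0 = {e. e < z \<and> rw e = i}"
proof -
  have "e < z \<Longrightarrow> cl e div 2 ^ L = 0" for e
    using cl[of e] assms by (intro div_less) simp
  thus ?thesis by (auto simp: cls_def)
qed

lemma class_lt: "e < z \<Longrightarrow> cl e div 2 ^ b < n"
  using cl[of e] div_le_dividend[of "cl e" "2 ^ b"] by linarith

text \<open>These are the processors that act in a merge: each one absorbs the odd class to its
  right, whose leader is \<open>sib b e\<close>.\<close>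

definition left_leader :: "nat \<Rightarrow> nat \<Rightarrow> bool" where
  "left_leader b e \<longleftrightarrow> lead b (rw e) (cl e div 2 ^ b) = Suc e \<and> even (cl e div 2 ^ b)"

definition sib :: "nat \<Rightarrow> nat \<Rightarrow> nat" where
  "sib b e = lead b (rw e) (cl e div 2 ^ b + 1)"

text \<open>Values live at leaders. If the even class is nonempty, its leader goes on leading and
  fetches the value of the odd sibling; an empty sibling has leader 0, and cell 0 holds the value of
  the empty set. If the even class is empty, leader and value of the odd class are inherited
  untouched. The form with arbitrary \<open>f\<close> and \<open>g\<close> serves both sums and
  maxima.\<close>

lemma merge_step:
  assumes V: "\<And>i c. V (lead b i c) = g (cls b i c)"
    and g: "\<And>i c. g (cls b i (2 * c) \<union> cls b i (2 * c + 1))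
      = f (g (cls b i (2 * c))) (g (cls b i (2 * c + 1)))"
    and V': "\<And>e. e < z \<Longrightarrow> V' (Suc e)
      = (if left_leader b e then f (V (Suc e)) (V (sib b e)) else V (Suc e))"
      "V' 0 = V 0"
  shows "V' (lead (Suc b) i c) = g (cls (Suc b) i c)"
proof (cases "lead b i (2 * c)")
  case (Suc e)
  hence e: "e < z" "rw e = i" "cl e div 2 ^ b = 2 * c" using lead_SucD by auto
  hence "left_leader b e" "sib b e = lead b i (2 * c + 1)" using Suc
    by (auto simp: left_leader_def sib_def)
  thus ?thesis using Suc e V'(1)[of e] g[of i c] V[of i "2 * c"] V[of i "2 * c + 1"]
    by (simp add: cls_Suc)
next
  case 0
  hence 1: "lead (Suc b) i c = lead b i (2 * c + 1)" "cls b i (2 * c) = {}"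
    by (simp_all add: lead_eq_0[symmetric])
  have "V' (lead b i (2 * c + 1)) = V (lead b i (2 * c + 1))"
  proof (cases "lead b i (2 * c + 1)")
    case (Suc e)
    hence "e < z" "\<not> left_leader b e" using lead_SucD[of b i "2*c+1" e] by (auto simp: left_leader_def)
    thus ?thesis using Suc V'(1)[of e] by simp
  qed (use V' in simp)
  thus ?thesis using 1 V[of i "2 * c + 1"] by (simp add: cls_Suc)
qed

text \<open>The left side is what the machine can compute with one processor per entry, the right
  side is the sum over pairs of sibling classes that the analysis needs. A nonempty even class has
  exactly one leader, which gives the bijection.\<close>

lemma sum_left_leaders:
  fixes f :: "nat \<Rightarrow> nat \<Rightarrow> real"
  shows "(\<Sum>e<z. if left_leader b e then f (rw e) (cl e div 2 ^ b) else 0) =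
    (\<Sum>i<m. \<Sum>c<n. if lead b i (2 * c) = 0 then 0 else f i (2 * c))"
proof -
  have "(\<Sum>e<z. if left_leader b e then f (rw e) (cl e div 2 ^ b) else 0)
      = (\<Sum>e\<in>{e. e < z \<and> left_leader b e}. f (rw e) (cl e div 2 ^ b))"
    by (simp add: sum.If_cases Int_def)
  also have "\<dots> = (\<Sum>(i, c)\<in>{(i, c). i < m \<and> c < n \<and> lead b i (2 * c) \<noteq> 0}. f i (2 * c))"
  proof (rule sum.reindex_bij_witness[of _ "\<lambda>(i, c). lead b i (2 * c) - 1"
        "\<lambda>e. (rw e, cl e div 2 ^ b div 2)"], goal_cases)
    case (1 e) thus ?case by (auto simp: left_leader_def)
  next
    case (2 e)
    hence "e < z" by simp
    from class_lt[OF this, of b] have "cl e div 2 ^ b div 2 < n" by linarith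
    thus ?case using 2 rw by (auto simp: left_leader_def)
  next
    case (3 ic)
    then obtain i c e where "ic = (i, c)" "lead b i (2 * c) = Suc e"
      by (cases ic; cases "lead b (fst ic) (2 * snd ic)") auto
    thus ?case using lead_SucD[of b i "2 * c" e] by auto
  next
    case (4 ic)
    then obtain i c e where "ic = (i, c)" "lead b i (2 * c) = Suc e"
      by (cases ic; cases "lead b (fst ic) (2 * snd ic)") auto
    thus ?case using lead_SucD[of b i "2 * c" e] by (auto simp: left_leader_def)
  next
    case (5 e) thus ?case by (auto simp: left_leader_def)
  qed
  also have "\<dots> = (\<Sum>(i, c)\<in>{..<m} \<times> {..<n}. if lead b i (2 * c) = 0 then 0 else f i (2 * c))"
    by (rule sum.mono_neutral_cong_left) (auto split: if_splits)
  also have "\<dots> = (\<Sum>i<m. \<Sum>c<n. if lead b i (2 * c) = 0 then 0 else f i (2 * c))"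
    by (simp add: sum.cartesian_product)
  finally show ?thesis .
qed

text \<open>Pairs with index below \<open>n\<close> reach up to class \<open>2 * n\<close>; the
  surplus classes are empty in the applications and contribute 0.\<close>

lemma sum_pairs:
  fixes f :: "nat \<Rightarrow> real"
  assumes "\<And>c. n \<le> c \<Longrightarrow> f c = 0"
  shows "(\<Sum>c<n. f (2 * c) + f (2 * c + 1)) = (\<Sum>c<n. f c)"
proof -
  have "(\<Sum>c<N. f (2 * c) + f (2 * c + 1)) = (\<Sum>c<2 * N. f c)" for N :: nat
    by (induction N) auto
  also have "(\<Sum>c<2 * n. f c) = (\<Sum>c<n. f c)"
    by (rule sum.mono_neutral_right) (use assms in auto)
  finally show ?thesis .
qed

text \<open>Flipping the sign of all odd classes changes only the cross term in
  \<open>(u (2 c) + u (2 c + 1))\<^sup>2\<close>; hence one of the two choices does not increase the sum of squares.\<close>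

lemma sum_squares_merge:
  fixes u v :: "nat \<Rightarrow> nat \<Rightarrow> real" and w1 w2 :: "nat \<Rightarrow> real" and r :: real
  assumes out: "\<And>i c. n \<le> c \<Longrightarrow> u i c = 0" "\<And>i c. n \<le> c \<Longrightarrow> v i c = 0"
    and r: "r\<^sup>2 = 1"
    and cross: "r * (\<Sum>i<m. \<Sum>c<n. w1 i * (u i (2 * c) * u i (2 * c + 1)) +
        w2 i * (v i (2 * c) * v i (2 * c + 1))) \<le> 0"
  shows "(\<Sum>i<m. \<Sum>c<n. w1 i * (u i (2 * c) + r * u i (2 * c + 1))\<^sup>2 + w2 i * (v i (2 * c) +
    r * v i (2 * c + 1))\<^sup>2)
    \<le> (\<Sum>i<m. \<Sum>c<n. w1 i * (u i c)\<^sup>2 + w2 i * (v i c)\<^sup>2)" (is "?L \<le> ?R")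
proof -
  let ?g = "\<lambda>i c. w1 i * (u i c)\<^sup>2 + w2 i * (v i c)\<^sup>2"
  have R: "?R = (\<Sum>i<m. \<Sum>c<n. ?g i (2 * c) + ?g i (2 * c + 1))"
    by (rule sum.cong[OF refl]) (rule sum_pairs[symmetric], simp add: out)
  have "w1 i * (x + r * y)\<^sup>2 + w2 i * (x' + r * y')\<^sup>2
      = ((w1 i * x\<^sup>2 + w2 i * x'\<^sup>2) + (w1 i * y\<^sup>2 + w2 i * y'\<^sup>2)) + 2 * r * (w1 i * (x * y) +
        w2 i * (x' * y'))"
    for i x y x' y'
  proof -
    have "w1 i * (x + r * y)\<^sup>2 + w2 i * (x' + r * y')\<^sup>2
      = w1 i * x\<^sup>2 + w2 i * x'\<^sup>2 + r\<^sup>2 * (w1 i * y\<^sup>2 + w2 i * y'\<^sup>2) + 2 * r * (w1 i * (x * y) +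
        w2 i * (x' * y'))"
      by algebra
    thus ?thesis using r by simp
  qed
  hence "?L = ?R + 2 * (r * (\<Sum>i<m. \<Sum>c<n. w1 i * (u i (2 * c) * u i (2 * c + 1)) +
        w2 i * (v i (2 * c) * v i (2 * c + 1))))"
    unfolding R by (simp add: sum.distrib[symmetric] sum_distrib_left mult.assoc)
  thus ?thesis using cross by linarith
qed

end

section \<open>The table of leaders\<close>

text \<open>
  Memory layout. Integer arrays: 5 holds \<open>L\<close>, 7 the level \<open>b\<close> of the innermost loop over levels and 6 the power
  \<open>2 ^ b\<close>, 9 and 8 the same for reductions, 10 the step counter, 11 the number \<open>E\<close>, 12 the number of
  steps, 13 the table of leaders and 14 the integral parts of the scaled exponents.
  Real arrays: 1 holds the current point (initially \<open>p\<close>), 3 the column potentials, 4 the step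
  sizes, 5 the signs, 6 to 8 values at entries or classes (entry \<open>e\<close> at \<open>e + 1\<close>, and 0 at address 0 for
  empty classes), 9 the cross terms, 10 the means, 11 the maxima, 12 the rates \<open>l\<close>,
  13 and 14 the row potentials \<open>U\<close> and \<open>D\<close>, 15 the deviations, 16 and 17 the weights of the quadratic
  form, 18 to 20 the row sums of arrays 6 to 8, and 21 and 22 the linear terms deciding the global sign.
\<close>

abbreviation nn :: iexp where "nn \<equiv> ILoad 0 (IConst 0)"
abbreviation mm :: iexp where "mm \<equiv> ILoad 0 (IConst 1)"
abbreviation kk :: iexp where "kk \<equiv> ILoad 0 (IConst 2)"
abbreviation zz :: iexp where "zz \<equiv> ILoad 0 (IConst 3)"
abbreviation ROW :: iexp where "ROW \<equiv> ILoad 1 Pid"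
abbreviation COL :: iexp where "COL \<equiv> ILoad 2 Pid"

definition eqE :: "iexp \<Rightarrow> iexp \<Rightarrow> bexp" where
  "eqE a b = BAnd (BNot (ILess a b)) (BNot (ILess b a))"
definition evenE :: "iexp \<Rightarrow> bexp" where
  "evenE c = ILess (ISub c (IMul (IConst 2) (IDiv c (IConst 2)))) (IConst 1)"

definition clsE :: iexp where "clsE = IDiv COL (sc 6)"
definition keyE :: iexp where
  "keyE = IAdd (IMul (IAdd (IMul (sc 7) mm) ROW) (IAdd nn (IConst 1))) clsE"
definition keyE1 :: iexp where
  "keyE1 = IAdd (IMul (IAdd (IMul (IAdd (sc 7) (IConst 1)) mm) ROW) (IAdd nn (IConst 1)))
     (IDiv COL (IMul (IConst 2) (sc 6)))"
definition rootE :: iexp where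
  "rootE = ILoad 13 (IMul (IAdd (IMul (sc 5) mm) Pid) (IAdd nn (IConst 1)))"
definition sibE :: iexp where "sibE = ILoad 13 (IAdd keyE (IConst 1))"
definition leadG :: bexp where "leadG = BAnd (eqE (ILoad 13 keyE) P1) (evenE clsE)"
definition survG :: bexp where
  "survG = BAnd (eqE (ILoad 13 keyE) P1)
     (BNot (BAnd (BNot (evenE clsE)) (ILess (IConst 0) (ILoad 13 (ISub keyE (IConst 1))))))"

text \<open>The table has \<open>(L + 1) * m * (n + 1)\<close> cells, too many to be cleared within
  the work bound. Only cells of nonempty classes are written, with at most one write per entry and
  level; all others rely on the memory being 0 at the start.\<close>

definition tab_init :: com where
  "tab_init = Seq (setI 7 (IConst 0)) (Seq (setI 6 (IConst 1)) (Seq (ParI zz TT 13 keyE P1)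
     (for_loop 5 7 6 (ParI zz survG 13 keyE1 P1))))"

definition merge :: "nat \<Rightarrow> com" where
  "merge x = parR1 zz leadG x (RAdd (RLoad x P1) (RLoad x sibE))"
definition merge_max :: "nat \<Rightarrow> com" where
  "merge_max x = parR1 zz (BAnd leadG (RLess (RLoad x P1) (RLoad x sibE))) x (RLoad x sibE)"

lemma merge_mods [simp]: "imods (merge x) = {}" "rmods (merge x) = {x}"
  "imods (merge_max x) = {}" "rmods (merge_max x) = {x}"
  by (auto simp: merge_def merge_max_def)

lemma tab_init_mods [simp]: "imods tab_init = {6, 7, 13}" "rmods tab_init = {}"
  by (auto simp: tab_init_def)

lemma costs [simp]: "icost clsE = 5" "icost keyE = 19" "icost keyE1 = 23" "icost rootE = 13"
    "icost sibE = 22" "bcost leadG = 69" "bcost survG = 96" "bcost (evenE c) = 2 * icost c + 7"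
  by (auto simp: clsE_def keyE_def keyE1_def rootE_def sibE_def leadG_def survG_def eqE_def evenE_def)

lemma evenE_val: "bval s i (evenE c) \<longleftrightarrow> even (ival s i c)"
  by (simp add: evenE_def) presburger

lemma eqE_val: "bval s i (eqE a b) \<longleftrightarrow> ival s i a = ival s i b"
  by (auto simp: eqE_def)

lemma evenE_fits: "ifits W s i c \<Longrightarrow> ival s i c \<le> W \<Longrightarrow> 2 \<le> W \<Longrightarrow> bfits W s i (evenE c)"
  by (auto simp: evenE_def)

lemma eqE_fits: "bfits W s i (eqE a b) \<longleftrightarrow> ifits W s i a \<and> ifits W s i b"
  by (auto simp: eqE_def)

text \<open>\<open>W_key\<close> covers the addresses of the table of leaders, \<open>W_pow\<close>
  the powers kept by loops, \<open>W_512\<close> the literal constants and \<open>W_steps\<close>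
  the number of rounding steps. The factor 64 in the choice of \<open>L\<close> is spent at the end:
  it makes the coordinates close enough to 0 or 1 and the rows with the largest admissible
  \<open>h\<close> negligible.\<close>

locale machine = entries +
  fixes k L W N :: nat
  assumes npos: "0 < n" and mpos: "0 < m"
    and L: "64 * n * m \<le> 2 ^ L" and znm: "z \<le> n * m"
    and W_key: "(L + 1) * m * (n + 1) \<le> W" and W_pow: "2 * 2 ^ L \<le> W" and W_512: "512 \<le> W"
    and W_steps: "12 * (32 * (k + L)) * (32 * (k + L)) * L + 1 \<le> W"
    and N: "1 \<le> N" "n \<le> N" "m \<le> N" "z \<le> N"
begin

text \<open>Rows have \<open>n + 1\<close> cells, so that the right neighbour of the last class is not in the next row.\<close>

definition key :: "nat \<Rightarrow> nat \<Rightarrow> nat \<Rightarrow> nat" where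
  "key b i c = (b * m + i) * (n + 1) + c"

definition env :: "mem \<Rightarrow> bool" where
  "env s \<longleftrightarrow> imem s 0 0 = n \<and> imem s 0 (Suc 0) = m \<and> imem s 0 2 = k \<and> imem s 0 3 = z \<and>
     (\<forall>e<z. imem s (Suc 0) e = rw e) \<and> (\<forall>e<z. imem s 2 e = cl e) \<and> imem s 5 0 = L"

definition level :: "mem \<Rightarrow> nat \<Rightarrow> bool" where
  "level s b \<longleftrightarrow> env s \<and> imem s 7 0 = b \<and> imem s 6 0 = 2 ^ b"

definition tab :: "mem \<Rightarrow> bool" where
  "tab s \<longleftrightarrow> (\<forall>b\<le>L. \<forall>i<m. \<forall>c\<le>n. imem s 13 (key b i c) = lead b i c) \<and> (\<forall>a. imem s 13 a \<le> z)"

lemma env_cong: "env s \<Longrightarrow> (\<And>x. x \<in> {0, Suc 0, 2, 5} \<Longrightarrow> imem t x = imem s x) \<Longrightarrow> env t"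
  by (simp add: env_def)

lemma two_pow_L: "n \<le> 2 ^ L" "m \<le> 2 ^ L" "z \<le> 2 ^ L" "64 \<le> (2::nat) ^ L"
proof -
  have "n * 1 \<le> n * m" "1 * m \<le> n * m" using npos mpos by (intro mult_le_mono; simp)+
  moreover have "1 * 1 \<le> n * m" using npos mpos by (intro mult_le_mono; simp)
  moreover have "64 * (n * m) \<le> 2 ^ L" using L by (simp only: mult.assoc)
  ultimately show "n \<le> 2 ^ L" "m \<le> 2 ^ L" "z \<le> 2 ^ L" "64 \<le> (2::nat) ^ L" using znm by linarith+
qed

lemma W_small: "n < W" "m < W" "z < W" "2 ^ L < W" "L < W" "k \<le> W"
    "n + 2 ^ L \<le> W" "m + 2 ^ L \<le> W" "z + 2 ^ L \<le> W"
proof -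
  have L0: "1 \<le> L" using two_pow_L(4) by (cases L) auto
  have "k + L \<le> 12 * (32 * (k + L)) * (32 * (k + L)) * L"
  proof -
    have "1 * (k + L) * 1 * 1 \<le> (12 * (32 * (k + L))) * (32 * (k + L)) * L"
      using L0 by (intro mult_le_mono) auto
    thus ?thesis by simp
  qed
  thus "k \<le> W" using W_steps by linarith
  show "n < W" "m < W" "z < W" "2 ^ L < W" "L < W" "n + 2 ^ L \<le> W" "m + 2 ^ L \<le> W" "z + 2 ^ L \<le> W"
    using two_pow_L W_pow less_exp[of L] by linarith+
qed

lemma two_pow_W: "b \<le> L \<Longrightarrow> 2 * 2 ^ b \<le> W" "b \<le> L \<Longrightarrow> 2 ^ b \<le> W"
proof -
  assume "b \<le> L"
  hence "(2::nat) ^ b \<le> 2 ^ L" by (intro power_increasing) auto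
  thus "2 * 2 ^ b \<le> W" "2 ^ b \<le> W" using W_pow by linarith+
qed

lemma key_bound:
  assumes "b \<le> L" "i < m" "c \<le> n"
  shows "key b i c \<le> W" "(b * m + i) * (n + 1) \<le> W" "b * m + i \<le> W" "b * m \<le> W"
proof -
  have "b * m \<le> L * m" using assms by (intro mult_le_mono1)
  hence "b * m + i + 1 \<le> (L + 1) * m" using assms unfolding add_mult_distrib by linarith
  hence "(b * m + i + 1) * (n + 1) \<le> (L + 1) * m * (n + 1)" by (rule mult_le_mono1)
  hence *: "(b * m + i) * (n + 1) + (n + 1) \<le> W" using W_key by (simp only: add_mult_distrib mult_1)
  thus "key b i c \<le> W" using assms unfolding key_def by linarith
  show "(b * m + i) * (n + 1) \<le> W" using * by linarith
  have "b * m + i \<le> (b * m + i) * (n + 1)" by simp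
  thus 1: "b * m + i \<le> W" using * by (meson add_leD1 le_trans)
  show "b * m \<le> W" using 1 by simp
qed

text \<open>Mixed radix representation: \<open>c\<close> is recovered modulo \<open>n + 1\<close>,
  then \<open>i\<close> modulo \<open>m\<close>. Injectivity is what makes the writes to the table
  exclusive.\<close>

lemma key_inj:
  assumes "key b i c = key b' i' c'" "i < m" "i' < m" "c \<le> n" "c' \<le> n"
  shows "b = b' \<and> i = i' \<and> c = c'"
proof -
  have "c mod (n + 1) = c' mod (n + 1)"
    using arg_cong[OF assms(1), of "\<lambda>x. x mod (n + 1)"] unfolding key_def mod_mult_self3 .
  hence 1: "c = c'" using assms by simp
  hence "(b * m + i) * (n + 1) = (b' * m + i') * (n + 1)" using assms(1) unfolding key_def
    by (simp only: add_right_cancel)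
  hence 2: "b * m + i = b' * m + i'" by (simp only: mult_cancel2) simp
  have "i = i'" using arg_cong[OF 2, of "\<lambda>x. x mod m"] assms unfolding mod_mult_self3 by simp
  moreover hence "b = b'" using 2 mpos by simp
  ultimately show ?thesis using 1 by simp
qed

lemma clsE_eval:
  assumes "level s b" "b \<le> L" "e < z"
  shows "ifits W s e clsE" "ival s e clsE = cl e div 2 ^ b"
  using assms cl[of e] W_small two_pow_W(2)[of b] W_512 by (auto simp: clsE_def level_def env_def)

lemma clsE_le: "level s b \<Longrightarrow> b \<le> L \<Longrightarrow> e < z \<Longrightarrow> ival s e clsE \<le> W"
  using clsE_eval(2) class_lt[of e b] W_small by simp

lemma keyE_eval:
  assumes "level s b" "b \<le> L" "e < z"
  shows "ifits W s e keyE" "ival s e keyE = key b (rw e) (cl e div 2 ^ b)"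
proof -
  note c = clsE_eval[OF assms] and f = class_lt[OF assms(3), of b] rw[OF assms(3)]
  note kb = key_bound[OF assms(2) f(2), of "cl e div 2 ^ b"]
  show "ival s e keyE = key b (rw e) (cl e div 2 ^ b)"
    using assms c by (simp add: keyE_def key_def level_def env_def)
  show "ifits W s e keyE"
    using assms c f kb W_small W_512 by (simp add: keyE_def key_def level_def env_def)
qed

lemma keyE1_eval:
  assumes "level s b" "b < L" "e < z"
  shows "ifits W s e keyE1" "ival s e keyE1 = key (Suc b) (rw e) (cl e div 2 ^ Suc b)"
proof -
  note f = class_lt[OF assms(3), of "Suc b"] rw[OF assms(3)] cl[OF assms(3)]
  have b: "Suc b \<le> L" using assms by simp
  note kb = key_bound[OF b f(2), of "cl e div 2 ^ Suc b"] two_pow_W(1)[of b] two_pow_W(2)[of b]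
  show "ival s e keyE1 = key (Suc b) (rw e) (cl e div 2 ^ Suc b)"
    using assms by (simp add: keyE1_def key_def level_def env_def)
  show "ifits W s e keyE1"
    using assms f kb W_small W_512 by (simp add: keyE1_def key_def level_def env_def)
qed

lemma tab_key: "tab s \<Longrightarrow> b \<le> L \<Longrightarrow> i < m \<Longrightarrow> c \<le> n \<Longrightarrow> imem s 13 (key b i c) = lead b i c"
  by (simp add: tab_def)

lemma sibE_eval:
  assumes "level s b" "b \<le> L" "e < z" "tab s"
  shows "ifits W s e sibE" "ival s e sibE = sib b e"
proof -
  note c = keyE_eval[OF assms(1-3)] and f = class_lt[OF assms(3), of b] rw[OF assms(3)]
  have k: "key b (rw e) (cl e div 2 ^ b) + 1 = key b (rw e) (cl e div 2 ^ b + 1)"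
    by (simp add: key_def)
  have v: "imem s 13 (key b (rw e) (cl e div 2 ^ b + 1)) = sib b e"
    using tab_key[OF assms(4,2) f(2)] f(1) by (simp add: sib_def)
  show "ival s e sibE = sib b e" using k v c by (simp add: sibE_def)
  have "sib b e \<le> z" by (simp add: sib_def lead_le)
  moreover have "key b (rw e) (cl e div 2 ^ b + 1) \<le> W" using key_bound(1)[OF assms(2) f(2)] f(1) by simp
  ultimately show "ifits W s e sibE"
    using c k v W_small W_512 by (simp add: sibE_def)
qed

lemma leadG_eval:
  assumes "level s b" "b \<le> L" "e < z" "tab s"
  shows "bfits W s e leadG" "bval s e leadG = left_leader b e"
proof -
  note c = keyE_eval[OF assms(1-3)] clsE_eval[OF assms(1-3)] and f
    = class_lt[OF assms(3), of b] rw[OF assms(3)]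
  have v: "imem s 13 (key b (rw e) (cl e div 2 ^ b)) = lead b (rw e) (cl e div 2 ^ b)"
    using tab_key[OF assms(4,2) f(2)] f(1) by simp
  show "bval s e leadG = left_leader b e"
    using c v by (simp add: leadG_def evenE_val eqE_val left_leader_def)
  have "lead b (rw e) (cl e div 2 ^ b) \<le> W" using lead_le W_small by (meson le_trans less_imp_le)
  thus "bfits W s e leadG"
    using c v W_small W_512 assms(3) f clsE_le[OF assms(1-3)]
    by (auto simp: leadG_def eqE_fits intro!: evenE_fits)
qed

lemma rootE_eval:
  assumes "env s" "tab s" "i < m"
  shows "ifits W s i rootE" "ival s i rootE = lead L i 0"
proof -
  have v: "imem s 13 ((L * m + i) * Suc n) = lead L i 0"
    using tab_key[OF assms(2) order_refl assms(3), of 0] by (simp add: key_def)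
  show "ival s i rootE = lead L i 0"
    using assms v by (simp add: rootE_def env_def)
  have "lead L i 0 \<le> W" using lead_le W_small by (meson le_trans less_imp_le)
  thus "ifits W s i rootE"
    using assms v W_small W_512 key_bound[OF order_refl assms(3), of 0] by (simp add: rootE_def env_def)
qed

lemma zz_eval: "env s \<Longrightarrow> ifits W s i zz" "env s \<Longrightarrow> ival s i zz = z"
  and mm_eval: "env s \<Longrightarrow> ifits W s i mm" "env s \<Longrightarrow> ival s i mm = m"
  and nn_eval: "env s \<Longrightarrow> ifits W s i nn" "env s \<Longrightarrow> ival s i nn = n"
  using W_small W_512 by (auto simp: env_def)

lemma level_env: "level s b \<Longrightarrow> env s" by (simp add: level_def)

lemma run_merge:
  assumes "level s b" "b \<le> L" "tab s"
  shows "\<exists>t. run W N (merge x) 200 s t \<and> imem t = imem s \<and>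
    rmem t = (rmem s)(x := (\<lambda>a. if 0 < a \<and> a - 1 < z \<and> left_leader b (a - 1)
      then (\<lambda>e. rmem s x (Suc e) + rmem s x (sib b e)) (a - 1) else rmem s x a))"
  unfolding merge_def
  by (rule run_parR1[OF N(1) W_small(3) zz_eval(1)[OF level_env] zz_eval(2)[OF level_env] N(4)])
    (use assms leadG_eval sibE_eval W_small W_512 in auto)

lemma run_merge_max:
  assumes "level s b" "b \<le> L" "tab s"
  shows "\<exists>t. run W N (merge_max x) 200 s t \<and> imem t = imem s \<and>
    rmem t = (rmem s)(x := (\<lambda>a. if 0 < a \<and> a - 1 < z \<and>
        (\<lambda>e. left_leader b e \<and> rmem s x (Suc e) < rmem s x (sib b e)) (a - 1)
      then (\<lambda>e. rmem s x (sib b e)) (a - 1) else rmem s x a))"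
  unfolding merge_max_def
  by (rule run_parR1[OF N(1) W_small(3) zz_eval(1)[OF level_env] zz_eval(2)[OF level_env] N(4)])
    (use assms leadG_eval sibE_eval W_small W_512 in auto)

text \<open>Because \<open>lead (Suc b)\<close> prefers the even half, an entry can decide whether
  it still leads by looking at one neighbouring cell of the table. Hence each level of the table
  takes a single parallel step over the entries.\<close>

lemma survive_iff:
  assumes "e < z"
  shows "lead (Suc b) (rw e) (cl e div 2 ^ Suc b) = Suc e \<longleftrightarrow>
    lead b (rw e) (cl e div 2 ^ b) = Suc e \<and>
      (even (cl e div 2 ^ b) \<or> lead b (rw e) (cl e div 2 ^ b - 1) = 0)"
proof -
  define c where "c = cl e div 2 ^ b"
  have S: "cl e div 2 ^ Suc b = c div 2" by (simp add: c_def power_Suc2 div_mult2_eq del: power_Suc)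
  have cD: "lead b (rw e) c' = Suc e \<Longrightarrow> c' = c" for c' using lead_SucD by (simp add: c_def)
  show ?thesis
  proof (cases "even c")
    case True
    hence "2 * (c div 2) = c" by simp
    thus ?thesis using True cD[of "c + 1"] by (auto simp: S c_def[symmetric] simp del: power_Suc)
  next
    case False
    hence "2 * (c div 2) = c - 1" "2 * (c div 2) + 1 = c" "c - 1 \<noteq> c" by presburger+
    thus ?thesis using False cD[of "c - 1"] by (auto simp: S c_def[symmetric] simp del: power_Suc)
  qed
qed

lemma survG_eval:
  assumes "level s b" "b \<le> L" "e < z"
    and T: "\<And>i c. i < m \<Longrightarrow> c \<le> n \<Longrightarrow> imem s 13 (key b i c) = lead b i c" "\<And>a. imem s 13 a \<le> z"
  shows "bfits W s e survG" "bval s e survG \<longleftrightarrow> lead (Suc b) (rw e) (cl e div 2 ^ Suc b) = Suc e"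
proof -
  note c = keyE_eval[OF assms(1-3)] clsE_eval[OF assms(1-3)] and f
    = class_lt[OF assms(3), of b] rw[OF assms(3)]
  have v: "imem s 13 (key b (rw e) (cl e div 2 ^ b)) = lead b (rw e) (cl e div 2 ^ b)"
    using T f by simp
  have v': "odd (cl e div 2 ^ b) \<Longrightarrow> imem s 13 (key b (rw e) (cl e div 2 ^ b) - Suc 0)
    = lead b (rw e) (cl e div 2 ^ b - 1)"
  proof -
    assume "odd (cl e div 2 ^ b)"
    hence "0 < cl e div 2 ^ b" by (intro Nat.gr0I) auto
    hence "key b (rw e) (cl e div 2 ^ b) - Suc 0 = key b (rw e) (cl e div 2 ^ b - 1)"
      by (simp add: key_def)
    thus ?thesis using T(1)[OF f(2), of "cl e div 2 ^ b - 1"] f(1) by simp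
  qed
  have "bval s e survG \<longleftrightarrow> lead b (rw e) (cl e div 2 ^ b) = Suc e \<and>
      (even (cl e div 2 ^ b) \<or> lead b (rw e) (cl e div 2 ^ b - 1) = 0)"
  proof (cases "even (cl e div 2 ^ b)")
    case True thus ?thesis using c v by (simp add: survG_def evenE_val eqE_val)
  next
    case False thus ?thesis using c v v'[OF False] by (simp add: survG_def evenE_val eqE_val)
  qed
  thus "bval s e survG \<longleftrightarrow> lead (Suc b) (rw e) (cl e div 2 ^ Suc b) = Suc e"
    unfolding survive_iff[OF assms(3)] .
  \<comment> \<open>The word bound applies to both sides of a conjunction, so the left neighbour is
    also read for even classes, where it may be a cell of another row; hence a bound for arbitrary
    addresses.\<close>
  have "imem s 13 a \<le> W" for a using T(2)[of a] W_small by linarith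
  moreover have "lead b (rw e) (cl e div 2 ^ b) \<le> W" using lead_le W_small
    by (meson le_trans less_imp_le)
  ultimately show "bfits W s e survG"
    using c v W_small W_512 assms(3) f clsE_le[OF assms(1-3)]
    by (auto simp: survG_def eqE_fits intro!: evenE_fits)
qed

lemma run_tab_init:
  assumes env: "env s" and zero: "imem s 13 = (\<lambda>_. 0)"
  shows "\<exists>t. run W N tab_init (200 + L * 200) s t \<and> tab t"
proof -
  obtain s1 where s1: "run W N (setI 7 (IConst 0)) 8 s s1"
      "imem s1 = (imem s)(7 := (imem s 7)(0 := 0))" "rmem s1 = rmem s"
    using run_setI[OF N(1), of W s "IConst 0" 8 7] W_512 by auto
  obtain s2 where s2: "run W N (setI 6 (IConst 1)) 8 s1 s2"
      "imem s2 = (imem s1)(6 := (imem s1 6)(0 := 1))" "rmem s2 = rmem s1"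
    using run_setI[OF N(1), of W s1 "IConst 1" 8 6] W_512 by auto
  have env2: "env s2" by (rule env_cong[OF env]) (auto simp: s1 s2)
  have lev2: "level s2 0" using env2 by (simp add: level_def s1 s2)
  have addr: "ival s2 e keyE = key 0 (rw e) (cl e)" if "e < z" for e
    using keyE_eval(2)[OF lev2 _ that] by simp
  have inj2: "inj_on (\<lambda>i. ival s2 i keyE) {i. i < z \<and> bval s2 i TT}"
  proof (rule inj_onI)
    fix x y assume xy: "x \<in> {i. i < z \<and> bval s2 i TT}" "y \<in> {i. i < z \<and> bval s2 i TT}"
      "ival s2 x keyE = ival s2 y keyE"
    hence "key 0 (rw x) (cl x) = key 0 (rw y) (cl y)" by (simp add: addr)
    from key_inj[OF this] xy rw cl inj show "x = y" by (auto simp: less_imp_le)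
  qed
  define T0 where "T0 = scatter {i. i < z \<and>
    bval s2 i TT} (\<lambda>i. ival s2 i keyE) (\<lambda>i. ival s2 i P1) (imem s2 13)"
  define s3 where "s3 = s2\<lparr>imem := (imem s2)(13 := T0)\<rparr>"
  have s3: "run W N (ParI zz TT 13 keyE P1) 30 s2 s3"
    unfolding s3_def T0_def
    by (rule run_ParI[OF N(1) zz_eval(1)[OF env2] zz_eval(2)[OF env2] N(4) _ _ inj2])
      (use lev2 keyE_eval W_small W_512 in auto)
  have T0: "T0 (key 0 i c) = lead 0 i c" if "i < m" "c \<le> n" for i c
  proof (cases "lead 0 i c")
    case (Suc e)
    hence e: "e < z" "rw e = i" "cl e = c" using lead_SucD[of 0 i c e] by auto
    have "T0 (ival s2 e keyE) = ival s2 e P1"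
      unfolding T0_def by (rule scatter_addr[OF inj2]) (use e in auto)
    thus ?thesis using addr[OF e(1)] e Suc by simp
  next
    case 0
    have "key 0 i c \<notin> (\<lambda>i. ival s2 i keyE) ` {i. i < z \<and> bval s2 i TT}"
    proof
      assume "key 0 i c \<in> (\<lambda>i. ival s2 i keyE) ` {i. i < z \<and> bval s2 i TT}"
      then obtain e where e: "e < z" "key 0 i c = key 0 (rw e) (cl e)" using addr by auto
      with key_inj[OF e(2)] that rw cl have "i = rw e" "c = cl e" by (auto simp: less_imp_le)
      thus False using 0 lead_0_entry[OF e(1)] by simp
    qed
    thus ?thesis using 0 zero unfolding T0_def by (simp add: scatter_other s1 s2)
  qed
  have T0': "T0 (key b i c) = 0" if "b \<noteq> 0" "i < m" "c \<le> n" for b i c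
  proof -
    have "key b i c \<notin> (\<lambda>i. ival s2 i keyE) ` {i. i < z \<and> bval s2 i TT}"
    proof
      assume "key b i c \<in> (\<lambda>i. ival s2 i keyE) ` {i. i < z \<and> bval s2 i TT}"
      then obtain e where e: "e < z" "key b i c = key 0 (rw e) (cl e)" using addr by auto
      with key_inj[OF e(2)] that rw cl show False by (auto simp: less_imp_le)
    qed
    thus ?thesis using zero unfolding T0_def by (simp add: scatter_other s1 s2)
  qed
  have T0z: "T0 a \<le> z" for a
  proof (cases "a \<in> (\<lambda>i. ival s2 i keyE) ` {i. i < z \<and> bval s2 i TT}")
    case True
    then obtain e where e: "e < z" "a = ival s2 e keyE" by auto
    have "T0 (ival s2 e keyE) = ival s2 e P1"
      unfolding T0_def by (rule scatter_addr[OF inj2]) (use e in auto)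
    thus ?thesis using e by simp
  next
    case False thus ?thesis using zero unfolding T0_def by (simp add: scatter_other s1 s2)
  qed
  \<comment> \<open>The levels above \<open>b\<close> have to be known to be 0, since later rounds
    write only the cells of nonempty classes there.\<close>
  define J where "J b s \<longleftrightarrow> env s \<and> (\<forall>b' i c. i < m \<longrightarrow> c \<le> n \<longrightarrow>
      imem s 13 (key b' i c) = (if b' \<le> b then lead b' i c else 0)) \<and>
        (\<forall>a. imem s 13 a \<le> z)" for b and s :: mem
  have "\<exists>t. run W N (for_loop 5 7 6 (ParI zz survG 13 keyE1 P1)) (22 + L * (140 + 28)) s3 t \<and> J L t"
  proof (rule run_for[OF N(1) W_pow])
    show "J 0 s3" unfolding J_def
    proof (intro conjI)
      show "env s3" by (rule env_cong[OF env2]) (auto simp: s3_def)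
    qed (use T0 T0' T0z in \<open>auto simp: s3_def\<close>)
    thus "imem s3 5 0 = L" by (simp add: J_def env_def)
  next
    fix i and s s' :: mem
    assume a: "J i s" "\<And>x. x \<noteq> 7 \<Longrightarrow> x \<noteq> 6 \<Longrightarrow> imem s' x = imem s x"
    have "env s'" by (rule env_cong[of s]) (use a in \<open>auto simp: J_def\<close>)
    thus "J i s'" using a by (auto simp: J_def)
  next
    fix b and s :: mem
    assume b: "b < L" and J: "J b s" and s: "imem s 7 0 = b" "imem s 6 0 = 2 ^ b"
    have env: "env s" using J by (simp add: J_def)
    have lev: "level s b" using env s by (simp add: level_def)
    define G where "G e \<longleftrightarrow> lead (Suc b) (rw e) (cl e div 2 ^ Suc b) = Suc e" for e
    have T: "\<And>i c. i < m \<Longrightarrow> c \<le> n \<Longrightarrow> imem s 13 (key b i c) = lead b i c" "\<And>a. imem s 13 a \<le> z"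
      using J by (auto simp: J_def)
    note sG = survG_eval[OF lev less_imp_le[OF b] _ T]
    have P: "{e. e < z \<and> bval s e survG} = {e. e < z \<and> G e}" using sG by (auto simp: G_def)
    define A where "A e = ival s e keyE1" for e
    have addr: "A e = key (Suc b) (rw e) (cl e div 2 ^ Suc b)" if "e < z" for e
      using keyE1_eval(2)[OF lev b that] by (simp add: A_def)
    have cle: "e < z \<Longrightarrow> cl e div 2 ^ Suc b \<le> n" for e using class_lt[of e "Suc b"] by simp
    \<comment> \<open>Exclusive writes: a surviving entry is the leader of its class at the next
      level, and a class has one leader.\<close>
    have injA: "inj_on A {e. e < z \<and> G e}"
    proof (rule inj_onI)
      fix x y assume xy: "x \<in> {e. e < z \<and> G e}" "y \<in> {e. e < z \<and> G e}" "A x = A y"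
      hence "key (Suc b) (rw x) (cl x div 2 ^ Suc b) = key (Suc b) (rw y) (cl y div 2 ^ Suc b)"
        by (simp add: addr del: power_Suc)
      from key_inj[OF this] xy rw cle have "rw x = rw y" "cl x div 2 ^ Suc b = cl y div 2 ^ Suc b"
        by (auto simp del: power_Suc)
      thus "x = y" using xy by (simp add: G_def del: power_Suc lead.simps)
    qed
    define T1 where "T1 = scatter {e. e < z \<and> G e} A (\<lambda>i. ival s i P1) (imem s 13)"
    define t where "t = s\<lparr>imem := (imem s)(13 := T1)\<rparr>"
    have "run W N (ParI zz survG 13 keyE1 P1) 140 s
      (s\<lparr>imem := (imem s)(13 := scatter {i. i < z \<and>
        bval s i survG} (\<lambda>i. ival s i keyE1) (\<lambda>i. ival s i P1) (imem s 13))\<rparr>)"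
      by (rule run_ParI[OF N(1) zz_eval(1)[OF env] zz_eval(2)[OF env] N(4)])
        (use sG(1) keyE1_eval[OF lev b] W_small W_512 injA P in \<open>auto simp: A_def[abs_def]\<close>)
    hence run: "run W N (ParI zz survG 13 keyE1 P1) 140 s t"
      unfolding t_def T1_def P A_def[abs_def] .
    have T1other: "T1 (key b' i c) = imem s 13 (key b' i c)" if "i < m" "c \<le> n"
      "b' = Suc b \<Longrightarrow> lead (Suc b) i c = 0" for b' i c
    proof -
      have "key b' i c \<notin> A ` {e. e < z \<and> G e}"
      proof
        assume "key b' i c \<in> A ` {e. e < z \<and> G e}"
        then obtain e where e: "e < z" "G e" "key b' i c = key (Suc b) (rw e) (cl e div 2 ^ Suc b)"
          using addr by auto
        with key_inj[OF e(3)] that(1,2) rw cle have "b' = Suc b" "i = rw e"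
          "c = cl e div 2 ^ Suc b" by auto
        thus False using that(3) e(2) by (simp add: G_def del: power_Suc lead.simps)
      qed
      thus ?thesis unfolding T1_def by (rule scatter_other)
    qed
    have T1lead: "T1 (key (Suc b) i c) = lead (Suc b) i c" if "i < m" "c \<le> n" for i c
    proof (cases "lead (Suc b) i c")
      case (Suc e)
      hence e: "e < z" "rw e = i" "cl e div 2 ^ Suc b = c" using lead_SucD[of "Suc b" i c e] by auto
      have "G e" using e Suc by (simp add: G_def del: power_Suc lead.simps)
      hence "T1 (A e) = ival s e P1"
        unfolding T1_def by (intro scatter_addr[OF injA]) (use e in auto)
      thus ?thesis using addr[OF e(1)] e Suc by (simp del: power_Suc lead.simps)
    next
      case 0
      thus ?thesis using T1other[OF that, of "Suc b"] J that by (simp add: J_def)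
    qed
    have T1z: "T1 a \<le> z" for a
    proof (cases "a \<in> A ` {e. e < z \<and> G e}")
      case True
      then obtain e where e: "e < z" "G e" "a = A e" by auto
      have "T1 (A e) = ival s e P1"
        unfolding T1_def by (intro scatter_addr[OF injA]) (use e in auto)
      thus ?thesis using e by simp
    next
      case False thus ?thesis using T(2) unfolding T1_def by (simp add: scatter_other)
    qed
    have "J (Suc b) t" unfolding J_def
    proof (intro conjI allI impI)
      show "env t" by (rule env_cong[OF env]) (auto simp: t_def)
      fix b' i c assume ic: "i < m" "c \<le> n"
      show "imem t 13 (key b' i c) = (if b' \<le> Suc b then lead b' i c else 0)"
      proof (cases "b' = Suc b")
        case True thus ?thesis using T1lead[OF ic] by (simp add: t_def)
      next
        case False
        thus ?thesis using T1other[OF ic, of b'] J ic by (auto simp: t_def J_def)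
      qed
    qed (use T1z in \<open>auto simp: t_def\<close>)
    with run show "\<exists>t. run W N (ParI zz survG 13 keyE1 P1) 140 s t \<and> J (Suc b) t" by blast
  qed auto
  then obtain t where t: "run W N (for_loop 5 7 6 (ParI zz survG 13 keyE1 P1)) (22 + L * (140 +
    28)) s3 t" "J L t"
    by blast
  have "run W N tab_init (200 + L * 200) s t" unfolding tab_init_def
    by (rule run_Seq[OF s1(1) run_Seq[OF s2(1) run_Seq[OF s3 t(1) order_refl] order_refl]]) simp
  moreover have "tab t" using t(2) by (simp add: tab_def J_def)
  ultimately show ?thesis by blast
qed

end

section \<open>Signs with small row sums\<close>

text \<open>All columns whose digit \<open>b\<close> is set change sign together: array 5 receives
  the new column signs, arrays 6 and 7 the matching class sums. The sums of squares in array 8 carry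
  no sign.\<close>

definition flip :: com where
  "flip = Seq (parR1 zz (BNot (evenE clsE)) 6 (RSub (RN 0) (RLoad 6 P1)))
    (Seq (parR1 zz (BNot (evenE clsE)) 7 (RSub (RN 0) (RLoad 7 P1)))
      (parR nn (BNot (evenE (IDiv Pid (sc 6)))) 5 (RSub (RN 0) (RLoad 5 Pid))))"

definition cross :: com where
  "cross = Seq (parR zz TT 9 (RN 0))
    (Seq (parR zz leadG 9
        (RAdd (RMul (RLoad 16 ROW) (RMul (RLoad 6 P1) (RLoad 6 sibE)))
              (RMul (RLoad 17 ROW) (RMul (RLoad 7 P1) (RLoad 7 sibE)))))
      (reduce 5 9 8 zz 9))"

definition sign_step :: com where
  "sign_step = Seq cross (Seq (If (RLess (RN 0) (RLoad 9 (IConst 0))) flip Skip)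
     (Seq (merge 6) (Seq (merge 7) (merge 8))))"

definition signs :: com where
  "signs = for_loop 5 7 6 sign_step"

lemma sign_mods [simp]: "imods flip = {}" "rmods flip = {5, 6, 7}"
  "imods cross = {8, 9}" "rmods cross = {9}"
  "imods sign_step = {8, 9}" "rmods sign_step = {5, 6, 7, 8, 9}"
  "imods signs = {6, 7, 8, 9}" "rmods signs = {5, 6, 7, 8, 9}"
  by (auto simp: flip_def cross_def sign_step_def signs_def)

context machine
begin

definition ents :: "nat \<Rightarrow> nat set" where "ents i = {e. e < z \<and> rw e = i}"

lemma finite_ents [simp]: "finite (ents i)"
  unfolding ents_def by (rule finite_subset[of _ "{..<z}"]) auto

lemma cls_root_ents: "cls L i 0 = ents i"
  using cls_root[OF two_pow_L(1)] by (simp add: ents_def)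

lemma sum_ents: "(\<Sum>i<m. \<Sum>e\<in>ents i. f e) = (\<Sum>e<z. f e)" for f :: "nat \<Rightarrow> real"
proof -
  have "(\<Sum>i<m. \<Sum>e\<in>{e\<in>{..<z}. rw e = i}. f e) = (\<Sum>e<z. f e)"
    by (rule sum.group) (use rw in auto)
  thus ?thesis by (simp add: ents_def)
qed

text \<open>At level 0 every nonempty class is a single entry, so the quadratic form is diagonal
  there. This is the value that the search for signs must not exceed.\<close>

lemma sum_leaves: "(\<Sum>i<m. \<Sum>c<n. w i * (\<Sum>e\<in>cls 0 i c. f e)\<^sup>2) = (\<Sum>e<z. w (rw e) * (f e)\<^sup>2)"
  for f w :: "nat \<Rightarrow> real"
proof -
  have 1: "w i * (\<Sum>e\<in>cls 0 i c. f e)\<^sup>2 = (\<Sum>e\<in>cls 0 i c. w (rw e) * (f e)\<^sup>2)" for i c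
  proof (cases "cls 0 i c = {}")
    case False
    then obtain e where "e \<in> cls 0 i c" by blast
    hence "cls 0 i c = {e}" "rw e = i" using cls_0 by (auto simp: cls_def)
    thus ?thesis by simp
  qed simp
  have "(\<Sum>c<n. \<Sum>e\<in>{e\<in>ents i. cl e = c}. w (rw e) * (f e)\<^sup>2) = (\<Sum>e\<in>ents i. w (rw e) * (f e)\<^sup>2)" for i
    by (rule sum.group) (use cl in \<open>auto simp: ents_def\<close>)
  moreover have "{e\<in>ents i. cl e = c} = cls 0 i c" for i c by (auto simp: ents_def cls_def)
  ultimately have "(\<Sum>i<m. \<Sum>c<n. w i * (\<Sum>e\<in>cls 0 i c. f e)\<^sup>2) = (\<Sum>i<m. \<Sum>e\<in>ents i. w (rw e) * (f e)\<^sup>2)"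
    by (simp add: 1)
  thus ?thesis by (simp add: sum_ents)
qed

lemma run_cross:
  assumes lev: "level s b" and b: "b < L" and tab: "tab s"
    and Z: "\<And>a. z \<le> a \<Longrightarrow> rmem s 9 a = 0"
  shows "\<exists>t. run W N cross (190 + 52 * L) s t \<and> (\<forall>a\<ge>z. rmem t 9 a = 0) \<and>
    rmem t 9 0 = (\<Sum>e<z. if left_leader b e then
       rmem s 16 (rw e) * (rmem s 6 (Suc e) * rmem s 6 (sib b e)) +
       rmem s 17 (rw e) * (rmem s 7 (Suc e) * rmem s 7 (sib b e)) else 0)"
proof -
  note env = level_env[OF lev]
  have bL: "b \<le> L" using b by simp
  have "\<exists>t. run W N (parR zz TT 9 (RN 0)) 10 s t \<and> imem t = imem s \<and>
    rmem t = (rmem s)(9 := (\<lambda>a. if a < z \<and> (\<lambda>_. True) a then (\<lambda>_. 0) a else rmem s 9 a))"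
    by (rule run_parR[OF N(1) less_imp_le[OF W_small(3)] zz_eval(1)[OF env] zz_eval(2)[OF env] N(4)])
      (use W_512 in auto)
  then obtain s1 where s1: "run W N (parR zz TT 9 (RN 0)) 10 s s1" "imem s1 = imem s"
    "rmem s1 = (rmem s)(9 := (\<lambda>a. if a < z then 0 else rmem s 9 a))" by auto
  have lev1: "level s1 b" and tab1: "tab s1" using lev tab by (auto simp: level_def env_def tab_def s1)
  note env1 = level_env[OF lev1]
  define F where "F e = rmem s 16 (rw e) * (rmem s 6 (Suc e) * rmem s 6 (sib b e)) +
       rmem s 17 (rw e) * (rmem s 7 (Suc e) * rmem s 7 (sib b e))" for e
  let ?v = "RAdd (RMul (RLoad 16 ROW) (RMul (RLoad 6 P1) (RLoad 6 sibE)))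
              (RMul (RLoad 17 ROW) (RMul (RLoad 7 P1) (RLoad 7 sibE)))"
  have row: "e < z \<Longrightarrow> ifits W s1 e ROW \<and> ival s1 e ROW = rw e" for e
    using env1 rw[of e] W_small by (auto simp: env_def)
  have rwW: "e < z \<Longrightarrow> rw e \<le> W" for e using rw[of e] W_small by simp
  have "\<exists>t. run W N (parR zz leadG 9 ?v) 139 s1 t \<and> imem t = imem s1 \<and>
    rmem t = (rmem s1)(9 := (\<lambda>a. if a < z \<and> left_leader b a then F a else rmem s1 9 a))"
    by (rule run_parR[OF N(1) less_imp_le[OF W_small(3)] zz_eval(1)[OF env1] zz_eval(2)[OF env1] N(4)])
      (use leadG_eval[OF lev1 bL _ tab1] sibE_eval[OF lev1 bL _ tab1] W_small W_512 row rwW in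
        \<open>auto simp: F_def s1(3)\<close>)
  then obtain s2 where s2: "run W N (parR zz leadG 9 ?v) 139 s1 s2" "imem s2 = imem s1"
    "rmem s2 = (rmem s1)(9 := (\<lambda>a. if a < z \<and> left_leader b a then F a else rmem s1 9 a))"
    by blast
  have env2: "env s2" using env1 by (auto simp: env_def s2)
  have "\<exists>t. run W N (reduce 5 9 8 zz 9) (30 + 52 * L) s2 t \<and> rmem t 9 0 = (\<Sum>a<z. rmem s2 9 a) \<and>
    (\<forall>a\<ge>z. rmem t 9 a = 0)"
  proof (rule run_reduce[OF N(1) W_pow W_small(9)])
    fix s' :: mem assume "\<And>y. y \<noteq> 9 \<Longrightarrow> y \<noteq> 8 \<Longrightarrow> imem s' y = imem s2 y"
    hence "env s'" by (intro env_cong[OF env2]) auto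
    thus "ifits W s' 0 zz \<and> ival s' 0 zz = z" using zz_eval by simp
  qed (use env2 Z N two_pow_L in \<open>auto simp: env_def s2 s1\<close>)
  then obtain t where t: "run W N (reduce 5 9 8 zz 9) (30 + 52 * L) s2 t"
    "rmem t 9 0 = (\<Sum>a<z. rmem s2 9 a)"
    "\<forall>a\<ge>z. rmem t 9 a = 0" by blast
  have "run W N cross (190 + 52 * L) s t" unfolding cross_def
    by (rule run_Seq[OF s1(1) run_Seq[OF s2(1) t(1) order_refl]]) simp
  moreover have "(\<Sum>a<z. rmem s2 9 a) = (\<Sum>e<z. if left_leader b e then F e else 0)"
    by (rule sum.cong) (auto simp: s1 s2)
  ultimately show ?thesis using t unfolding F_def by (intro exI[of _ t]) simp
qed

lemma run_flip:
  assumes lev: "level s b" and b: "b < L"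
  shows "\<exists>t. run W N flip 100 s t \<and>
    (\<forall>x\<in>{6,7}. rmem t x = (\<lambda>a. if 0 < a \<and> a - 1 < z \<and>
      odd (cl (a - 1) div 2 ^ b) then - rmem s x a else rmem s x a)) \<and>
    rmem t 5 = (\<lambda>j. if j < n \<and> odd (j div 2 ^ b) then - rmem s 5 j else rmem s 5 j)"
proof -
  have bL: "b \<le> L" using b by simp
  have G: "bfits W s' e (BNot (evenE clsE)) \<and> bval s' e (BNot (evenE clsE)) = odd (cl e div 2 ^ b)"
    if "level s' b" "e < z" for s' e
    using clsE_eval[OF that(1) bL that(2)] clsE_le[OF that(1) bL that(2)] W_512
    by (auto simp: evenE_val intro!: evenE_fits)
  have 1: "\<exists>t. run W N (parR1 zz (BNot (evenE clsE)) x (RSub (RN 0) (RLoad x P1))) 33 s' t \<and>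
    imem t = imem s' \<and>
    rmem t = (rmem s')(x := (\<lambda>a. if 0 < a \<and> a - 1 < z \<and> (\<lambda>e. odd (cl e div 2 ^ b)) (a - 1)
      then (\<lambda>e. - rmem s' x (Suc e)) (a - 1) else rmem s' x a))" if lev': "level s' b" for s' x
    by (rule run_parR1[OF N(1) W_small(3) zz_eval(1)[OF level_env[OF lev']] zz_eval(2)[OF
      level_env[OF lev']] N(4)])
      (use G[OF lev'] W_small W_512 in auto)
  obtain s1 where s1: "run W N (parR1 zz (BNot (evenE clsE)) 6 (RSub (RN 0) (RLoad 6 P1))) 33 s s1"
    "imem s1 = imem s" "rmem s1 = (rmem s)(6 := (\<lambda>a. if 0 < a \<and> a - 1 < z \<and> odd (cl (a - 1) div 2 ^ b)
      then - rmem s 6 (Suc (a - 1)) else rmem s 6 a))" using 1[OF lev, of 6] by blast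
  have lev1: "level s1 b" using lev by (auto simp: level_def env_def s1)
  obtain s2 where s2: "run W N (parR1 zz (BNot (evenE clsE)) 7 (RSub (RN 0) (RLoad 7 P1))) 33 s1 s2"
    "imem s2 = imem s1" "rmem s2 = (rmem s1)(7 := (\<lambda>a. if 0 < a \<and> a - 1 < z \<and> odd (cl (a - 1) div 2 ^ b)
      then - rmem s1 7 (Suc (a - 1)) else rmem s1 7 a))" using 1[OF lev1, of 7] by blast
  have lev2: "level s2 b" using lev1 by (auto simp: level_def env_def s2)
  note env2 = level_env[OF lev2]
  have E: "ifits W s2 j (IDiv Pid (sc 6))" "ival s2 j (IDiv Pid (sc 6)) = j div 2 ^ b"
      "ival s2 j (IDiv Pid (sc 6)) \<le> W" if "j < n" for j
    using lev2 that W_small W_512 two_pow_W(2)[OF bL] le_trans[OF div_le_dividend[of j "2 ^ b"], of W]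
    by (auto simp: level_def)
  have "\<exists>t. run W N (parR nn (BNot (evenE (IDiv Pid (sc 6)))) 5 (RSub (RN 0) (RLoad 5 Pid))) 30 s2
    t \<and> imem t = imem s2 \<and>
    rmem t = (rmem s2)(5 := (\<lambda>j. if j < n \<and> odd (j div 2 ^ b) then - rmem s2 5 j else rmem s2 5 j))"
  proof (rule run_parR[OF N(1) less_imp_le[OF W_small(1)] nn_eval(1)[OF env2] nn_eval(2)[OF env2]
    N(2)], goal_cases)
    case (1 j)
    thus ?case using E[OF 1] W_512 by (auto simp: evenE_val intro!: evenE_fits)
  qed (use W_small in auto)
  then obtain s3 where s3: "run W N (parR nn (BNot (evenE (IDiv Pid (sc 6)))) 5 (RSub (RN 0) (RLoad
    5 Pid))) 30 s2 s3"
    "imem s3 = imem s2" "rmem s3 = (rmem s2)(5 := (\<lambda>j. if j < n \<and>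
      odd (j div 2 ^ b) then - rmem s2 5 j else rmem s2 5 j))"
    by auto
  have "run W N flip 100 s s3" unfolding flip_def
    by (rule run_Seq[OF s1(1) run_Seq[OF s2(1) s3(1) order_refl]]) simp
  thus ?thesis by (intro exI[of _ s3]) (auto simp: s1 s2 s3 fun_eq_iff)
qed

text \<open>The greedy choice of the sign of one binary digit: the tested cell holds the cross term,
  which flipping all odd classes negates.\<close>

lemma run_flip_if:
  assumes lev: "level s b" and b: "b < L"
  shows "\<exists>t (r::real). run W N (If (RLess (RN 0) (RLoad 9 (IConst 0))) flip Skip) 106 s t \<and>
    (r = 1 \<or> r = -1) \<and> r * rmem s 9 0 \<le> 0 \<and>
    (\<forall>x\<in>{6,7}. (\<forall>e<z. rmem t x (Suc e)
      = (if odd (cl e div 2 ^ b) then r else 1) * rmem s x (Suc e)) \<and> rmem t x 0 = rmem s x 0) \<and>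
    (\<forall>j<n. rmem t 5 j = (if odd (j div 2 ^ b) then r else 1) * rmem s 5 j)"
proof (cases "0 < rmem s 9 0")
  case True
  obtain t where t: "run W N flip 100 s t"
    "\<forall>x\<in>{6,7}. rmem t x = (\<lambda>a. if 0 < a \<and> a - 1 < z \<and>
      odd (cl (a - 1) div 2 ^ b) then - rmem s x a else rmem s x a)"
    "rmem t 5 = (\<lambda>j. if j < n \<and> odd (j div 2 ^ b) then - rmem s 5 j else rmem s 5 j)"
    using run_flip[OF lev b] by blast
  have "run W N (If (RLess (RN 0) (RLoad 9 (IConst 0))) flip Skip) 106 s t"
    by (rule run_If[OF N(1), of _ _ _ _ 100]) (use t True in auto)
  thus ?thesis using t True by (intro exI[of _ t] exI[of _ "-1"]) auto
next
  case False
  have "run W N (If (RLess (RN 0) (RLoad 9 (IConst 0))) flip Skip) 106 s s"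
    by (rule run_If[OF N(1), of _ _ _ _ 100]) (use False run_Skip in auto)
  thus ?thesis using False by (intro exI[of _ s] exI[of _ 1]) auto
qed

lemma run_merge_sum:
  assumes "level s b" "b \<le> L" "tab s"
    and V: "\<And>i c. rmem s x (lead b i c) = (\<Sum>e\<in>cls b i c. f e)"
  shows "\<exists>t. run W N (merge x) 200 s t \<and> imem t = imem s \<and> (\<forall>y. y \<noteq> x \<longrightarrow> rmem t y = rmem s y) \<and>
    (\<forall>i c. rmem t x (lead (Suc b) i c) = (\<Sum>e\<in>cls (Suc b) i c. f e))"
proof -
  obtain t where t: "run W N (merge x) 200 s t" "imem t = imem s"
    "rmem t = (rmem s)(x := (\<lambda>a. if 0 < a \<and> a - 1 < z \<and> left_leader b (a - 1)
      then rmem s x (Suc (a - 1)) + rmem s x (sib b (a - 1)) else rmem s x a))"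
    using run_merge[OF assms(1-3), of x] by blast
  have "rmem t x (lead (Suc b) i c) = (\<Sum>e\<in>cls (Suc b) i c. f e)" for i c
  proof (rule merge_step[where V = "rmem s x" and f = "(+)", OF V])
    fix i c show "sum f (cls b i (2 * c) \<union> cls b i (2 * c + 1))
      = sum f (cls b i (2 * c)) + sum f (cls b i (2 * c + 1))"
      by (rule sum.union_disjoint) (use cls_disjoint[of "2 * c" "2 * c + 1"] in auto)
  qed (auto simp: t)
  thus ?thesis using t by (intro exI[of _ t] conjI allI) (simp_all del: lead.simps)
qed

text \<open>\<open>fx\<close> and \<open>fy\<close> are unsigned entry values, \<open>w1\<close> and
  \<open>w2\<close> row weights; \<open>fv\<close> is summed along the same tree without signs. The
  product form of the signs is not recorded: \<open>\<sigma>\<close> only has to agree with array 5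
  and with the signed class sums. The last conjunct compares the form at level \<open>b\<close> with
  its diagonal value at level 0.\<close>

definition sign_inv :: "nat \<Rightarrow> (nat \<Rightarrow> real) \<Rightarrow> (nat \<Rightarrow> real) \<Rightarrow> (nat \<Rightarrow> real) \<Rightarrow>
    (nat \<Rightarrow> real) \<Rightarrow> (nat \<Rightarrow> real) \<Rightarrow> mem \<Rightarrow> (nat \<Rightarrow> real) \<Rightarrow> bool" where
  "sign_inv b w1 w2 fx fy fv s \<sigma> \<longleftrightarrow> env s \<and> tab s \<and> rmem s 16 = w1 \<and> rmem s 17 = w2 \<and>
     (\<forall>a\<ge>z. rmem s 9 a = 0) \<and> (\<forall>j<n. rmem s 5 j = \<sigma> j) \<and> (\<forall>j. \<sigma> j = 1 \<or> \<sigma> j = -1) \<and>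
     (\<forall>i c. rmem s 6 (lead b i c) = (\<Sum>e\<in>cls b i c. fx e * \<sigma> (cl e))) \<and>
     (\<forall>i c. rmem s 7 (lead b i c) = (\<Sum>e\<in>cls b i c. fy e * \<sigma> (cl e))) \<and>
     (\<forall>i c. rmem s 8 (lead b i c) = (\<Sum>e\<in>cls b i c. fv e)) \<and>
     (\<Sum>i<m. \<Sum>c<n. w1 i * (\<Sum>e\<in>cls b i c. fx e * \<sigma> (cl e))\<^sup>2 + w2 i * (\<Sum>e\<in>cls b i c. fy e * \<sigma> (cl e))\<^sup>2)
       \<le> (\<Sum>e<z. w1 (rw e) * (fx e)\<^sup>2 + w2 (rw e) * (fy e)\<^sup>2)"

lemma run_sign_step:
  assumes inv: "sign_inv b w1 w2 fx fy fv s \<sigma>" and b: "b < L" and s: "imem s 7 0 = b"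
    "imem s 6 0 = 2 ^ b"
  shows "\<exists>t \<sigma>'. run W N sign_step (900 + 52 * L) s t \<and> sign_inv (Suc b) w1 w2 fx fy fv t \<sigma>'"
proof -
  have bL: "b \<le> L" using b by simp
  note inv' = inv[unfolded sign_inv_def]
  have env: "env s" and tab: "tab s" and w: "rmem s 16 = w1" "rmem s 17 = w2"
    and Z: "\<And>a. a \<ge> z \<Longrightarrow> rmem s 9 a = 0" and \<sigma>: "\<And>j. j < n \<Longrightarrow> rmem s 5 j = \<sigma> j" "\<And>j. \<sigma> j = 1 \<or> \<sigma> j = -1"
    and X: "\<And>i c. rmem s 6 (lead b i c) = (\<Sum>e\<in>cls b i c. fx e * \<sigma> (cl e))"
    and Y: "\<And>i c. rmem s 7 (lead b i c) = (\<Sum>e\<in>cls b i c. fy e * \<sigma> (cl e))"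
    and V: "\<And>i c. rmem s 8 (lead b i c) = (\<Sum>e\<in>cls b i c. fv e)"
    and Q: "(\<Sum>i<m. \<Sum>c<n. w1 i * (\<Sum>e\<in>cls b i c. fx e * \<sigma> (cl e))\<^sup>2 +
      w2 i * (\<Sum>e\<in>cls b i c. fy e * \<sigma> (cl e))\<^sup>2)
       \<le> (\<Sum>e<z. w1 (rw e) * (fx e)\<^sup>2 + w2 (rw e) * (fy e)\<^sup>2)"
    using inv' by blast+
  have lev: "level s b" using env s by (simp add: level_def)
  define u where "u i c = (\<Sum>e\<in>cls b i c. fx e * \<sigma> (cl e))" for i c
  define v where "v i c = (\<Sum>e\<in>cls b i c. fy e * \<sigma> (cl e))" for i c
  have out: "n \<le> c \<Longrightarrow> u i c = 0" "n \<le> c \<Longrightarrow> v i c = 0" for i c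
    by (simp_all add: u_def v_def cls_out)
  obtain s1 where s1: "run W N cross (190 + 52 * L) s s1" "\<forall>a\<ge>z. rmem s1 9 a = 0"
    "rmem s1 9 0 = (\<Sum>e<z. if left_leader b e then
       rmem s 16 (rw e) * (rmem s 6 (Suc e) * rmem s 6 (sib b e)) +
       rmem s 17 (rw e) * (rmem s 7 (Suc e) * rmem s 7 (sib b e)) else 0)"
    using run_cross[OF lev b tab] Z by blast
  \<comment> \<open>The tested cell is the total cross term over all pairs of siblings, which is
    what \<open>sum_squares_merge\<close> asks to be nonpositive after multiplication by
    \<open>r\<close>. Empty even classes have no left leader, but their products are 0.\<close>
  have Zval: "rmem s1 9 0 = (\<Sum>i<m. \<Sum>c<n. w1 i * (u i (2 * c) * u i (2 * c + 1)) +
    w2 i * (v i (2 * c) * v i (2 * c + 1)))"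
  proof -
    define f where "f i c = w1 i * (u i c * u i (c + 1)) + w2 i * (v i c * v i (c + 1))" for i c
    have "rmem s1 9 0 = (\<Sum>e<z. if left_leader b e then f (rw e) (cl e div 2 ^ b) else 0)"
      unfolding s1(3)
    proof (rule sum.cong[OF refl])
      fix e
      show "(if left_leader b e then rmem s 16 (rw e) * (rmem s 6 (Suc e) * rmem s 6 (sib b e)) +
         rmem s 17 (rw e) * (rmem s 7 (Suc e) * rmem s 7 (sib b e)) else 0) =
         (if left_leader b e then f (rw e) (cl e div 2 ^ b) else 0)"
      proof (cases "left_leader b e")
        case True
        hence "lead b (rw e) (cl e div 2 ^ b) = Suc e" by (simp add: left_leader_def)
        hence "rmem s 6 (Suc e) = u (rw e) (cl e div 2 ^ b)"
          "rmem s 7 (Suc e) = v (rw e) (cl e div 2 ^ b)"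
          using X[of "rw e" "cl e div 2 ^ b"] Y[of "rw e" "cl e div 2 ^ b"]
            by (simp_all add: u_def v_def)
        moreover have "rmem s 6 (sib b e) = u (rw e) (cl e div 2 ^ b + 1)"
          "rmem s 7 (sib b e) = v (rw e) (cl e div 2 ^ b + 1)"
          unfolding sib_def u_def v_def X Y by simp_all
        ultimately show ?thesis by (simp add: f_def w)
      qed simp
    qed
    also have "\<dots> = (\<Sum>i<m. \<Sum>c<n. if lead b i (2 * c) = 0 then 0 else f i (2 * c))"
      by (rule sum_left_leaders)
    also have "\<dots> = (\<Sum>i<m. \<Sum>c<n. f i (2 * c))"
      by (intro sum.cong refl) (auto simp: f_def u_def v_def lead_eq_0)
    finally show ?thesis by (simp add: f_def)
  qed
  have f1: "x \<noteq> 9 \<Longrightarrow> rmem s1 x = rmem s x" "x \<notin> {8, 9} \<Longrightarrow> imem s1 x = imem s x" for x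
    using run_rmem[OF s1(1)] run_imem[OF s1(1)] by auto
  have lev1: "level s1 b" and tab1: "tab s1" using lev tab by (auto simp: level_def env_def tab_def f1)
  obtain s2 r where s2: "run W N (If (RLess (RN 0) (RLoad 9 (IConst 0))) flip Skip) 106 s1 s2"
    "r = 1 \<or> r = -1" "r * rmem s1 9 0 \<le> 0"
    "\<forall>x\<in>{6,7}. (\<forall>e<z. rmem s2 x (Suc e)
      = (if odd (cl e div 2 ^ b) then r else 1) * rmem s1 x (Suc e)) \<and> rmem s2 x 0 = rmem s1 x 0"
    "\<forall>j<n. rmem s2 5 j = (if odd (j div 2 ^ b) then r else 1) * rmem s1 5 j"
    using run_flip_if[OF lev1 b] by blast
  have f2: "x \<notin> {5, 6, 7} \<Longrightarrow> rmem s2 x = rmem s1 x" "imem s2 x = imem s1 x" for x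
    using run_rmem[OF s2(1)] run_imem[OF s2(1)] by auto
  \<comment> \<open>\<open>j div 2 ^ b\<close> is odd exactly if binary digit \<open>b\<close> of
    \<open>j\<close> is set, so this multiplies in the factor of that digit.\<close>
  define \<sigma>' where "\<sigma>' j = (if odd (j div 2 ^ b) then r else 1) * \<sigma> j" for j
  have \<sigma>': "\<sigma>' j = 1 \<or> \<sigma>' j = -1" for j using \<sigma>(2)[of j] s2(2) by (auto simp: \<sigma>'_def)
  have flipped: "(\<Sum>e\<in>cls b i c. f e * \<sigma>' (cl e))
    = (if odd c then r else 1) * (\<Sum>e\<in>cls b i c. f e * \<sigma> (cl e))"
    for f i c unfolding sum_distrib_left by (rule sum.cong) (auto simp: cls_def \<sigma>'_def)
  have moved: "rmem s2 x (lead b i c) = (if odd c then r else 1) * rmem s x (lead b i c)"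
    if "x \<in> {6, 7}" "cls b i c = {} \<Longrightarrow> rmem s x (lead b i c) = 0" for x i c
  proof (cases "lead b i c")
    case 0
    hence "rmem s x 0 = 0" using that(2) lead_eq_0[of b i c] by simp
    thus ?thesis using s2(4) that(1) 0 f1(1)[of x] by auto
  next
    case (Suc e)
    hence "e < z" "cl e div 2 ^ b = c" using lead_SucD by auto
    thus ?thesis using s2(4) that(1) Suc f1(1)[of x] by auto
  qed
  have X2: "rmem s2 6 (lead b i c) = (\<Sum>e\<in>cls b i c. fx e * \<sigma>' (cl e))" for i c
    unfolding flipped using moved[of 6 i c] X[of i c] by simp
  have Y2: "rmem s2 7 (lead b i c) = (\<Sum>e\<in>cls b i c. fy e * \<sigma>' (cl e))" for i c
    unfolding flipped using moved[of 7 i c] Y[of i c] by simp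
  have lev2: "level s2 b" and tab2: "tab s2" using lev1 tab1 by (auto simp: level_def env_def tab_def f2)
  obtain s3 where s3: "run W N (merge 6) 200 s2 s3" "imem s3 = imem s2"
    "\<forall>y. y \<noteq> 6 \<longrightarrow> rmem s3 y = rmem s2 y"
    "\<forall>i c. rmem s3 6 (lead (Suc b) i c) = (\<Sum>e\<in>cls (Suc b) i c. fx e * \<sigma>' (cl e))"
    using run_merge_sum[of s2 b 6 "\<lambda>e. fx e * \<sigma>' (cl e)", OF lev2 bL tab2 X2] by blast
  have lev3: "level s3 b" and tab3: "tab s3" using lev2 tab2 by (auto simp: level_def env_def tab_def s3)
  have "\<And>i c. rmem s3 7 (lead b i c) = (\<Sum>e\<in>cls b i c. fy e * \<sigma>' (cl e))" using Y2 s3 by simp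
  from run_merge_sum[of s3 b 7 "\<lambda>e. fy e * \<sigma>' (cl e)", OF lev3 bL tab3 this]
  obtain s4 where s4: "run W N (merge 7) 200 s3 s4" "imem s4 = imem s3"
    "\<forall>y. y \<noteq> 7 \<longrightarrow> rmem s4 y = rmem s3 y"
    "\<forall>i c. rmem s4 7 (lead (Suc b) i c) = (\<Sum>e\<in>cls (Suc b) i c. fy e * \<sigma>' (cl e))"
    by blast
  have lev4: "level s4 b" and tab4: "tab s4" using lev3 tab3 by (auto simp: level_def env_def tab_def s4)
  have "\<And>i c. rmem s4 8 (lead b i c) = (\<Sum>e\<in>cls b i c. fv e)"
    using V s3 s4 f2(1)[of 8] f1(1)[of 8] by simp
  from run_merge_sum[of s4 b 8 fv, OF lev4 bL tab4 this]
  obtain s5 where s5: "run W N (merge 8) 200 s4 s5" "imem s5 = imem s4"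
    "\<forall>y. y \<noteq> 8 \<longrightarrow> rmem s5 y = rmem s4 y"
    "\<forall>i c. rmem s5 8 (lead (Suc b) i c) = (\<Sum>e\<in>cls (Suc b) i c. fv e)"
    by blast
  have run: "run W N sign_step (900 + 52 * L) s s5" unfolding sign_step_def
    by (rule run_Seq[OF s1(1) run_Seq[OF s2(1) run_Seq[OF s3(1) run_Seq[OF s4(1) s5(1) order_refl]
      order_refl] order_refl]]) simp
  have merged: "(\<Sum>e\<in>cls (Suc b) i c. f e * \<sigma>' (cl e)) =
      (\<Sum>e\<in>cls b i (2 * c). f e * \<sigma> (cl e)) + r * (\<Sum>e\<in>cls b i (2 * c + 1). f e * \<sigma> (cl e))" for f i c
  proof -
    have "(\<Sum>e\<in>cls (Suc b) i c. f e * \<sigma>' (cl e))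
      = (\<Sum>e\<in>cls b i (2 * c). f e * \<sigma>' (cl e)) + (\<Sum>e\<in>cls b i (2 * c + 1). f e * \<sigma>' (cl e))"
      unfolding cls_Suc by (rule sum.union_disjoint) (use cls_disjoint[of "2 * c" "2 * c + 1"] in auto)
    thus ?thesis unfolding flipped by simp
  qed
  have "(\<Sum>i<m. \<Sum>c<n. w1 i * (\<Sum>e\<in>cls (Suc b) i c. fx e * \<sigma>' (cl e))\<^sup>2 +
    w2 i * (\<Sum>e\<in>cls (Suc b) i c. fy e * \<sigma>' (cl e))\<^sup>2)
    \<le> (\<Sum>i<m. \<Sum>c<n. w1 i * (u i c)\<^sup>2 + w2 i * (v i c)\<^sup>2)"
    unfolding merged u_def[symmetric] v_def[symmetric]
    by (rule sum_squares_merge) (use out s2 Zval in auto)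
  also have "\<dots> \<le> (\<Sum>e<z. w1 (rw e) * (fx e)\<^sup>2 + w2 (rw e) * (fy e)\<^sup>2)"
    using Q by (simp add: u_def v_def)
  finally have "sign_inv (Suc b) w1 w2 fx fy fv s5 \<sigma>'"
    unfolding sign_inv_def
    using lev4 tab4 \<sigma>' s3 s4 s5 s1(2) s2(5) \<sigma>(1) w f1 f2 by (auto simp: level_def env_def tab_def \<sigma>'_def)
  with run show ?thesis by blast
qed

text \<open>Since \<open>n \<le> 2 ^ L\<close>, a row forms a single class at level
  \<open>L\<close>: the class sums have become signed row sums, and the comparison with the diagonal
  form concerns whole rows.\<close>

lemma run_signs:
  assumes env: "env s" "tab s"
    and Z: "\<And>a. z \<le> a \<Longrightarrow> rmem s 9 a = 0" and one: "\<And>j. j < n \<Longrightarrow> rmem s 5 j = 1"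
    and leaf: "\<And>e. e < z \<Longrightarrow> rmem s 6 (Suc e) = fx e" "\<And>e. e < z \<Longrightarrow> rmem s 7 (Suc e) = fy e"
      "\<And>e. e < z \<Longrightarrow> rmem s 8 (Suc e) = fv e"
    and zero: "rmem s 6 0 = 0" "rmem s 7 0 = 0" "rmem s 8 0 = 0"
  shows "\<exists>t \<sigma>. run W N signs (22 + L * (928 + 52 * L)) s t \<and>
    (\<forall>a\<ge>z. rmem t 9 a = 0) \<and> rmem t 6 0 = 0 \<and> rmem t 7 0 = 0 \<and> rmem t 8 0 = 0 \<and>
    (\<forall>j<n. rmem t 5 j = \<sigma> j) \<and> (\<forall>j. \<sigma> j = 1 \<or> \<sigma> j = -1) \<and>
    (\<forall>i. rmem t 6 (lead L i 0) = (\<Sum>e\<in>ents i. fx e * \<sigma> (cl e))) \<and>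
    (\<forall>i. rmem t 7 (lead L i 0) = (\<Sum>e\<in>ents i. fy e * \<sigma> (cl e))) \<and>
    (\<forall>i. rmem t 8 (lead L i 0) = (\<Sum>e\<in>ents i. fv e)) \<and>
    (\<Sum>i<m. rmem s 16 i * (\<Sum>e\<in>ents i. fx e * \<sigma> (cl e))\<^sup>2 + rmem s 17 i * (\<Sum>e\<in>ents i. fy e * \<sigma> (cl e))\<^sup>2)
       \<le> (\<Sum>e<z. rmem s 16 (rw e) * (fx e)\<^sup>2 + rmem s 17 (rw e) * (fy e)\<^sup>2)"
proof -
  define J where "J b s' \<longleftrightarrow> (\<exists>\<sigma>. sign_inv b (rmem s 16) (rmem s 17) fx fy fv s' \<sigma>)" for b s'
  have leaves: "V (lead 0 i c) = (\<Sum>e\<in>cls 0 i c. f e)" if "V 0 = 0" "\<And>e. e < z \<Longrightarrow> V (Suc e) = f e"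
    for V f :: "nat \<Rightarrow> real" and i c
  proof (cases "cls 0 i c = {}")
    case False
    then obtain e where e: "e \<in> cls 0 i c" by blast
    hence "cls 0 i c = {e}" using cls_0 by (auto simp: cls_def)
    thus ?thesis using that e by (auto simp: cls_def)
  qed (use that in auto)
  have "\<exists>t. run W N signs (22 + L * (928 + 52 * L)) s t \<and> J L t"
    unfolding signs_def
  proof (rule run_for[OF N(1) W_pow])
    have "sign_inv 0 (rmem s 16) (rmem s 17) fx fy fv s (\<lambda>_. 1)"
      unfolding sign_inv_def
    proof (intro conjI allI)
      fix i c
      show "rmem s 6 (lead 0 i c) = (\<Sum>e\<in>cls 0 i c. fx e * 1)"
        using leaves[of "rmem s 6" fx i c] leaf zero by simp
      show "rmem s 7 (lead 0 i c) = (\<Sum>e\<in>cls 0 i c. fy e * 1)"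
        using leaves[of "rmem s 7" fy i c] leaf zero by simp
      show "rmem s 8 (lead 0 i c) = (\<Sum>e\<in>cls 0 i c. fv e)"
        using leaves[of "rmem s 8" fv i c] leaf zero by simp
      show "(\<Sum>i<m. \<Sum>c<n. rmem s 16 i * (\<Sum>e\<in>cls 0 i c. fx e * 1)\<^sup>2 +
        rmem s 17 i * (\<Sum>e\<in>cls 0 i c. fy e * 1)\<^sup>2)
         \<le> (\<Sum>e<z. rmem s 16 (rw e) * (fx e)\<^sup>2 + rmem s 17 (rw e) * (fy e)\<^sup>2)"
        unfolding sum.distrib sum_leaves by simp
    qed (use env Z one in auto)
    thus "J 0 s" by (auto simp: J_def)
    show "imem s 5 0 = L" using env by (simp add: env_def)
  next
    fix i and s s' :: mem
    assume a: "J i s" "\<And>x. x \<noteq> 7 \<Longrightarrow> x \<noteq> 6 \<Longrightarrow> imem s' x = imem s x" "rmem s' = rmem s"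
    thus "J i s'" by (auto simp: J_def sign_inv_def env_def tab_def)
  next
    fix b and s :: mem
    assume "b < L" "J b s" "imem s 7 0 = b" "imem s 6 0 = 2 ^ b"
    thus "\<exists>t. run W N sign_step (900 + 52 * L) s t \<and> J (Suc b) t"
      using run_sign_step unfolding J_def by blast
  qed auto
  then obtain t \<sigma> where t: "run W N signs (22 + L * (928 + 52 * L)) s t"
    and inv: "sign_inv L (rmem s 16) (rmem s 17) fx fy fv t \<sigma>" unfolding J_def by blast
  have c0: "(\<Sum>c<n. f c) = f 0" if "\<And>c. 0 < c \<Longrightarrow> f c = 0" for f :: "nat \<Rightarrow> real"
  proof -
    have "(\<Sum>c<n. f c) = (\<Sum>c\<in>{0}. f c)" by (rule sum.mono_neutral_right) (use that npos in auto)
    thus ?thesis by simp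
  qed
  have empty: "0 < c \<Longrightarrow> cls L i c = {}" for i c
  proof -
    assume c: "0 < c"
    have "cl e div 2 ^ L = 0" if "e < z" for e using cl[OF that] two_pow_L(1) by (intro div_less) simp
    thus ?thesis using c by (auto simp: cls_def)
  qed
  have eq: "(\<Sum>i<m. \<Sum>c<n. rmem s 16 i * (\<Sum>e\<in>cls L i c. fx e * \<sigma> (cl e))\<^sup>2 +
    rmem s 17 i * (\<Sum>e\<in>cls L i c. fy e * \<sigma> (cl e))\<^sup>2)
    = (\<Sum>i<m. rmem s 16 i * (\<Sum>e\<in>ents i. fx e * \<sigma> (cl e))\<^sup>2 +
      rmem s 17 i * (\<Sum>e\<in>ents i. fy e * \<sigma> (cl e))\<^sup>2)"
    by (rule sum.cong[OF refl]) (subst c0, auto simp: empty cls_root_ents)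
  \<comment> \<open>Class \<open>n\<close> is empty in every row and has leader 0, so the invariant
    at this class tells the contents of cell 0.\<close>
  have "rmem t 6 (lead L 0 n) = (\<Sum>e\<in>cls L 0 n. fx e * \<sigma> (cl e))"
      "rmem t 7 (lead L 0 n) = (\<Sum>e\<in>cls L 0 n. fy e * \<sigma> (cl e))"
      "rmem t 8 (lead L 0 n) = (\<Sum>e\<in>cls L 0 n. fv e)"
    using inv unfolding sign_inv_def by blast+
  hence zeros: "rmem t 6 0 = 0 \<and> rmem t 7 0 = 0 \<and> rmem t 8 0 = 0"
    using cls_out[of n L 0] lead_out[of n L 0] by simp
  have roots: "\<forall>i. rmem t 6 (lead L i 0) = (\<Sum>e\<in>ents i. fx e * \<sigma> (cl e))"
      "\<forall>i. rmem t 7 (lead L i 0) = (\<Sum>e\<in>ents i. fy e * \<sigma> (cl e))"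
      "\<forall>i. rmem t 8 (lead L i 0) = (\<Sum>e\<in>ents i. fv e)"
    using inv unfolding sign_inv_def cls_root_ents[symmetric] by blast+
  have rest: "\<forall>a\<ge>z. rmem t 9 a = 0" "\<forall>j<n. rmem t 5 j = \<sigma> j" "\<forall>j. \<sigma> j = 1 \<or> \<sigma> j = -1"
    using inv unfolding sign_inv_def by blast+
  have Q: "(\<Sum>i<m. \<Sum>c<n. rmem s 16 i * (\<Sum>e\<in>cls L i c. fx e * \<sigma> (cl e))\<^sup>2 +
    rmem s 17 i * (\<Sum>e\<in>cls L i c. fy e * \<sigma> (cl e))\<^sup>2)
       \<le> (\<Sum>e<z. rmem s 16 (rw e) * (fx e)\<^sup>2 + rmem s 17 (rw e) * (fy e)\<^sup>2)"
    using inv unfolding sign_inv_def by blast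
  show ?thesis
    by (intro exI[of _ t] exI[of _ \<sigma>] conjI) (use t zeros roots rest Q[unfolded eq] in \<open>assumption
      | simp only:\<close>)+
qed

end

section \<open>Potentials of rows and columns\<close>

lemma exp_le_quadratic:
  fixes y :: real
  assumes "\<bar>y\<bar> \<le> 1"
  shows "exp y \<le> 1 + y + y\<^sup>2"
proof (cases "0 \<le> y")
  case True thus ?thesis using exp_bound[of y] assms by simp
next
  case False
  define u where "u = - y"
  have u: "0 \<le> u" "u \<le> 1" using False assms by (auto simp: u_def)
  have "exp (- u) \<le> 1 / (1 + u)"
    using exp_ge_add_one_self[of u] u by (simp add: exp_minus divide_simps)
  also have "\<dots> \<le> 1 - u + u\<^sup>2"
  proof -
    have "1 \<le> (1 - u + u\<^sup>2) * (1 + u)"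
      using mult_nonneg_nonneg[OF u(1) zero_le_power2[of u]]
        by (simp add: algebra_simps power2_eq_square)
    thus ?thesis using u by (simp add: divide_simps)
  qed
  finally show ?thesis by (simp add: u_def)
qed

text \<open>The coefficient \<open>1 / 12\<close> in place of \<open>1 / 8\<close> from the Taylor
  expansion leaves room for the cubic term: the square of the right side exceeds
  \<open>1 + y\<close> by \<open>y\<^sup>2 * ((1 - y) / 12 + y\<^sup>2 / 144)\<close>.\<close>

lemma sqrt_one_plus_le:
  fixes y :: real
  assumes "\<bar>y\<bar> \<le> 1 / 2"
  shows "sqrt (1 + y) \<le> 1 + y / 2 - y\<^sup>2 / 12"
proof -
  have y2: "y\<^sup>2 \<le> 1 / 4" using abs_le_square_iff[of y "1/2"] assms by (simp add: power2_eq_square)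
  have "(1 + y / 2 - y\<^sup>2 / 12)\<^sup>2 = 1 + y + y\<^sup>2 * ((1 - y) / 12 + y\<^sup>2 / 144)"
    by (simp add: power2_eq_square field_simps)
  moreover have "0 \<le> y\<^sup>2 * ((1 - y) / 12 + y\<^sup>2 / 144)"
    using assms by (intro mult_nonneg_nonneg) auto
  moreover have "0 \<le> 1 + y / 2 - y\<^sup>2 / 12" using assms y2 by linarith
  ultimately show ?thesis by (intro real_le_lsqrt) auto
qed

text \<open>The step \<open>x \<mapsto> x \<plusminus> x (1 - x) / E\<close> multiplies \<open>x (1 - x)\<close> by \<open>1 + y\<close>; the potential \<open>h\<close> stays above
  \<open>sqrt (x (1 - x))\<close>, scaled up by \<open>1 + 1 / (12 E\<^sup>2)\<close> in every step, although its average does not grow.\<close>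

lemma column_step:
  fixes x E \<sigma> h g :: real
  assumes x: "0 \<le> x" "x \<le> 1" and E: "4 \<le> E" and \<sigma>: "\<sigma> = 1 \<or> \<sigma> = -1"
    and h: "sqrt (x * (1 - x)) * g \<le> h" and g: "0 \<le> g"
  defines "\<delta> \<equiv> x * (1 - x) / E" and "y \<equiv> \<sigma> * ((1 - 2 * x) / E) - x * (1 - x) / (E * E)"
    and "\<gamma> \<equiv> 1 / (12 * (E * E))"
  shows "0 \<le> x + \<sigma> * \<delta>" "x + \<sigma> * \<delta> \<le> 1"
    and "sqrt ((x + \<sigma> * \<delta>) * (1 - (x + \<sigma> * \<delta>))) * (g * (1 + \<gamma>))
      \<le> h * ((1 + y / 2 - y * y / 12) * (1 + \<gamma>))"
    and "h * ((1 + y / 2 - y * y / 12) * (1 + \<gamma>)) \<le> h +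
      \<sigma> * (h * ((1 - 2 * x) / E * (1 / 2 + x * (1 - x) / (E * E) / 6) * (1 + \<gamma>)))"
proof -
  have Ep: "0 < E" using E by simp
  have xx: "0 \<le> x * (1 - x)" using x by simp
  have xx4: "x * (1 - x) \<le> 1 / 4"
  proof -
    have "0 \<le> (1 - 2 * x)\<^sup>2" by simp
    thus ?thesis by (simp add: power2_eq_square algebra_simps)
  qed
  have d: "\<delta> \<le> x" "\<delta> \<le> 1 - x" "0 \<le> \<delta>"
  proof -
    have "x * (1 - x) \<le> x * 1" using x by (intro mult_left_mono) auto
    moreover have "x * (1 - x) \<le> 1 * (1 - x)" using x by (intro mult_right_mono) auto
    moreover have "x * (1 - x) / E \<le> x * (1 - x)"
      using divide_left_mono[of 1 E "x * (1 - x)"] xx E by simp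
    ultimately show "\<delta> \<le> x" "\<delta> \<le> 1 - x" "0 \<le> \<delta>" using xx Ep by (auto simp: \<delta>_def)
  qed
  show x': "0 \<le> x + \<sigma> * \<delta>" "x + \<sigma> * \<delta> \<le> 1" using \<sigma> d by auto
  have \<sigma>2: "\<sigma> * \<sigma> = 1" using \<sigma> by auto
  have prod: "(x + \<sigma> * \<delta>) * (1 - (x + \<sigma> * \<delta>)) = x * (1 - x) * (1 + y)"
  proof -
    have "(x + \<sigma> * \<delta>) * (1 - (x + \<sigma> * \<delta>)) = x * (1 - x) + \<sigma> * \<delta> * (1 - 2 * x) - (\<sigma> * \<sigma>) * (\<delta> * \<delta>)"
      by (simp add: algebra_simps)
    also have "\<dots> = x * (1 - x) * (1 + y)"
      unfolding \<sigma>2 \<delta>_def y_def using Ep by (simp add: field_simps)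
    finally show ?thesis .
  qed
  define \<alpha> where "\<alpha> = (1 - 2 * x) / E"
  define \<beta> where "\<beta> = x * (1 - x) / (E * E)"
  have \<gamma>0: "0 \<le> \<gamma>" by (simp add: \<gamma>_def)
  have \<alpha>4: "\<bar>\<alpha>\<bar> \<le> 1 / 4"
  proof -
    have "\<bar>1 - 2 * x\<bar> \<le> 1" using x by auto
    also have "1 \<le> E / 4" using E by simp
    finally show ?thesis using Ep by (simp add: \<alpha>_def abs_div field_simps)
  qed
  have \<beta>4: "0 \<le> \<beta>" "\<beta> \<le> 1 / 4"
  proof -
    show "0 \<le> \<beta>" using xx by (simp add: \<beta>_def)
    have "1 \<le> E * E" using mult_mono[of 1 E 1 E] E by simp
    hence "x * (1 - x) / (E * E) \<le> x * (1 - x) / 1" using xx by (intro divide_left_mono) auto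
    thus "\<beta> \<le> 1 / 4" using xx4 unfolding \<beta>_def by linarith
  qed
  have y: "y = \<sigma> * \<alpha> - \<beta>" by (simp add: y_def \<alpha>_def \<beta>_def)
  have "\<bar>\<sigma> * \<alpha>\<bar> \<le> 1 / 4" using \<sigma> \<alpha>4 by auto
  hence y2: "\<bar>y\<bar> \<le> 1 / 2" unfolding y using \<beta>4 by linarith
  have sq: "sqrt (1 + y) \<le> 1 + y / 2 - y * y / 12" using sqrt_one_plus_le[OF y2]
    by (simp add: power2_eq_square)
  have pos: "0 \<le> sqrt (1 + y)" using y2 by simp
  have h0: "0 \<le> h" using h mult_nonneg_nonneg[OF real_sqrt_ge_zero[OF xx] g] by linarith
  have "sqrt (x * (1 - x) * (1 + y)) * (g * (1 + \<gamma>)) = sqrt (x * (1 - x)) * g * (sqrt (1 + y) * (1 + \<gamma>))"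
    by (simp add: real_sqrt_mult)
  also have "\<dots> \<le> h * ((1 + y / 2 - y * y / 12) * (1 + \<gamma>))"
    by (intro mult_mono h mult_right_mono sq) (use \<gamma>0 pos h0 sq in auto)
  finally show "sqrt ((x + \<sigma> * \<delta>) * (1 - (x + \<sigma> * \<delta>))) * (g * (1 + \<gamma>))
    \<le> h * ((1 + y / 2 - y * y / 12) * (1 + \<gamma>))"
    unfolding prod .
  have "(\<sigma> * \<alpha> - \<beta>) * (\<sigma> * \<alpha> - \<beta>) = (\<sigma> * \<sigma>) * (\<alpha> * \<alpha>) - 2 * \<sigma> * \<alpha> * \<beta> + \<beta> * \<beta>"
    by (simp add: algebra_simps)
  hence yy: "y * y = \<alpha> * \<alpha> - 2 * \<sigma> * \<alpha> * \<beta> + \<beta> * \<beta>" unfolding y \<sigma>2 by simp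
  \<comment> \<open>Separation into parts even and odd in \<open>\<sigma>\<close>. The odd part is
    linear in \<open>\<sigma>\<close> and is left to the global sign; the even part has to
    compensate the inflation by \<open>1 + \<gamma>\<close>.\<close>
  have split: "1 + y / 2 - y * y / 12
    = (1 - \<beta> / 2 - \<alpha> * \<alpha> / 12 - \<beta> * \<beta> / 12) + \<sigma> * (\<alpha> * (1 / 2 + \<beta> / 6))"
    unfolding yy by (simp add: y field_simps)
  \<comment> \<open>The loss is uniform in \<open>x\<close>: near \<open>1 / 2\<close> it comes from
    \<open>\<beta>\<close>, near 0 and 1 from \<open>\<alpha> * \<alpha>\<close>. Together they
    amount to \<open>(1 + 2 * x * (1 - x)) * \<gamma>\<close>, whence the choice of
    \<open>\<gamma>\<close>.\<close>
  have even: "1 - \<beta> / 2 - \<alpha> * \<alpha> / 12 - \<beta> * \<beta> / 12 \<le> 1 - \<gamma>"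
  proof -
    have "\<beta> / 2 + \<alpha> * \<alpha> / 12 = (6 * (x * (1 - x)) + (1 - 2 * x) * (1 - 2 * x)) * \<gamma>"
      unfolding \<alpha>_def \<beta>_def \<gamma>_def using Ep by (simp add: field_simps)
    moreover have "1 \<le> 6 * (x * (1 - x)) + (1 - 2 * x) * (1 - 2 * x)" using xx
      by (simp add: algebra_simps)
    hence "1 * \<gamma> \<le> (6 * (x * (1 - x)) + (1 - 2 * x) * (1 - 2 * x)) * \<gamma>" using \<gamma>0
      by (rule mult_right_mono)
    moreover have "0 \<le> \<beta> * \<beta>" by simp
    ultimately show ?thesis by linarith
  qed
  have "(1 - \<beta> / 2 - \<alpha> * \<alpha> / 12 - \<beta> * \<beta> / 12) * (1 + \<gamma>) \<le> (1 - \<gamma>) * (1 + \<gamma>)"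
    using even \<gamma>0 by (intro mult_right_mono) auto
  also have "\<dots> \<le> 1" by (simp add: algebra_simps)
  finally have "h * ((1 - \<beta> / 2 - \<alpha> * \<alpha> / 12 - \<beta> * \<beta> / 12) * (1 + \<gamma>)) \<le> h * 1" using h0
    by (rule mult_left_mono)
  moreover have "h * ((1 + y / 2 - y * y / 12) * (1 + \<gamma>)) =
      h * ((1 - \<beta> / 2 - \<alpha> * \<alpha> / 12 - \<beta> * \<beta> / 12) * (1 + \<gamma>)) + \<sigma> * (h * (\<alpha> * (1 / 2 + \<beta> / 6) * (1 + \<gamma>)))"
    unfolding split by (simp add: algebra_simps)
  ultimately show "h * ((1 + y / 2 - y * y / 12) * (1 + \<gamma>)) \<le> h +
      \<sigma> * (h * ((1 - 2 * x) / E * (1 / 2 + x * (1 - x) / (E * E) / 6) * (1 + \<gamma>)))"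
    unfolding \<alpha>_def \<beta>_def by simp
qed

text \<open>Everything odd in \<open>s\<close> is collected in the last summand, to be made
  nonpositive in total by the global sign. In the even part the square of a difference is bounded by
  twice the sum of the squares, which separates \<open>X\<close> from \<open>Y\<close>; hence the
  weights \<open>2 l\<^sup>2\<close> and \<open>128 l\<^sup>4\<close>, the latter being twice the
  square of \<open>8 l\<^sup>2\<close>.\<close>

lemma row_average:
  fixes U D l X Y V s :: real
  assumes U: "0 \<le> U" "0 \<le> D" and s: "s = 1 \<or> s = -1"
  defines "v \<equiv> 4 * (l * l) * V" and "q \<equiv> l * X - 8 * (l * l) * Y" and "q' \<equiv> - (l * X) - 8 * (l * l) * Y"
  defines "zU \<equiv> s * q - v" and "zD \<equiv> s * q' - v"
  shows "U * (1 + zU + zU * zU) + D * (1 + zD + zD * zD) \<le>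
    (U + D) * (1 - v + v * v) + (U + D) * (2 * (l * l) * X\<^sup>2 + 128 * (l * l * l * l) * Y\<^sup>2) +
    s * ((1 - 2 * v) * (U * q + D * q'))"
proof -
  have s2: "s * s = 1" using s by auto
  have e: "1 + (s * q - v) + (s * q - v) * (s * q - v)
    = 1 - v + v * v + q * q + s * ((1 - 2 * v) * q)" for q
  proof -
    have "(s * q - v) * (s * q - v) = (s * s) * (q * q) - 2 * s * q * v + v * v"
      by (simp add: algebra_simps)
    thus ?thesis unfolding s2 by (simp add: algebra_simps)
  qed
  have b: "(a - b) * (a - b) \<le> 2 * (a * a) + 2 * (b * b)" for a b :: real
    using zero_le_power2[of "a + b"] by (simp add: power2_eq_square algebra_simps)
  have b1: "q * q \<le> 2 * (l * l) * X\<^sup>2 + 128 * (l * l * l * l) * Y\<^sup>2"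
    using b[of "l * X" "8 * (l * l) * Y"] by (simp add: q_def power2_eq_square algebra_simps)
  have b2: "q' * q' \<le> 2 * (l * l) * X\<^sup>2 + 128 * (l * l * l * l) * Y\<^sup>2"
    using b[of "- (l * X)" "8 * (l * l) * Y"] by (simp add: q'_def power2_eq_square algebra_simps)
  have "U * (1 + zU + zU * zU) + D * (1 + zD + zD * zD) =
    (U + D) * (1 - v + v * v) + (U * (q * q) + D * (q' * q')) + s * ((1 - 2 * v) * (U * q + D * q'))"
    unfolding zU_def zD_def e by (simp add: algebra_simps)
  moreover have "U * (q * q) + D * (q' * q')
    \<le> (U + D) * (2 * (l * l) * X\<^sup>2 + 128 * (l * l * l * l) * Y\<^sup>2)"
    using mult_left_mono[OF b1 U(1)] mult_left_mono[OF b2 U(2)] by (simp add: distrib_right)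
  ultimately show ?thesis by linarith
qed

text \<open>The drift \<open>-4 l\<^sup>2 V\<close> coming from \<open>-4 l\<^sup>2 a\<^sup>2 x\<^sup>2\<close> pays for all second-order terms.\<close>

lemma row_drift:
  fixes l V Q a :: real
  assumes l: "0 \<le> l" "l * a \<le> 1 / 32" and a: "0 \<le> a" and V: "0 \<le> V" "l * V \<le> a"
    and Q: "Q \<le> (2 * (l * l) + 128 * (l * l * l * l) * (a * a)) * V"
  shows "Q + (4 * (l * l) * V) * (4 * (l * l) * V) \<le> 4 * (l * l) * V"
proof -
  have la: "0 \<le> l * a" using l a by simp
  have "(l * a) * (l * a) \<le> (1 / 32) * (1 / 32)" using l la by (intro mult_mono) auto
  hence 1: "128 * ((l * a) * (l * a)) \<le> 1 / 8" by simp
  have "l * (l * V) \<le> l * a" using l V by (intro mult_left_mono) auto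
  hence 2: "16 * (l * (l * V)) \<le> 1 / 2" using l by simp
  have "Q + (4 * (l * l) * V) * (4 * (l * l) * V) \<le>
      ((l * l) * V) * (2 + 128 * ((l * a) * (l * a)) + 16 * (l * (l * V)))"
    using Q by (simp add: algebra_simps)
  also have "\<dots> \<le> ((l * l) * V) * 4" using 1 2 V l by (intro mult_left_mono) auto
  finally show ?thesis by simp
qed

lemma two_power_le_exp: "(2::real) ^ h \<le> exp (real h)"
proof -
  have "(2::real) ^ h \<le> exp 1 ^ h" using exp_ge_add_one_self[of 1] by (intro power_mono) auto
  thus ?thesis by (simp add: exp_of_nat_mult[symmetric])
qed

text \<open>With \<open>l = 8 * h / d\<close> the gain \<open>l * S\<close> is at least
  \<open>4 * h\<close>. The correction costs at most \<open>h + l * S / 8\<close>: the first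
  assumption bounds the part with \<open>\<mu>\<close>, and \<open>l * a \<le> 1 / 32\<close> from
  the second bounds the part with \<open>S\<close>. At least \<open>h\<close> is left in the
  exponent, which makes up for the start value \<open>1 / 2 ^ h\<close>.\<close>

lemma escape_potential:
  fixes S R a \<mu> l d :: real and h :: nat
  assumes h: "256 * real h * \<mu> * a \<le> d\<^sup>2" "256 * real h * a \<le> d"
    and d: "0 < d" and l: "l = 8 * real h / d" and a: "0 \<le> a" and S: "d / 2 \<le> S"
    and R: "R \<le> a * (\<mu> + S)"
  shows "1 \<le> (1 / 2 ^ h) * exp (l * S - 4 * (l * l) * R)"
proof -
  have l0: "0 \<le> l" using l d by simp
  have la: "l * a \<le> 1 / 32" using h(2) d by (simp add: l field_simps)
  have "4 * (l * l) * R \<le> 4 * (l * l) * (a * (\<mu> + S))" using R by (intro mult_left_mono) auto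
  also have "\<dots> = 4 * (l * l) * (\<mu> * a) + 4 * (l * a) * (l * S)" by (simp add: algebra_simps)
  also have "4 * (l * l) * (\<mu> * a) \<le> real h"
  proof -
    have "4 * (l * l) * (\<mu> * a) = real h * (256 * real h * \<mu> * a) / d\<^sup>2"
      using d by (simp add: l field_simps power2_eq_square)
    also have "\<dots> \<le> real h * d\<^sup>2 / d\<^sup>2" using h(1) by (intro divide_right_mono mult_left_mono) auto
    finally show ?thesis using d by simp
  qed
  also have "4 * (l * a) * (l * S) \<le> (1 / 8) * (l * S)"
    using la S d l0 by (intro mult_right_mono) auto
  finally have 1: "l * S - 4 * (l * l) * R \<ge> 7 / 8 * (l * S) - real h" by simp
  have "l * S \<ge> l * (d / 2)" using S l0 by (intro mult_left_mono) auto
  moreover have "l * (d / 2) = 4 * real h" using d by (simp add: l)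
  ultimately have "real h \<le> l * S - 4 * (l * l) * R" using 1 by linarith
  hence "2 ^ h \<le> exp (l * S - 4 * (l * l) * R)"
    using two_power_le_exp[of h] by (meson exp_le_cancel_iff le_cases order_trans)
  thus ?thesis by simp
qed

section \<open>One rounding step\<close>

abbreviation RE :: rexp where "RE \<equiv> ROfNat (sc 11)"
abbreviation EE2 :: rexp where "EE2 \<equiv> RMul RE RE"
abbreviation rx :: rexp where "rx \<equiv> RLoad 1 Pid"
abbreviation rxx :: rexp where "rxx \<equiv> RMul rx (RSub (RN 1) rx)"
abbreviation rl :: rexp where "rl \<equiv> RLoad 12 Pid"
abbreviation rll :: rexp where "rll \<equiv> RMul rl rl"
abbreviation rW :: rexp where "rW \<equiv> RAdd (RLoad 13 Pid) (RLoad 14 Pid)"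
abbreviation rA :: rexp where "rA \<equiv> RLoad 0 Pid"
abbreviation rv :: rexp where "rv \<equiv> RMul (RMul (RN 4) rll) (RLoad 20 Pid)"
abbreviation rlX :: rexp where "rlX \<equiv> RMul rl (RLoad 18 Pid)"
abbreviation rlY :: rexp where "rlY \<equiv> RMul (RMul (RN 8) rll) (RLoad 19 Pid)"
abbreviation rq :: rexp where "rq \<equiv> RSub rlX rlY"
abbreviation rq' :: rexp where "rq' \<equiv> RSub (RSub (RN 0) rlX) rlY"
abbreviation rgrow :: rexp where "rgrow \<equiv> RAdd (RN 1) (RDiv (RN 1) (RMul (RN 12) EE2))"
abbreviation ralpha :: rexp where "ralpha \<equiv> RDiv (RSub (RN 1) (RMul (RN 2) rx)) RE"
abbreviation rbeta :: rexp where "rbeta \<equiv> RDiv rxx EE2"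
abbreviation ry :: rexp where "ry \<equiv> RSub (RMul (RLoad 5 Pid) ralpha) rbeta"

text \<open>If a column moves by \<open>\<sigma> * \<delta>\<close>, an entry \<open>a\<close> adds
  \<open>\<sigma> * a * \<delta>\<close> to \<open>S\<close>, and twice
  \<open>\<sigma> * a\<^sup>2 * x * \<delta>\<close> plus \<open>(a * \<delta>)\<^sup>2\<close> to
  \<open>R\<close>. Arrays 6 to 8 hold these three quantities without \<open>\<sigma>\<close>; the
  first two enter the quadratic form with the weights in arrays 16 and 17, the third is independent
  of the signs.\<close>

definition choose_signs :: com where
  "choose_signs =
    Seq (parR nn TT 4 (RDiv rxx RE)) (Seq (parR nn TT 5 (RN 1))
    (Seq (parR mm TT 16 (RMul (RMul (RN 2) rll) rW)) (Seq (parR mm TT 17 (RMul (RMul (RN 128) (RMul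
      (RMul rll rl) rl)) rW))
    (Seq (parR1 zz TT 6 (RMul rA (RLoad 4 COL)))
    (Seq (parR1 zz TT 7 (RMul (RMul (RMul rA rA) (RLoad 1 COL)) (RLoad 4 COL)))
    (Seq (parR1 zz TT 8 (RMul (RMul rA (RLoad 4 COL)) (RMul rA (RLoad 4 COL)))) signs))))))"

text \<open>Arrays 21 and 22 receive the parts of the new row and column potentials that are linear
  in the signs. If their total is positive, all signs are reversed.\<close>

definition orient :: com where
  "orient =
    Seq (parR mm TT 18 (RLoad 6 rootE)) (Seq (parR mm TT 19 (RLoad 7 rootE)) (Seq (parR mm TT 20
      (RLoad 8 rootE))
    (Seq (parR mm TT 21 (RMul (RSub (RN 1) (RMul (RN 2) rv)) (RAdd (RMul (RLoad 13 Pid) rq) (RMul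
      (RLoad 14 Pid) rq'))))
    (Seq (parR nn TT 22 (RMul (RLoad 5 Pid) (RMul (RLoad 3 Pid)
        (RMul (RMul ralpha (RAdd (RDiv (RN 1) (RN 2)) (RDiv rbeta (RN 6)))) rgrow))))
    (Seq (reduce 5 9 8 mm 21) (Seq (reduce 5 9 8 nn 22)
    (If (RLess (RN 0) (RAdd (RLoad 21 (IConst 0)) (RLoad 22 (IConst 0))))
       (Seq (parR mm TT 18 (RSub (RN 0) (RLoad 18 Pid))) (Seq (parR mm TT 19 (RSub (RN 0) (RLoad 19
         Pid)))
         (parR nn TT 5 (RSub (RN 0) (RLoad 5 Pid)))))
       Skip)))))))"

definition escG :: bexp where
  "escG = BNot (BAnd (BNot (RLess (RDiv (RLoad 2 Pid) (RN 2)) (RLoad 15 Pid)))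
     (BNot (RLess (RLoad 15 Pid) (RSub (RN 0) (RDiv (RLoad 2 Pid) (RN 2))))))"

text \<open>The order matters: the row potentials need the old rates and the column potentials the
  old point. Therefore array 1 changes after array 3, and the rates of rows that have just left
  their interval are set to 0 last.\<close>

definition move :: com where
  "move =
    Seq (parR mm TT 13 (RMul (RLoad 13 Pid) (RAdd (RAdd (RN 1) (RSub rq rv)) (RMul (RSub rq rv)
      (RSub rq rv)))))
    (Seq (parR mm TT 14 (RMul (RLoad 14 Pid) (RAdd (RAdd (RN 1) (RSub rq' rv)) (RMul (RSub rq' rv)
      (RSub rq' rv)))))
    (Seq (parR nn TT 3 (RMul (RLoad 3 Pid) (RMul (RSub (RAdd (RN 1) (RDiv ry (RN 2))) (RDiv (RMul
      ry ry) (RN 12))) rgrow)))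
    (Seq (parR nn TT 1 (RAdd rx (RMul (RLoad 5 Pid) (RLoad 4 Pid))))
    (Seq (parR mm TT 15 (RAdd (RLoad 15 Pid) (RLoad 18 Pid)))
    (Seq (parI mm escG 4 (IConst 1)) (parR mm escG 12 (RN 0)))))))"

definition step :: com where
  "step = Seq choose_signs (Seq orient move)"

lemma step_mods [simp]:
  "imods choose_signs = {6, 7, 8, 9}" "rmods choose_signs = {4, 5, 6, 7, 8, 9, 16, 17}"
  "imods orient = {8, 9}" "rmods orient = {5, 18, 19, 20, 21, 22}"
  "imods move = {4}" "rmods move = {1, 3, 12, 13, 14, 15}"
  "imods step = {4, 6, 7, 8, 9}" "rmods step
    = {1, 3, 4, 5, 6, 7, 8, 9, 12, 13, 14, 15, 16, 17, 18, 19, 20, 21, 22}"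
  by (auto simp: choose_signs_def orient_def move_def step_def)

context machine
begin

lemma run_mm:
  assumes "env s" "\<And>i. i < m \<Longrightarrow> rfits W s i v \<and> rval s i v = V i" "rcost v + 8 \<le> D"
  shows "\<exists>t. run W N (parR mm TT x v) D s t \<and> imem t = imem s \<and>
    rmem t = (rmem s)(x := (\<lambda>a. if a < m then V a else rmem s x a))"
proof -
  have "\<exists>t. run W N (parR mm TT x v) D s t \<and> imem t = imem s \<and>
    rmem t = (rmem s)(x := (\<lambda>a. if a < m \<and> (\<lambda>_. True) a then V a else rmem s x a))"
    by (rule run_parR[OF N(1) less_imp_le[OF W_small(2)] mm_eval(1) mm_eval(2) N(3)])
      (use assms W_512 in auto)
  thus ?thesis by simp
qed

lemma run_nn:
  assumes "env s" "\<And>i. i < n \<Longrightarrow> rfits W s i v \<and> rval s i v = V i" "rcost v + 8 \<le> D"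
  shows "\<exists>t. run W N (parR nn TT x v) D s t \<and> imem t = imem s \<and>
    rmem t = (rmem s)(x := (\<lambda>a. if a < n then V a else rmem s x a))"
proof -
  have "\<exists>t. run W N (parR nn TT x v) D s t \<and> imem t = imem s \<and>
    rmem t = (rmem s)(x := (\<lambda>a. if a < n \<and> (\<lambda>_. True) a then V a else rmem s x a))"
    by (rule run_parR[OF N(1) less_imp_le[OF W_small(1)] nn_eval(1) nn_eval(2) N(2)])
      (use assms W_512 in auto)
  thus ?thesis by simp
qed

lemma run_zz1:
  assumes "env s" "\<And>i. i < z \<Longrightarrow> rfits W s i v \<and> rval s i v = V i" "rcost v + 10 \<le> D"
  shows "\<exists>t. run W N (parR1 zz TT x v) D s t \<and> imem t = imem s \<and>
    rmem t = (rmem s)(x := (\<lambda>a. if 0 < a \<and> a - 1 < z then V (a - 1) else rmem s x a))"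
proof -
  have "\<exists>t. run W N (parR1 zz TT x v) D s t \<and> imem t = imem s \<and>
    rmem t = (rmem s)(x := (\<lambda>a. if 0 < a \<and> a - 1 < z \<and>
      (\<lambda>_. True) (a - 1) then V (a - 1) else rmem s x a))"
    by (rule run_parR1[OF N(1) W_small(3) zz_eval(1) zz_eval(2) N(4)])
      (use assms W_512 in auto)
  thus ?thesis by simp
qed

definition Er :: real where "Er = real (32 * (k + L))"

lemma E_le_W: "32 * (k + L) \<le> W" and L_pos: "1 \<le> L"
proof -
  show L0: "1 \<le> L" using two_pow_L(4) by (cases L) auto
  have "1 * (32 * (k + L)) * 1 * 1 \<le> 12 * (32 * (k + L)) * (32 * (k + L)) * L"
    using L0 by (intro mult_le_mono) auto
  thus "32 * (k + L) \<le> W" using W_steps by linarith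
qed

lemma Er_ge: "32 \<le> Er" using L_pos by (simp add: Er_def)

lemma Pid_fits: "i < n \<Longrightarrow> i \<le> W" "i < m \<Longrightarrow> i \<le> W" "i < z \<Longrightarrow> i \<le> W"
  using W_small by auto

lemma const_fits: "0 \<le> W" "1 \<le> W" "2 \<le> W" "4 \<le> W" "6 \<le> W" "8 \<le> W" "12 \<le> W" "128 \<le> W" "Suc 0 \<le> W"
  using W_512 by auto

lemma run_choose_signs:
  fixes s :: mem
  assumes env: "env s" "tab s" and E: "imem s 11 0 = 32 * (k + L)"
    and av: "\<forall>e<z. rmem s 0 e = av e" and Z: "\<forall>a\<ge>z. rmem s 9 a = 0"
    and zero: "rmem s 6 0 = 0" "rmem s 7 0 = 0" "rmem s 8 0 = 0"
  defines "x \<equiv> rmem s 1" and "l \<equiv> rmem s 12" and "w \<equiv> \<lambda>i. rmem s 13 i + rmem s 14 i"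
  defines "\<delta> \<equiv> \<lambda>j. x j * (1 - x j) / Er"
  shows "\<exists>t \<sigma>. run W N choose_signs (400 + L * (928 + 52 * L)) s t \<and>
    (\<forall>a\<ge>z. rmem t 9 a = 0) \<and> rmem t 6 0 = 0 \<and> rmem t 7 0 = 0 \<and> rmem t 8 0 = 0 \<and>
    (\<forall>j<n. rmem t 4 j = \<delta> j) \<and> (\<forall>j<n. rmem t 5 j = \<sigma> j) \<and> (\<forall>j. \<sigma> j = 1 \<or> \<sigma> j = -1) \<and>
    (\<forall>i. rmem t 6 (lead L i 0) = (\<Sum>e\<in>ents i. av e * \<delta> (cl e) * \<sigma> (cl e))) \<and>
    (\<forall>i. rmem t 7 (lead L i 0) = (\<Sum>e\<in>ents i. av e * av e * x (cl e) * \<delta> (cl e) * \<sigma> (cl e))) \<and>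
    (\<forall>i. rmem t 8 (lead L i 0) = (\<Sum>e\<in>ents i. (av e * \<delta> (cl e)) * (av e * \<delta> (cl e)))) \<and>
    (\<Sum>i<m. w i * (2 * (l i * l i) * (\<Sum>e\<in>ents i. av e * \<delta> (cl e) * \<sigma> (cl e))\<^sup>2 +
        128 * (l i * l i * l i * l i) * (\<Sum>e\<in>ents i. av e * av e * x (cl e) * \<delta> (cl e) * \<sigma> (cl e))\<^sup>2))
      \<le> (\<Sum>i<m. w i * (\<Sum>e\<in>ents i. 2 * (l i * l i) * (av e * \<delta> (cl e))\<^sup>2 +
        128 * (l i * l i * l i * l i) * (av e * av e * x (cl e) * \<delta> (cl e))\<^sup>2))"
proof -
  note fits = Pid_fits const_fits E_le_W
  obtain s1 where s1: "run W N (parR nn TT 4 (RDiv rxx RE)) 30 s s1" "imem s1 = imem s"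
    "rmem s1 = (rmem s)(4 := (\<lambda>a. if a < n then \<delta> a else rmem s 4 a))"
    using run_nn[OF env(1), of "RDiv rxx RE" \<delta> 30 4] fits E by (auto simp: \<delta>_def x_def Er_def)
  have env1: "env s1" using env by (simp add: env_def s1)
  obtain s2 where s2: "run W N (parR nn TT 5 (RN 1)) 31 s1 s2" "imem s2 = imem s1"
    "rmem s2 = (rmem s1)(5 := (\<lambda>a. if a < n then 1 else rmem s1 5 a))"
    using run_nn[OF env1, of "RN 1" "\<lambda>_. 1" 31 5] fits by auto
  have env2: "env s2" using env1 by (simp add: env_def s2)
  obtain s3 where s3: "run W N (parR mm TT 16 (RMul (RMul (RN 2) rll) rW)) 40 s2 s3" "imem s3 = imem s2"
    "rmem s3 = (rmem s2)(16 := (\<lambda>i. if i < m then 2 * (l i * l i) * w i else rmem s2 16 i))"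
    using run_mm[OF env2, of "RMul (RMul (RN 2) rll) rW" "\<lambda>i. 2 * (l i * l i) * w i" 40 16] fits
    by (auto simp: l_def w_def s1 s2)
  have env3: "env s3" using env2 by (simp add: env_def s3)
  obtain s4 where s4: "run W N (parR mm TT 17 (RMul (RMul (RN 128) (RMul (RMul rll rl) rl)) rW)) 50
    s3 s4" "imem s4 = imem s3"
    "rmem s4 = (rmem s3)(17 := (\<lambda>i. if i < m then 128 * (l i * l i * l i * l i) * w i else rmem s3
      17 i))"
    using run_mm[OF env3, of "RMul (RMul (RN 128) (RMul (RMul rll rl) rl)) rW"
      "\<lambda>i. 128 * (l i * l i * l i * l i) * w i" 50 17] fits
    by (auto simp: l_def w_def s1 s2 s3)
  have env4: "env s4" using env3 by (simp add: env_def s4)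
  have cW: "e < z \<Longrightarrow> imem s4 2 e = cl e \<and> cl e \<le> W \<and> cl e < n" for e
    using env4 cl[of e] W_small by (auto simp: env_def)
  obtain s5 where s5: "run W N (parR1 zz TT 6 (RMul rA (RLoad 4 COL))) 31 s4 s5" "imem s5 = imem s4"
    "rmem s5 = (rmem s4)(6 := (\<lambda>a. if 0 < a \<and>
      a - 1 < z then av (a - 1) * \<delta> (cl (a - 1)) else rmem s4 6 a))"
    using run_zz1[OF env4, of "RMul rA (RLoad 4 COL)" "\<lambda>e. av e * \<delta> (cl e)" 31 6] fits cW
    by (auto simp: av[rule_format] s1 s2 s3 s4)
  have env5: "env s5" using env4 by (simp add: env_def s5)
  obtain s6 where s6: "run W N (parR1 zz TT 7 (RMul (RMul (RMul rA rA) (RLoad 1 COL)) (RLoad 4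
    COL))) 40 s5 s6" "imem s6 = imem s5"
    "rmem s6 = (rmem s5)(7 := (\<lambda>a. if 0 < a \<and> a - 1 < z then
       av (a - 1) * av (a - 1) * x (cl (a - 1)) * \<delta> (cl (a - 1)) else rmem s5 7 a))"
    using run_zz1[OF env5, of "RMul (RMul (RMul rA rA) (RLoad 1 COL)) (RLoad 4 COL)"
      "\<lambda>e. av e * av e * x (cl e) * \<delta> (cl e)" 40 7] fits cW
    by (auto simp: av[rule_format] x_def s1 s2 s3 s4 s5)
  have env6: "env s6" using env5 by (simp add: env_def s6)
  obtain s7 where s7: "run W N (parR1 zz TT 8 (RMul (RMul rA (RLoad 4 COL)) (RMul rA (RLoad 4
    COL)))) 40 s6 s7" "imem s7 = imem s6"
    "rmem s7 = (rmem s6)(8 := (\<lambda>a. if 0 < a \<and> a - 1 < z then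
       (av (a - 1) * \<delta> (cl (a - 1))) * (av (a - 1) * \<delta> (cl (a - 1))) else rmem s6 8 a))"
    using run_zz1[OF env6, of "RMul (RMul rA (RLoad 4 COL)) (RMul rA (RLoad 4 COL))"
      "\<lambda>e. (av e * \<delta> (cl e)) * (av e * \<delta> (cl e))" 40 8] fits cW
    by (auto simp: av[rule_format] x_def s1 s2 s3 s4 s5 s6)
  have env7: "env s7" "tab s7" using env6 env by (auto simp: env_def tab_def s1 s2 s3 s4 s5 s6 s7)
  have "\<exists>t \<sigma>. run W N signs (22 + L * (928 + 52 * L)) s7 t \<and>
    (\<forall>a\<ge>z. rmem t 9 a = 0) \<and> rmem t 6 0 = 0 \<and> rmem t 7 0 = 0 \<and> rmem t 8 0 = 0 \<and>
    (\<forall>j<n. rmem t 5 j = \<sigma> j) \<and> (\<forall>j. \<sigma> j = 1 \<or> \<sigma> j = -1) \<and>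
    (\<forall>i. rmem t 6 (lead L i 0) = (\<Sum>e\<in>ents i. av e * \<delta> (cl e) * \<sigma> (cl e))) \<and>
    (\<forall>i. rmem t 7 (lead L i 0) = (\<Sum>e\<in>ents i. av e * av e * x (cl e) * \<delta> (cl e) * \<sigma> (cl e))) \<and>
    (\<forall>i. rmem t 8 (lead L i 0) = (\<Sum>e\<in>ents i. (av e * \<delta> (cl e)) * (av e * \<delta> (cl e)))) \<and>
    (\<Sum>i<m. rmem s7 16 i * (\<Sum>e\<in>ents i. av e * \<delta> (cl e) * \<sigma> (cl e))\<^sup>2 +
       rmem s7 17 i * (\<Sum>e\<in>ents i. av e * av e * x (cl e) * \<delta> (cl e) * \<sigma> (cl e))\<^sup>2)
       \<le> (\<Sum>e<z. rmem s7 16 (rw e) * (av e * \<delta> (cl e))\<^sup>2 +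
         rmem s7 17 (rw e) * (av e * av e * x (cl e) * \<delta> (cl e))\<^sup>2)"
    by (rule run_signs[OF env7]) (use Z zero in \<open>auto simp: s1 s2 s3 s4 s5 s6 s7\<close>)
  then obtain t \<sigma> where t: "run W N signs (22 + L * (928 + 52 * L)) s7 t"
    "\<forall>a\<ge>z. rmem t 9 a = 0" "rmem t 6 0 = 0" "rmem t 7 0 = 0" "rmem t 8 0 = 0"
    "\<forall>j<n. rmem t 5 j = \<sigma> j" "\<forall>j. \<sigma> j = 1 \<or> \<sigma> j = -1"
    "\<forall>i. rmem t 6 (lead L i 0) = (\<Sum>e\<in>ents i. av e * \<delta> (cl e) * \<sigma> (cl e))"
    "\<forall>i. rmem t 7 (lead L i 0) = (\<Sum>e\<in>ents i. av e * av e * x (cl e) * \<delta> (cl e) * \<sigma> (cl e))"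
    "\<forall>i. rmem t 8 (lead L i 0) = (\<Sum>e\<in>ents i. (av e * \<delta> (cl e)) * (av e * \<delta> (cl e)))"
    "(\<Sum>i<m. rmem s7 16 i * (\<Sum>e\<in>ents i. av e * \<delta> (cl e) * \<sigma> (cl e))\<^sup>2 +
       rmem s7 17 i * (\<Sum>e\<in>ents i. av e * av e * x (cl e) * \<delta> (cl e) * \<sigma> (cl e))\<^sup>2)
       \<le> (\<Sum>e<z. rmem s7 16 (rw e) * (av e * \<delta> (cl e))\<^sup>2 +
         rmem s7 17 (rw e) * (av e * av e * x (cl e) * \<delta> (cl e))\<^sup>2)"
    by blast
  have run: "run W N choose_signs (400 + L * (928 + 52 * L)) s t"
    unfolding choose_signs_def
    by (rule run_Seq[OF s1(1) run_Seq[OF s2(1) run_Seq[OF s3(1) run_Seq[OF s4(1) run_Seq[OF s5(1)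
          run_Seq[OF s6(1) run_Seq[OF s7(1) t(1) order_refl] order_refl] order_refl] order_refl]
            order_refl] order_refl]]) simp
  have w7: "i < m \<Longrightarrow> rmem s7 16 i = 2 * (l i * l i) * w i"
    "i < m \<Longrightarrow> rmem s7 17 i = 128 * (l i * l i * l i * l i) * w i" for i
    by (simp_all add: s3 s4 s5 s6 s7)
  have \<delta>4: "\<forall>j<n. rmem t 4 j = \<delta> j"
    using run_rmem[OF t(1), of 4] by (simp add: s1 s2 s3 s4 s5 s6 s7)
  have lhs: "(\<Sum>i<m. w i * (2 * (l i * l i) * (\<Sum>e\<in>ents i. av e * \<delta> (cl e) * \<sigma> (cl e))\<^sup>2 +
        128 * (l i * l i * l i * l i) * (\<Sum>e\<in>ents i. av e * av e * x (cl e) * \<delta> (cl e) * \<sigma> (cl e))\<^sup>2))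
     = (\<Sum>i<m. rmem s7 16 i * (\<Sum>e\<in>ents i. av e * \<delta> (cl e) * \<sigma> (cl e))\<^sup>2 +
       rmem s7 17 i * (\<Sum>e\<in>ents i. av e * av e * x (cl e) * \<delta> (cl e) * \<sigma> (cl e))\<^sup>2)"
    by (rule sum.cong) (auto simp: w7 algebra_simps)
  have rhs: "(\<Sum>e<z. rmem s7 16 (rw e) * (av e * \<delta> (cl e))\<^sup>2 +
    rmem s7 17 (rw e) * (av e * av e * x (cl e) * \<delta> (cl e))\<^sup>2)
    = (\<Sum>i<m. w i * (\<Sum>e\<in>ents i. 2 * (l i * l i) * (av e * \<delta> (cl e))\<^sup>2 +
        128 * (l i * l i * l i * l i) * (av e * av e * x (cl e) * \<delta> (cl e))\<^sup>2))"
    unfolding sum_ents[symmetric] sum_distrib_left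
    by (intro sum.cong refl) (auto simp: w7 ents_def algebra_simps)
  show ?thesis
    by (intro exI[of _ t] exI[of _ \<sigma>] conjI) (rule run t(2-10) \<delta>4 t(11)[folded lhs, unfolded rhs])+
qed

text \<open>The row sums \<open>X\<close> and \<open>Y\<close> are odd under a global change of
  sign, while \<open>V\<close> and all squares are even. So the bound on the quadratic form
  survives, and the linear terms can be given the sign that helps.\<close>

lemma run_orient:
  fixes s :: mem
  assumes env: "env s" "tab s" and E: "imem s 11 0 = 32 * (k + L)"
    and zero: "\<forall>a\<ge>m. rmem s 21 a = 0" "\<forall>a\<ge>n. rmem s 22 a = 0"
  defines "x \<equiv> rmem s 1" and "l \<equiv> rmem s 12" and "U \<equiv> rmem s 13" and "D \<equiv> rmem s 14"
    and "\<sigma> \<equiv> rmem s 5" and "H \<equiv> rmem s 3"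
  defines "X \<equiv> \<lambda>i. rmem s 6 (lead L i 0)" and "Y \<equiv> \<lambda>i. rmem s 7 (lead L i 0)"
    and "V \<equiv> \<lambda>i. rmem s 8 (lead L i 0)"
  shows "\<exists>t r. run W N orient (400 + 104 * L) s t \<and> (r = 1 \<or> r = -1) \<and>
    (\<forall>a\<ge>m. rmem t 21 a = 0) \<and> (\<forall>a\<ge>n. rmem t 22 a = 0) \<and>
    (\<forall>i<m. rmem t 18 i = r * X i \<and> rmem t 19 i = r * Y i \<and> rmem t 20 i = V i) \<and>
    (\<forall>j<n. rmem t 5 j = r * \<sigma> j) \<and>
    r * ((\<Sum>i<m. (1 - 2 * (4 * (l i * l i) * V i)) * (U i * (l i * X i - 8 * (l i * l i) * Y i) +
      D i * (- (l i * X i) - 8 * (l i * l i) * Y i))) +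
      (\<Sum>j<n. \<sigma> j * (H j * ((1 - 2 * x j) / Er * (1 / 2 + x j * (1 - x j) / (Er * Er) / 6) * (1 +
        1 / (12 * (Er * Er))))))) \<le> 0"
proof -
  note fits = Pid_fits const_fits E_le_W
  define fR where "fR i = (1 - 2 * (4 * (l i * l i) * V i)) * (U i * (l i * X i - 8 * (l i * l i) *
    Y i) + D i * (- (l i * X i) - 8 * (l i * l i) * Y i))" for i
  define fC where "fC j = \<sigma> j * (H j * ((1 - 2 * x j) / Er * (1 / 2 +
    x j * (1 - x j) / (Er * Er) / 6) * (1 + 1 / (12 * (Er * Er)))))" for j
  note root = rootE_eval
  obtain s1 where s1: "run W N (parR mm TT 18 (RLoad 6 rootE)) 22 s s1" "imem s1 = imem s"
    "rmem s1 = (rmem s)(18 := (\<lambda>a. if a < m then X a else rmem s 18 a))"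
    using run_mm[OF env(1), of "RLoad 6 rootE" X 22 18] root[OF env] by (auto simp: X_def)
  have env1: "env s1" "tab s1" using env by (auto simp: env_def tab_def s1)
  obtain s2 where s2: "run W N (parR mm TT 19 (RLoad 7 rootE)) 22 s1 s2" "imem s2 = imem s1"
    "rmem s2 = (rmem s1)(19 := (\<lambda>a. if a < m then Y a else rmem s1 19 a))"
    using run_mm[OF env1(1), of "RLoad 7 rootE" Y 22 19] root[OF env1] by (auto simp: Y_def s1)
  have env2: "env s2" "tab s2" using env1 by (auto simp: env_def tab_def s2)
  obtain s3 where s3: "run W N (parR mm TT 20 (RLoad 8 rootE)) 22 s2 s3" "imem s3 = imem s2"
    "rmem s3 = (rmem s2)(20 := (\<lambda>a. if a < m then V a else rmem s2 20 a))"
    using run_mm[OF env2(1), of "RLoad 8 rootE" V 22 20] root[OF env2] by (auto simp: V_def s1 s2)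
  have env3: "env s3" "tab s3" using env2 by (auto simp: env_def tab_def s3)
  let ?R = "RMul (RSub (RN 1) (RMul (RN 2) rv)) (RAdd (RMul (RLoad 13 Pid) rq) (RMul (RLoad 14 Pid)
    rq'))"
  have "rcost ?R \<le> 72" by simp
  have "i < m \<Longrightarrow> rfits W s3 i ?R \<and> rval s3 i ?R = fR i" for i
    using fits by (simp add: fR_def s1 s2 s3 U_def D_def l_def)
  from run_mm[OF env3(1), of ?R fR 80 21, OF this]
  obtain s4 where s4: "run W N (parR mm TT 21 ?R) 80 s3 s4" "imem s4 = imem s3"
    "rmem s4 = (rmem s3)(21 := (\<lambda>a. if a < m then fR a else rmem s3 21 a))"
    using \<open>rcost ?R \<le> 72\<close> by auto
  have env4: "env s4" "tab s4" using env3 by (auto simp: env_def tab_def s4)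
  let ?C = "RMul (RLoad 5 Pid) (RMul (RLoad 3 Pid)
        (RMul (RMul ralpha (RAdd (RDiv (RN 1) (RN 2)) (RDiv rbeta (RN 6)))) rgrow))"
  have c: "rcost ?C + 8 \<le> 80" by simp
  have "j < n \<Longrightarrow> rfits W s4 j ?C \<and> rval s4 j ?C = fC j" for j
    using fits E by (simp add: fC_def s1 s2 s3 s4 x_def H_def \<sigma>_def Er_def)
  from run_nn[OF env4(1), of ?C fC 80 22, OF this c]
  obtain s5 where s5: "run W N (parR nn TT 22 ?C) 80 s4 s5" "imem s5 = imem s4"
    "rmem s5 = (rmem s4)(22 := (\<lambda>a. if a < n then fC a else rmem s4 22 a))"
    by blast
  have env5: "env s5" "tab s5" using env4 by (auto simp: env_def tab_def s5)
  have "\<exists>t. run W N (reduce 5 9 8 mm 21) (22 + L * (2 + 50)) s5 t \<and>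
    rmem t 21 0 = (\<Sum>a<m. rmem s5 21 a) \<and> (\<forall>a\<ge>m. rmem t 21 a = 0)"
  proof (rule run_reduce[OF N(1) W_pow W_small(8)])
    fix s' :: mem assume "\<And>y. y \<noteq> 9 \<Longrightarrow> y \<noteq> 8 \<Longrightarrow> imem s' y = imem s5 y"
    hence "env s'" by (intro env_cong[OF env5(1)]) auto
    thus "ifits W s' 0 mm \<and> ival s' 0 mm = m" using mm_eval by simp
  qed (use env5 zero N two_pow_L in \<open>auto simp: env_def s1 s2 s3 s4 s5\<close>)
  then obtain s6 where s6: "run W N (reduce 5 9 8 mm 21) (22 + L * (2 + 50)) s5 s6"
    "rmem s6 21 0 = (\<Sum>a<m. rmem s5 21 a)" "\<forall>a\<ge>m. rmem s6 21 a = 0" by blast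
  have f6: "x \<noteq> 21 \<Longrightarrow> rmem s6 x = rmem s5 x" "x \<notin> {8, 9} \<Longrightarrow> imem s6 x = imem s5 x" for x
    using run_rmem[OF s6(1)] run_imem[OF s6(1)] by auto
  have env6: "env s6" "tab s6" using env5 by (auto simp: env_def tab_def f6)
  have "\<exists>t. run W N (reduce 5 9 8 nn 22) (22 + L * (2 + 50)) s6 t \<and>
    rmem t 22 0 = (\<Sum>a<n. rmem s6 22 a) \<and> (\<forall>a\<ge>n. rmem t 22 a = 0)"
  proof (rule run_reduce[OF N(1) W_pow W_small(7)])
    fix s' :: mem assume "\<And>y. y \<noteq> 9 \<Longrightarrow> y \<noteq> 8 \<Longrightarrow> imem s' y = imem s6 y"
    hence "env s'" by (intro env_cong[OF env6(1)]) auto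
    thus "ifits W s' 0 nn \<and> ival s' 0 nn = n" using nn_eval by simp
  qed (use env6 zero N two_pow_L in \<open>auto simp: env_def s1 s2 s3 s4 s5 f6\<close>)
  then obtain s7 where s7: "run W N (reduce 5 9 8 nn 22) (22 + L * (2 + 50)) s6 s7"
    "rmem s7 22 0 = (\<Sum>a<n. rmem s6 22 a)" "\<forall>a\<ge>n. rmem s7 22 a = 0" by blast
  have f7: "x \<noteq> 22 \<Longrightarrow> rmem s7 x = rmem s6 x" "x \<notin> {8, 9} \<Longrightarrow> imem s7 x = imem s6 x" for x
    using run_rmem[OF s7(1)] run_imem[OF s7(1)] by auto
  have env7: "env s7" using env6 by (auto simp: env_def f7)
  have tot: "rmem s7 21 0 + rmem s7 22 0 = (\<Sum>i<m. fR i) + (\<Sum>j<n. fC j)"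
    by (simp add: f7 s7 f6 s6 s5 s4)
  have v7: "i < m \<Longrightarrow> rmem s7 18 i = X i \<and> rmem s7 19 i = Y i \<and> rmem s7 20 i = V i" "rmem s7 5 = \<sigma>" for i
    by (simp_all add: f7 f6 s5 s4 s3 s2 s1 \<sigma>_def)
  let ?b = "RLess (RN 0) (RAdd (RLoad 21 (IConst 0)) (RLoad 22 (IConst 0)))"
  let ?neg = "Seq (parR mm TT 18 (RSub (RN 0) (RLoad 18 Pid))) (Seq (parR mm TT 19 (RSub (RN 0)
    (RLoad 19 Pid)))
         (parR nn TT 5 (RSub (RN 0) (RLoad 5 Pid))))"
  have "\<exists>t r. run W N (If ?b ?neg Skip) 60 s7 t \<and> (r = 1 \<or> r = -1) \<and>
    r * (rmem s7 21 0 + rmem s7 22 0) \<le> 0 \<and>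
    (\<forall>a\<ge>m. rmem t 21 a = 0) \<and> (\<forall>a\<ge>n. rmem t 22 a = 0) \<and>
    (\<forall>i<m. rmem t 18 i = r * X i \<and> rmem t 19 i = r * Y i \<and> rmem t 20 i = V i) \<and>
      (\<forall>j<n. rmem t 5 j = r * \<sigma> j)"
  proof (cases "0 < rmem s7 21 0 + rmem s7 22 0")
    case True
    obtain u1 where u1: "run W N (parR mm TT 18 (RSub (RN 0) (RLoad 18 Pid))) 15 s7 u1"
      "imem u1 = imem s7"
      "rmem u1 = (rmem s7)(18 := (\<lambda>a. if a < m then - X a else rmem s7 18 a))"
      using run_mm[OF env7, of "RSub (RN 0) (RLoad 18 Pid)" "\<lambda>a. - X a" 15 18] fits v7 by auto
    have eu1: "env u1" using env7 by (auto simp: env_def u1)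
    obtain u2 where u2: "run W N (parR mm TT 19 (RSub (RN 0) (RLoad 19 Pid))) 15 u1 u2"
      "imem u2 = imem u1"
      "rmem u2 = (rmem u1)(19 := (\<lambda>a. if a < m then - Y a else rmem u1 19 a))"
      using run_mm[OF eu1, of "RSub (RN 0) (RLoad 19 Pid)" "\<lambda>a. - Y a" 15 19] fits v7 by (auto simp: u1)
    have eu2: "env u2" using eu1 by (auto simp: env_def u2)
    obtain u3 where u3: "run W N (parR nn TT 5 (RSub (RN 0) (RLoad 5 Pid))) 15 u2 u3" "imem u3 = imem u2"
      "rmem u3 = (rmem u2)(5 := (\<lambda>a. if a < n then - \<sigma> a else rmem u2 5 a))"
      using run_nn[OF eu2, of "RSub (RN 0) (RLoad 5 Pid)" "\<lambda>a. - \<sigma> a" 15 5] fits v7 by (auto simp: u1 u2)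
    have rn: "run W N ?neg 45 s7 u3" by (rule run_Seq[OF u1(1) run_Seq[OF u2(1) u3(1) order_refl]]) simp
    have "run W N (If ?b ?neg Skip) 60 s7 u3"
      by (rule run_If[OF N(1), of _ _ _ _ 45]) (use rn True in auto)
    thus ?thesis using True s7(3) s6(3) f7(1)[of 21] v7
      by (intro exI[of _ u3] exI[of _ "-1"]) (auto simp: u1 u2 u3)
  next
    case False
    have "run W N (If ?b ?neg Skip) 60 s7 s7"
      by (rule run_If[OF N(1), of _ _ _ _ 45]) (use False run_Skip in auto)
    thus ?thesis using False s7(3) s6(3) f7(1)[of 21] v7
      by (intro exI[of _ s7] exI[of _ 1]) auto
  qed
  then obtain t r where t: "run W N (If ?b ?neg Skip) 60 s7 t" "r = 1 \<or> r = -1"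
    "r * (rmem s7 21 0 + rmem s7 22 0) \<le> 0"
    "\<forall>a\<ge>m. rmem t 21 a = 0" "\<forall>a\<ge>n. rmem t 22 a = 0"
    "\<forall>i<m. rmem t 18 i = r * X i \<and> rmem t 19 i = r * Y i \<and> rmem t 20 i = V i"
      "\<forall>j<n. rmem t 5 j = r * \<sigma> j"
    by (elim exE conjE) (rule that; assumption)
  have run: "run W N orient (400 + 104 * L) s t"
    unfolding orient_def
    by (rule run_Seq[OF s1(1) run_Seq[OF s2(1) run_Seq[OF s3(1) run_Seq[OF s4(1) run_Seq[OF s5(1)
          run_Seq[OF s6(1) run_Seq[OF s7(1) t(1) order_refl] order_refl] order_refl] order_refl]
            order_refl] order_refl]]) simp
  show ?thesis
    by (intro exI[of _ t] exI[of _ r] conjI) (rule run t(2) t(4-7) t(3)[unfolded tot fR_def fC_def])+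
qed

lemma run_move:
  fixes s :: mem
  assumes env: "env s" and E: "imem s 11 0 = 32 * (k + L)"
  defines "x \<equiv> rmem s 1" and "l \<equiv> rmem s 12" and "U \<equiv> rmem s 13" and "D \<equiv> rmem s 14"
    and "\<sigma> \<equiv> rmem s 5" and "H \<equiv> rmem s 3"
    and "\<delta> \<equiv> rmem s 4"
  defines "X \<equiv> rmem s 18" and "Y \<equiv> rmem s 19" and "V \<equiv> rmem s 20"
  defines "q \<equiv> \<lambda>i. l i * X i - 8 * (l i * l i) * Y i - 4 * (l i * l i) * V i"
    and "q' \<equiv> \<lambda>i. - (l i * X i) - 8 * (l i * l i) * Y i - 4 * (l i * l i) * V i"
    and "y \<equiv> \<lambda>j. \<sigma> j * ((1 - 2 * x j) / Er) - x j * (1 - x j) / (Er * Er)"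
    and "S \<equiv> \<lambda>i. rmem s 15 i + X i"
  defines "esc \<equiv> \<lambda>i. rmem s 2 i / 2 < S i \<or> S i < - (rmem s 2 i / 2)"
  shows "\<exists>t. run W N move 600 s t \<and>
    (\<forall>i<m. rmem t 13 i = U i * (1 + q i + q i * q i) \<and> rmem t 14 i = D i * (1 + q' i + q' i * q' i) \<and>
       rmem t 15 i = S i \<and> imem t 4 i = (if esc i then 1 else imem s 4 i) \<and>
         rmem t 12 i = (if esc i then 0 else l i)) \<and>
    (\<forall>j<n. rmem t 3 j = H j * ((1 + y j / 2 - y j * y j / 12) * (1 + 1 / (12 * (Er * Er)))) \<and>
       rmem t 1 j = x j + \<sigma> j * \<delta> j)"
proof -
  note fits = Pid_fits const_fits E_le_W
  let ?u = "RMul (RLoad 13 Pid) (RAdd (RAdd (RN 1) (RSub rq rv)) (RMul (RSub rq rv) (RSub rq rv)))"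
  have c1: "rcost ?u + 8 \<le> 120" by simp
  have "i < m \<Longrightarrow> rfits W s i ?u \<and> rval s i ?u = U i * (1 + q i + q i * q i)" for i
    using fits by (simp add: U_def q_def l_def X_def Y_def V_def)
  from run_mm[OF env, of ?u "\<lambda>i. U i * (1 + q i + q i * q i)" 120 13, OF this c1]
  obtain s1 where s1: "run W N (parR mm TT 13 ?u) 120 s s1" "imem s1 = imem s"
    "rmem s1 = (rmem s)(13 := (\<lambda>a. if a < m then U a * (1 + q a + q a * q a) else rmem s 13 a))" by blast
  have env1: "env s1" using env by (auto simp: env_def s1)
  let ?d = "RMul (RLoad 14 Pid) (RAdd (RAdd (RN 1) (RSub rq' rv)) (RMul (RSub rq' rv) (RSub rq' rv)))"
  have c2: "rcost ?d + 8 \<le> 140" by simp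
  have "i < m \<Longrightarrow> rfits W s1 i ?d \<and> rval s1 i ?d = D i * (1 + q' i + q' i * q' i)" for i
    using fits by (simp add: D_def q'_def l_def X_def Y_def V_def s1)
  from run_mm[OF env1, of ?d "\<lambda>i. D i * (1 + q' i + q' i * q' i)" 140 14, OF this c2]
  obtain s2 where s2: "run W N (parR mm TT 14 ?d) 140 s1 s2" "imem s2 = imem s1"
    "rmem s2 = (rmem s1)(14 := (\<lambda>a. if a < m then D a * (1 + q' a +
      q' a * q' a) else rmem s1 14 a))" by blast
  have env2: "env s2" using env1 by (auto simp: env_def s2)
  let ?h = "RMul (RLoad 3 Pid) (RMul (RSub (RAdd (RN 1) (RDiv ry (RN 2))) (RDiv (RMul ry ry) (RN
    12))) rgrow)"
  have c3: "rcost ?h + 8 \<le> 180" by simp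
  have "j < n \<Longrightarrow> rfits W s2 j ?h \<and>
    rval s2 j ?h = H j * ((1 + y j / 2 - y j * y j / 12) * (1 + 1 / (12 * (Er * Er))))" for j
    using fits E by (simp add: H_def y_def x_def \<sigma>_def Er_def s1 s2)
  from run_nn[OF env2, of ?h "\<lambda>j. H j * ((1 + y j / 2 - y j * y j / 12) * (1 +
    1 / (12 * (Er * Er))))" 180 3, OF this c3]
  obtain s3 where s3: "run W N (parR nn TT 3 ?h) 180 s2 s3" "imem s3 = imem s2"
    "rmem s3 = (rmem s2)(3 := (\<lambda>j. if j < n then H j * ((1 + y j / 2 - y j * y j / 12) * (1 +
      1 / (12 * (Er * Er)))) else rmem s2 3 j))" by blast
  have env3: "env s3" using env2 by (auto simp: env_def s3)
  let ?x = "RAdd rx (RMul (RLoad 5 Pid) (RLoad 4 Pid))"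
  obtain s4 where s4: "run W N (parR nn TT 1 ?x) 20 s3 s4" "imem s4 = imem s3"
    "rmem s4 = (rmem s3)(1 := (\<lambda>j. if j < n then x j + \<sigma> j * \<delta> j else rmem s3 1 j))"
    using run_nn[OF env3, of ?x "\<lambda>j. x j + \<sigma> j * \<delta> j" 20 1] fits
      by (auto simp: x_def \<sigma>_def \<delta>_def s1 s2 s3)
  have env4: "env s4" using env3 by (auto simp: env_def s4)
  obtain s5 where s5: "run W N (parR mm TT 15 (RAdd (RLoad 15 Pid) (RLoad 18 Pid))) 20 s4 s5"
    "imem s5 = imem s4"
    "rmem s5 = (rmem s4)(15 := (\<lambda>i. if i < m then S i else rmem s4 15 i))"
    using run_mm[OF env4, of "RAdd (RLoad 15 Pid) (RLoad 18 Pid)" S 20 15] fits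
      by (auto simp: S_def X_def s1 s2 s3 s4)
  have env5: "env s5" using env4 by (auto simp: env_def s5)
  have cG: "bcost escG = 23" by (simp add: escG_def)
  have G: "bfits W s' i escG \<and> bval s' i escG = esc i" if "i < m" "rmem s' 15 = rmem s5 15"
    "rmem s' 2 = rmem s5 2" for s' i
    using fits that by (auto simp: escG_def esc_def s1 s2 s3 s4 s5)
  have "\<exists>t. run W N (parI mm escG 4 (IConst 1)) 40 s5 t \<and> rmem t = rmem s5 \<and>
    imem t = (imem s5)(4 := (\<lambda>i. if i < m \<and> esc i then (\<lambda>_. 1) i else imem s5 4 i))"
    by (rule run_parI[OF N(1) less_imp_le[OF W_small(2)] mm_eval(1)[OF env5] mm_eval(2)[OF env5] N(3)])
      (use fits G cG in auto)
  then obtain s6 where s6: "run W N (parI mm escG 4 (IConst 1)) 40 s5 s6" "rmem s6 = rmem s5"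
    "imem s6 = (imem s5)(4 := (\<lambda>i. if i < m \<and> esc i then 1 else imem s5 4 i))" by blast
  have env6: "env s6" using env5 by (auto simp: env_def s6)
  have "\<exists>t. run W N (parR mm escG 12 (RN 0)) 40 s6 t \<and> imem t = imem s6 \<and>
    rmem t = (rmem s6)(12 := (\<lambda>i. if i < m \<and> esc i then (\<lambda>_. 0) i else rmem s6 12 i))"
    by (rule run_parR[OF N(1) less_imp_le[OF W_small(2)] mm_eval(1)[OF env6] mm_eval(2)[OF env6] N(3)])
      (use fits G s6 cG in auto)
  then obtain t where t: "run W N (parR mm escG 12 (RN 0)) 40 s6 t" "imem t = imem s6"
    "rmem t = (rmem s6)(12 := (\<lambda>i. if i < m \<and> esc i then 0 else rmem s6 12 i))" by blast
  have "run W N move (120 + (140 + (180 + (20 + (20 + (40 + 40)))))) s t"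
    unfolding move_def
    by (rule run_Seq[OF s1(1) run_Seq[OF s2(1) run_Seq[OF s3(1) run_Seq[OF s4(1) run_Seq[OF s5(1)
          run_Seq[OF s6(1) t(1) order_refl] order_refl] order_refl] order_refl] order_refl]]) simp
  hence run: "run W N move 600 s t" by (rule run_mono) simp
  show ?thesis
    by (intro exI[of _ t] conjI allI impI) (use run in \<open>auto simp: t s6 s5 s4 s3 s2 s1 l_def\<close>)
qed

end

section \<open>Effect of one step on the potentials of a row\<close>

locale rounding = machine +
  fixes av p \<Delta> :: "nat \<Rightarrow> real"
  assumes av: "e < z \<Longrightarrow> 0 \<le> av e" and p: "j < n \<Longrightarrow> 0 \<le> p j" "j < n \<Longrightarrow> p j \<le> 1"
    and \<Delta>: "i < m \<Longrightarrow> 0 < \<Delta> i"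
begin

definition mu :: "nat \<Rightarrow> real" where "mu i = (\<Sum>e\<in>ents i. av e * p (cl e))"
definition am :: "nat \<Rightarrow> real" where "am i = Max (insert 0 (av ` ents i))"

text \<open>The comparison of the three quotients of the exponent with \<open>256 * t\<close>, free
  of divisions so that zero denominators need no case distinction. With
  \<open>l = 8 * t / \<Delta> i\<close>, the constant 256 yields
  \<open>l * am i \<le> 1 / 32\<close>, \<open>l * mu i \<le> k / 32\<close> and
  \<open>4 * l\<^sup>2 * mu i * am i \<le> t\<close>.\<close>

definition cond :: "nat \<Rightarrow> nat \<Rightarrow> bool" where
  "cond i t \<longleftrightarrow> 256 * real t * mu i * am i \<le> (\<Delta> i)\<^sup>2 \<and> 256 * real t * am i \<le> \<Delta> i \<and>
     256 * real t * mu i \<le> \<Delta> i * real k"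

definition dev :: "(nat \<Rightarrow> real) \<Rightarrow> nat \<Rightarrow> real" where
  "dev x i = (\<Sum>e\<in>ents i. av e * (x (cl e) - p (cl e)))"
definition dev2 :: "(nat \<Rightarrow> real) \<Rightarrow> nat \<Rightarrow> real" where
  "dev2 x i = (\<Sum>e\<in>ents i. (av e * av e) * ((x (cl e))\<^sup>2 - (p (cl e))\<^sup>2))"

text \<open>\<open>exp (\<plusminus> l S - 4 l\<^sup>2 R)\<close> is a supermartingale for \<open>S = dev x i\<close> and \<open>R = dev2 x i\<close>. The program updates \<open>U\<close>
  and \<open>D\<close> by \<open>1 + q + q\<^sup>2\<close> instead of \<open>exp q\<close>, which keeps them above it. A row that has left its
  interval is marked and gets \<open>l = 0\<close>, which freezes its potential.\<close>

definition row_inv :: "(nat \<Rightarrow> real) \<Rightarrow> nat \<Rightarrow> nat \<Rightarrow> real \<Rightarrow> real \<Rightarrow> real \<Rightarrow> bool" where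
  "row_inv x i bad l U D \<longleftrightarrow> (bad = 1 \<and> l = 0 \<and> 0 \<le> U \<and> 0 \<le> D \<and> 1 \<le> U + D) \<or>
    (bad = 0 \<and> (\<exists>h. 1 \<le> h \<and> h \<le> L \<and> cond i h \<and> l = 8 * real h / \<Delta> i \<and> \<bar>dev x i\<bar> \<le> \<Delta> i / 2 \<and>
      (1 / 2 ^ h) * exp (l * dev x i - 4 * (l * l) * dev2 x i) \<le> U \<and>
      (1 / 2 ^ h) * exp (- (l * dev x i) - 4 * (l * l) * dev2 x i) \<le> D))"

lemma row_inv_nonneg: "row_inv x i bad l U D \<Longrightarrow> 0 \<le> U \<and> 0 \<le> D"
proof -
  have "0 \<le> (1 / 2 ^ h) * exp y" for h :: nat and y :: real by simp
  thus "row_inv x i bad l U D \<Longrightarrow> 0 \<le> U \<and> 0 \<le> D"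
    unfolding row_inv_def by (meson order_trans)
qed

lemma am_ge: "e \<in> ents i \<Longrightarrow> av e \<le> am i" and am_nonneg: "0 \<le> am i"
  by (auto simp: am_def intro!: Max_ge)

lemma ents_lt: "e \<in> ents i \<Longrightarrow> e < z \<and> cl e < n" by (auto simp: ents_def cl)

text \<open>\<open>mu i + dev x i\<close> is the current row sum of \<open>av e * x (cl e)\<close>,
  so a bound for each entry relative to its share of the row sum carries over to the sum.\<close>

lemma row_abs_bound:
  assumes "\<And>e. e \<in> ents i \<Longrightarrow> \<bar>f e\<bar> \<le> c * (av e * x (cl e))"
  shows "\<bar>\<Sum>e\<in>ents i. f e\<bar> \<le> c * (mu i + dev x i)"
proof -
  have "\<bar>\<Sum>e\<in>ents i. f e\<bar> \<le> (\<Sum>e\<in>ents i. \<bar>f e\<bar>)" by (rule sum_abs)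
  also have "\<dots> \<le> (\<Sum>e\<in>ents i. c * (av e * x (cl e)))" by (rule sum_mono) (rule assms)
  also have "\<dots> = c * (mu i + dev x i)"
    by (simp add: mu_def dev_def sum.distrib[symmetric] sum_distrib_left algebra_simps)
  finally show ?thesis .
qed

definition del :: "(nat \<Rightarrow> real) \<Rightarrow> nat \<Rightarrow> real" where "del x j = x j * (1 - x j) / Er"
definition rX :: "(nat \<Rightarrow> real) \<Rightarrow> (nat \<Rightarrow> real) \<Rightarrow> nat \<Rightarrow> real" where
  "rX x \<sigma> i = (\<Sum>e\<in>ents i. av e * del x (cl e) * \<sigma> (cl e))"
definition rY :: "(nat \<Rightarrow> real) \<Rightarrow> (nat \<Rightarrow> real) \<Rightarrow> nat \<Rightarrow> real" where
  "rY x \<sigma> i = (\<Sum>e\<in>ents i. av e * av e * x (cl e) * del x (cl e) * \<sigma> (cl e))"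
definition rV :: "(nat \<Rightarrow> real) \<Rightarrow> nat \<Rightarrow> real" where
  "rV x i = (\<Sum>e\<in>ents i. (av e * del x (cl e)) * (av e * del x (cl e)))"

context
  fixes x \<sigma> :: "nat \<Rightarrow> real"
  assumes x_unit: "\<forall>j<n. 0 \<le> x j \<and> x j \<le> 1" and sgn: "\<forall>j. \<sigma> j = 1 \<or> \<sigma> j = -1"
begin

lemma x_bounds: "j < n \<Longrightarrow> 0 \<le> x j" "j < n \<Longrightarrow> x j \<le> 1"
  using x_unit by auto

lemma del_bounds: "j < n \<Longrightarrow> 0 \<le> del x j" "j < n \<Longrightarrow> del x j \<le> x j / Er" "j < n \<Longrightarrow> del x j \<le> 1"
proof -
  assume j: "j < n"
  have E: "0 < Er" "1 \<le> Er" using Er_ge by auto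
  have "0 \<le> x j * (1 - x j)" "x j * (1 - x j) \<le> x j * 1"
    using x_bounds[OF j] mult_left_mono[of "1 - x j" 1 "x j"] by auto
  thus "0 \<le> del x j" "del x j \<le> x j / Er" using E by (auto simp: del_def divide_right_mono)
  moreover have "x j / Er \<le> 1" using x_bounds[OF j] E by simp
  ultimately show "del x j \<le> 1" by linarith
qed

text \<open>A coordinate moves by at most the fraction \<open>1 / Er\<close> of itself, so
  \<open>rX\<close> is at most this fraction of the row sum. \<open>rY\<close> and \<open>rV\<close>
  contain one more factor that is at most \<open>am i\<close>.\<close>

lemma row_bounds:
  "\<bar>rX x \<sigma> i\<bar> \<le> (1 / Er) * (mu i + dev x i)"
  "\<bar>rY x \<sigma> i\<bar> \<le> (am i / Er) * (mu i + dev x i)"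
  "0 \<le> rV x i" "rV x i \<le> (am i / Er) * (mu i + dev x i)"
proof -
  have E: "0 < Er" using Er_ge by simp
  have s1: "\<bar>\<sigma> j\<bar> = 1" for j using sgn[rule_format, of j] by auto
  have ad: "av e * del x (cl e) \<le> (1 / Er) * (av e * x (cl e))"
    "0 \<le> av e * del x (cl e)" if "e \<in> ents i" for e
    using mult_left_mono[OF del_bounds(2)[of "cl e"] av[of e]] ents_lt[OF that] del_bounds(1)[of
      "cl e"] av[of e]
    by (auto simp: field_simps)
  show "\<bar>rX x \<sigma> i\<bar> \<le> (1 / Er) * (mu i + dev x i)"
    unfolding rX_def
  proof (rule row_abs_bound)
    fix e assume e: "e \<in> ents i"
    have "\<bar>av e * del x (cl e) * \<sigma> (cl e)\<bar> = \<bar>av e * del x (cl e)\<bar> * \<bar>\<sigma> (cl e)\<bar>" by (rule abs_mult)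
    also have "\<dots> = av e * del x (cl e)" using ad(2)[OF e] s1 by (simp only: abs_of_nonneg mult_1_right)
    finally show "\<bar>av e * del x (cl e) * \<sigma> (cl e)\<bar> \<le> (1 / Er) * (av e * x (cl e))"
      using ad(1)[OF e] by simp
  qed
  have aad: "c * (av e * del x (cl e)) \<le> (am i / Er) * (av e * x (cl e))" if "e \<in> ents i" "0 \<le> c"
    "c \<le> am i" for e c
  proof -
    have "c * (av e * del x (cl e)) \<le> am i * ((1 / Er) * (av e * x (cl e)))"
      by (rule mult_mono[OF that(3) ad(1)[OF that(1)] am_nonneg ad(2)[OF that(1)]])
    thus ?thesis by simp
  qed
  have avb: "0 \<le> av e" "av e \<le> am i" "0 \<le> x (cl e)" "x (cl e) \<le> 1" "0 \<le> del x (cl e)"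
    "del x (cl e) \<le> 1" if "e \<in> ents i" for e
    using ents_lt[OF that] av am_ge[OF that] x_bounds del_bounds by auto
  have avx: "0 \<le> av e * x (cl e)" "av e * x (cl e) \<le> am i" "0 \<le> av e * del x (cl e)"
    "av e * del x (cl e) \<le> am i" if "e \<in> ents i" for e
    using avb[OF that] mult_mono[of "av e" "am i" "x (cl e)" 1] mult_mono[of "av e" "am i"
      "del x (cl e)" 1] am_nonneg by auto
  show "\<bar>rY x \<sigma> i\<bar> \<le> (am i / Er) * (mu i + dev x i)"
    unfolding rY_def
  proof (rule row_abs_bound)
    fix e assume e: "e \<in> ents i"
    have "\<bar>av e * av e * x (cl e) * del x (cl e) * \<sigma> (cl e)\<bar> = (av e * x (cl e)) * (av e * del x (cl e))"
      using avb[OF e] s1 by (simp add: abs_mult)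
    thus "\<bar>av e * av e * x (cl e) * del x (cl e) * \<sigma> (cl e)\<bar> \<le> (am i / Er) * (av e * x (cl e))"
      using aad[OF e avx(1,2)[OF e]] by simp
  qed
  have "\<bar>rV x i\<bar> \<le> (am i / Er) * (mu i + dev x i)"
    unfolding rV_def
  proof (rule row_abs_bound)
    fix e assume e: "e \<in> ents i"
    show "\<bar>(av e * del x (cl e)) * (av e * del x (cl e))\<bar> \<le> (am i / Er) * (av e * x (cl e))"
      using aad[OF e avx(3,4)[OF e]] avx[OF e] by (simp add: abs_mult)
  qed
  moreover show "0 \<le> rV x i" unfolding rV_def by (intro sum_nonneg) auto
  ultimately show "rV x i \<le> (am i / Er) * (mu i + dev x i)" by simp
qed

text \<open>This dictates \<open>Er = 32 * (k + L)\<close>. The third part of \<open>cond\<close>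
  gives \<open>l * mu i \<le> k / 32\<close>, and inside the interval
  \<open>l * dev x i \<le> 4 * h \<le> 4 * L\<close>; thus \<open>l\<close> times the row sum is at
  most \<open>Er / 8\<close>, and \<open>l\<close> times its change in one step at most
  \<open>1 / 8\<close>. The terms with \<open>rY\<close> and \<open>rV\<close> have a further factor
  \<open>l * am i \<le> 1 / 32\<close>.\<close>

lemma alive_bounds:
  assumes i: "i < m" and h: "h \<le> L" "cond i h" "l = 8 * real h / \<Delta> i" and S: "\<bar>dev x i\<bar> \<le> \<Delta> i / 2"
  shows "0 \<le> l" "l * am i \<le> 1 / 32" "l * rV x i \<le> am i"
    "\<bar>l * rX x \<sigma> i - 8 * (l * l) * rY x \<sigma> i - 4 * (l * l) * rV x i\<bar> \<le> 1"
    "\<bar>- (l * rX x \<sigma> i) - 8 * (l * l) * rY x \<sigma> i - 4 * (l * l) * rV x i\<bar> \<le> 1"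
proof -
  note d = \<Delta>[OF i]
  have E: "0 < Er" using Er_ge by simp
  show l0: "0 \<le> l" using h d by simp
  show la: "l * am i \<le> 1 / 32" unfolding h(3) using h(2) d by (simp add: cond_def field_simps)
  define B where "B = l * ((1 / Er) * (mu i + dev x i))"
  have "l * mu i \<le> real k / 32" unfolding h(3) using h(2) d by (simp add: cond_def field_simps)
  moreover have "l * dev x i \<le> l * (\<Delta> i / 2)" using S l0 by (intro mult_left_mono) auto
  moreover have "l * (\<Delta> i / 2) = 4 * real h" using h d by simp
  moreover have "real h \<le> real L" using h by simp
  ultimately have "l * (mu i + dev x i) \<le> real k / 32 + 4 * real L" by (simp add: distrib_left)
  also have "\<dots> \<le> Er / 8" by (simp add: Er_def)
  finally have B8: "B \<le> 1 / 8" using E by (simp add: B_def field_simps)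
  have X: "\<bar>l * rX x \<sigma> i\<bar> \<le> B"
    using mult_left_mono[OF row_bounds(1) l0, of i] l0 by (simp add: B_def abs_mult)
  have B0: "0 \<le> B" using X by linarith
  have sc: "l * v \<le> am i * B" if "v \<le> (am i / Er) * (mu i + dev x i)" for v
    using mult_left_mono[OF that l0] by (simp add: B_def ac_simps)
  have "l * rV x i \<le> am i * B" using sc row_bounds(4) by blast
  also have "\<dots> \<le> am i * 1" using am_nonneg B8 by (intro mult_left_mono) auto
  finally show "l * rV x i \<le> am i" by simp
  have sc2: "(l * l) * v \<le> 1 / 32 * B" if "v \<le> (am i / Er) * (mu i + dev x i)" for v
  proof -
    have "l * (l * v) \<le> l * (am i * B)" using sc[OF that] l0 by (rule mult_left_mono)
    also have "\<dots> = (l * am i) * B" by simp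
    also have "\<dots> \<le> 1 / 32 * B" using la B0 by (rule mult_right_mono)
    finally show ?thesis by (simp add: mult.assoc)
  qed
  have Y: "\<bar>(l * l) * rY x \<sigma> i\<bar> \<le> 1 / 32 * B"
    using sc2[OF row_bounds(2)[of i]] l0 by (simp add: abs_mult)
  have V: "(l * l) * rV x i \<le> 1 / 32 * B" "0 \<le> (l * l) * rV x i"
    using sc2[OF row_bounds(4)[of i]] row_bounds(3)[of i] by auto
  have e: "8 * (l * l) * rY x \<sigma> i = 8 * ((l * l) * rY x \<sigma> i)"
    "4 * (l * l) * rV x i = 4 * ((l * l) * rV x i)" by simp_all
  show "\<bar>l * rX x \<sigma> i - 8 * (l * l) * rY x \<sigma> i - 4 * (l * l) * rV x i\<bar> \<le> 1"
    "\<bar>- (l * rX x \<sigma> i) - 8 * (l * l) * rY x \<sigma> i - 4 * (l * l) * rV x i\<bar> \<le> 1"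
    unfolding e using X Y V B8 by linarith+
qed

text \<open>Weighted by the row potentials, the first sum is the share of this row in the diagonal
  form to which the signs are compared. It fits into the drift because
  \<open>av e * x (cl e) \<le> am i\<close> reduces its quartic part to a multiple of
  \<open>rV x i\<close>.\<close>

lemma row_second_order:
  assumes i: "i < m" and inv: "row_inv x i bad l U D"
  shows "(\<Sum>e\<in>ents i. 2 * (l * l) * (av e * del x (cl e))\<^sup>2 +
    128 * (l * l * l * l) * (av e * av e * x (cl e) * del x (cl e))\<^sup>2)
    + (4 * (l * l) * rV x i) * (4 * (l * l) * rV x i) \<le> 4 * (l * l) * rV x i"
proof (cases "l = 0")
  \<comment> \<open>Only rows still inside their interval have \<open>l \<noteq> 0\<close>; for
    marked rows both sides vanish.\<close>
  case False
  then obtain h where h: "h \<le> L" "cond i h" "l = 8 * real h / \<Delta> i" "\<bar>dev x i\<bar> \<le> \<Delta> i / 2"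
    using inv unfolding row_inv_def by blast
  show ?thesis
  proof (rule row_drift[OF alive_bounds(1,2)[OF i h] am_nonneg row_bounds(3) alive_bounds(3)[OF i h]])
    have "(\<Sum>e\<in>ents i. 2 * (l * l) * (av e * del x (cl e))\<^sup>2 +
      128 * (l * l * l * l) * (av e * av e * x (cl e) * del x (cl e))\<^sup>2)
      \<le> (\<Sum>e\<in>ents i. (2 * (l * l) +
        128 * (l * l * l * l) * (am i * am i)) * ((av e * del x (cl e)) * (av e * del x (cl e))))"
    proof (rule sum_mono)
      fix e assume e: "e \<in> ents i"
      have b: "0 \<le> av e * x (cl e)" "av e * x (cl e) \<le> am i"
        using ents_lt[OF e] av[of e] x_bounds[of "cl e"] am_ge[OF e] mult_mono[of "av e" "am i"
          "x (cl e)" 1] am_nonneg by auto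
      have "(av e * x (cl e)) * (av e * x (cl e)) \<le> am i * am i" using b am_nonneg
        by (intro mult_mono) auto
      hence "((av e * x (cl e)) * (av e * x (cl e))) * ((av e * del x (cl e)) * (av e * del x (cl e)))
          \<le> (am i * am i) * ((av e * del x (cl e)) * (av e * del x (cl e)))"
            by (rule mult_right_mono) simp
      hence "(av e * av e * x (cl e) * del x (cl e))\<^sup>2
        \<le> (am i * am i) * ((av e * del x (cl e)) * (av e * del x (cl e)))"
        by (simp add: power2_eq_square ac_simps)
      hence "128 * (l * l * l * l) * (av e * av e * x (cl e) * del x (cl e))\<^sup>2 \<le>
          128 * (l * l * l * l) * ((am i * am i) * ((av e * del x (cl e)) * (av e * del x (cl e))))"
        by (intro mult_left_mono) (auto simp: mult.assoc[symmetric] mult_nonneg_nonneg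
          alive_bounds(1)[OF i h])
      thus "2 * (l * l) * (av e * del x (cl e))\<^sup>2 +
        128 * (l * l * l * l) * (av e * av e * x (cl e) * del x (cl e))\<^sup>2
        \<le> (2 * (l * l) + 128 * (l * l * l * l) * (am i * am i)) * ((av e * del x (cl e)) * (av e *
          del x (cl e)))"
        by (simp add: distrib_right power2_eq_square mult.assoc)
    qed
    thus "(\<Sum>e\<in>ents i. 2 * (l * l) * (av e * del x (cl e))\<^sup>2 +
      128 * (l * l * l * l) * (av e * av e * x (cl e) * del x (cl e))\<^sup>2)
      \<le> (2 * (l * l) + 128 * (l * l * l * l) * (am i * am i)) * rV x i"
      by (simp add: rV_def sum_distrib_left)
  qed
qed simp

text \<open>The exponents change by exactly \<open>q\<close> and \<open>q'\<close>, and
  \<open>1 + q + q * q \<ge> exp q\<close>, so the potentials stay above the exponentials. When the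
  row leaves its interval, this lower bound is exchanged for the weaker fact that
  \<open>U + D\<close> is at least 1, which needs no further care because \<open>l\<close> becomes
  0.\<close>

lemma row_step:
  assumes i: "i < m" and inv: "row_inv x i bad l U D"
    and x'_unit: "\<forall>j<n. x' j = x j + \<sigma> j * del x j \<and> 0 \<le> x' j \<and> x' j \<le> 1"
  defines "q \<equiv> l * rX x \<sigma> i - 8 * (l * l) * rY x \<sigma> i - 4 * (l * l) * rV x i"
    and "q' \<equiv> - (l * rX x \<sigma> i) - 8 * (l * l) * rY x \<sigma> i - 4 * (l * l) * rV x i"
    and "esc \<equiv> \<Delta> i / 2 < dev x' i \<or> dev x' i < - (\<Delta> i / 2)"
  shows "dev x' i = dev x i + rX x \<sigma> i"
    and "row_inv x' i (if esc then 1 else bad) (if esc then 0 else l) (U * (1 + q +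
      q * q)) (D * (1 + q' + q' * q'))"
proof -
  have x': "\<And>j. j < n \<Longrightarrow> x' j = x j + \<sigma> j * del x j" "\<And>j. j < n \<Longrightarrow> 0 \<le> x' j" "\<And>j. j < n \<Longrightarrow> x' j \<le> 1"
    using x'_unit by auto
  have x'c: "e \<in> ents i \<Longrightarrow> x' (cl e) = x (cl e) + \<sigma> (cl e) * del x (cl e)" for e
    using x'(1) ents_lt by blast
  show S': "dev x' i = dev x i + rX x \<sigma> i"
    unfolding dev_def rX_def sum.distrib[symmetric]
      by (rule sum.cong[OF refl]) (simp add: x'c algebra_simps)
  have \<sigma>2: "\<sigma> j * \<sigma> j = 1" for j using sgn[rule_format, of j] by auto
  \<comment> \<open>\<open>\<sigma> j * \<sigma> j = 1\<close> makes the quadratic part of the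
    change independent of the signs: it is the drift \<open>rV\<close>.\<close>
  have R': "dev2 x' i = dev2 x i + 2 * rY x \<sigma> i + rV x i"
    unfolding dev2_def rY_def rV_def sum_distrib_left sum.distrib[symmetric]
  proof (rule sum.cong[OF refl])
    fix e assume e: "e \<in> ents i"
    let ?c = "cl e"
    have "(x' ?c)\<^sup>2 = (x ?c)\<^sup>2 + 2 * (x ?c * del x ?c * \<sigma> ?c) + (\<sigma> ?c * \<sigma> ?c) * (del x ?c * del x ?c)"
      unfolding x'c[OF e] by (simp add: power2_eq_square algebra_simps)
    thus "av e * av e * ((x' ?c)\<^sup>2 - (p ?c)\<^sup>2) = av e * av e * ((x ?c)\<^sup>2 - (p ?c)\<^sup>2) +
       2 * (av e * av e * x ?c * del x ?c * \<sigma> ?c) + av e * del x ?c * (av e * del x ?c)"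
      unfolding \<sigma>2 by (simp add: algebra_simps)
  qed
  from inv consider (dead) "bad = 1" "l = 0" "0 \<le> U" "0 \<le> D" "1 \<le> U + D" |
    (alive) h where "bad = 0" "h \<le> L" "cond i h" "l = 8 * real h / \<Delta> i" "\<bar>dev x i\<bar> \<le> \<Delta> i / 2"
      "(1 / 2 ^ h) * exp (l * dev x i - 4 * (l * l) * dev2 x i) \<le> U"
      "(1 / 2 ^ h) * exp (- (l * dev x i) - 4 * (l * l) * dev2 x i) \<le> D" "1 \<le> h"
    unfolding row_inv_def by blast
  thus "row_inv x' i (if esc then 1 else bad) (if esc then 0 else l) (U * (1 + q +
    q * q)) (D * (1 + q' + q' * q'))"
  proof cases
    case dead
    \<comment> \<open>For \<open>l = 0\<close> both \<open>q\<close> and \<open>q'\<close> are 0, so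
      the potentials of a marked row do not move.\<close>
    thus ?thesis by (simp add: row_inv_def q_def q'_def)
  next
    case (alive h)
    note ab = alive_bounds[OF i alive(2-5)]
    have e1: "exp q \<le> 1 + q + q * q" using exp_le_quadratic[of q] ab(4)
      by (simp add: q_def power2_eq_square)
    have e2: "exp q' \<le> 1 + q' + q' * q'" using exp_le_quadratic[of q'] ab(5)
      by (simp add: q'_def power2_eq_square)
    have U0: "0 \<le> U" "0 \<le> D" using row_inv_nonneg[OF inv] by auto
    have U': "(1 / 2 ^ h) * exp (l * dev x' i - 4 * (l * l) * dev2 x' i) \<le> U * (1 + q + q * q)"
    proof -
      have "l * dev x' i - 4 * (l * l) * dev2 x' i = (l * dev x i - 4 * (l * l) * dev2 x i) + q"
        by (simp add: S' R' q_def algebra_simps)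
      hence "(1 / 2 ^ h) * exp (l * dev x' i - 4 * (l * l) * dev2 x' i) =
          ((1 / 2 ^ h) * exp (l * dev x i - 4 * (l * l) * dev2 x i)) * exp q" by (simp add: exp_add)
      also have "\<dots> \<le> U * (1 + q + q * q)" using alive(6) e1 U0 by (intro mult_mono) auto
      finally show ?thesis .
    qed
    have D': "(1 / 2 ^ h) * exp (- (l * dev x' i) - 4 * (l * l) * dev2 x' i) \<le> D * (1 + q' + q' * q')"
    proof -
      have "- (l * dev x' i) - 4 * (l * l) * dev2 x' i = (- (l * dev x i) - 4 * (l * l) * dev2 x i) + q'"
        by (simp add: S' R' q'_def algebra_simps)
      hence "(1 / 2 ^ h) * exp (- (l * dev x' i) - 4 * (l * l) * dev2 x' i) =
          ((1 / 2 ^ h) * exp (- (l * dev x i) - 4 * (l * l) * dev2 x i)) * exp q'" by (simp add: exp_add)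
      also have "\<dots> \<le> D * (1 + q' + q' * q')" using alive(7) e2 U0 by (intro mult_mono) auto
      finally show ?thesis .
    qed
    have nn: "0 \<le> U * (1 + q + q * q)" "0 \<le> D * (1 + q' + q' * q')"
      using order_trans[OF _ e1, of 0] order_trans[OF _ e2, of 0] U0 by auto
    show ?thesis
    proof (cases esc)
      case False
      thus ?thesis using alive U' D' unfolding row_inv_def esc_def by (auto simp: abs_le_iff)
    next
      case True
      \<comment> \<open>Dropping the squares of \<open>p\<close> and using
        \<open>av e \<le> am i\<close> and \<open>x' \<le> 1\<close> compares \<open>dev2\<close>
        with the current row sum.\<close>
      have Rle: "dev2 x' i \<le> am i * (mu i + dev x' i)"
      proof -
        have "dev2 x' i \<le> (\<Sum>e\<in>ents i. am i * (av e * x' (cl e)))"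
          unfolding dev2_def
        proof (rule sum_mono)
          fix e assume e: "e \<in> ents i"
          have b: "0 \<le> av e" "av e \<le> am i" "0 \<le> x' (cl e)" "x' (cl e) \<le> 1"
            using ents_lt[OF e] av am_ge[OF e] x' by auto
          have "(x' (cl e))\<^sup>2 - (p (cl e))\<^sup>2 \<le> x' (cl e)"
            using mult_left_mono[OF b(4,3)] zero_le_power2[of "p (cl e)"]
              unfolding power2_eq_square by linarith
          hence "av e * av e * ((x' (cl e))\<^sup>2 - (p (cl e))\<^sup>2) \<le> (av e * av e) * x' (cl e)"
            using b by (intro mult_left_mono) auto
          also have "\<dots> = av e * (av e * x' (cl e))" by simp
          also have "\<dots> \<le> am i * (av e * x' (cl e))" using b by (intro mult_right_mono) auto
          finally show "av e * av e * ((x' (cl e))\<^sup>2 - (p (cl e))\<^sup>2) \<le> am i * (av e * x' (cl e))" .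
        qed
        also have "\<dots> = am i * (mu i + dev x' i)"
          by (simp add: mu_def dev_def sum.distrib[symmetric] sum_distrib_left algebra_simps)
        finally show ?thesis .
      qed
      have c: "256 * real h * mu i * am i \<le> (\<Delta> i)\<^sup>2" "256 * real h * am i \<le> \<Delta> i" using alive
        by (auto simp: cond_def)
      have "1 \<le> U * (1 + q + q * q) + D * (1 + q' + q' * q')"
      proof (cases "\<Delta> i / 2 < dev x' i")
        case True
        have "1 \<le> (1 / 2 ^ h) * exp (l * dev x' i - 4 * (l * l) * dev2 x' i)"
          by (rule escape_potential[OF c \<Delta>[OF i] alive(4) am_nonneg _ Rle]) (use True in simp)
        thus ?thesis using U' nn by linarith
      next
        case False
        hence S: "\<Delta> i / 2 \<le> - dev x' i" using True by (auto simp: esc_def)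
        \<comment> \<open>The deviation is negative here, so replacing it by its absolute value only
          weakens the bound; the lower side then follows from the same lemma with
          \<open>S = - dev x' i\<close>.\<close>
        have "am i * (mu i + dev x' i) \<le> am i * (mu i + - dev x' i)"
          using am_nonneg S \<Delta>[OF i] by (intro mult_left_mono) auto
        hence "dev2 x' i \<le> am i * (mu i + - dev x' i)" using Rle by linarith
        from escape_potential[OF c \<Delta>[OF i] alive(4) am_nonneg S this]
        have "1 \<le> (1 / 2 ^ h) * exp (- (l * dev x' i) - 4 * (l * l) * dev2 x' i)" by simp
        thus ?thesis using D' nn by linarith
      qed
      thus ?thesis using True nn by (simp add: row_inv_def)
    qed
  qed
qed

end

text \<open>\<open>g\<close> is the accumulated inflation of the column potentials, \<open>F\<close>
  the bound on the total potential. The cells required to be 0 are those on which the merges and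
  reductions of the next step rely.\<close>

definition invariant :: "real \<Rightarrow> real \<Rightarrow> mem \<Rightarrow> bool" where
  "invariant g F s \<longleftrightarrow> env s \<and> tab s \<and> imem s 11 0 = 32 * (k + L) \<and>
    (\<forall>a\<ge>z. rmem s 9 a = 0) \<and> (\<forall>a\<ge>m. rmem s 21 a = 0) \<and> (\<forall>a\<ge>n. rmem s 22 a = 0) \<and>
    rmem s 6 0 = 0 \<and> rmem s 7 0 = 0 \<and> rmem s 8 0 = 0 \<and>
    (\<forall>e<z. rmem s 0 e = av e) \<and> (\<forall>i<m. rmem s 2 i = \<Delta> i) \<and>
    (\<forall>j<n. 0 \<le> rmem s 1 j \<and> rmem s 1 j \<le> 1 \<and> sqrt (rmem s 1 j * (1 - rmem s 1 j)) * g \<le> rmem s 3 j) \<and>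
    (\<forall>i<m. rmem s 15 i = dev (rmem s 1) i \<and>
      row_inv (rmem s 1) i (imem s 4 i) (rmem s 12 i) (rmem s 13 i) (rmem s 14 i)) \<and>
    (\<Sum>i<m. rmem s 13 i + rmem s 14 i) + (\<Sum>j<n. rmem s 3 j) \<le> F"

lemma run_step:
  assumes inv: "invariant g F s" and g: "0 \<le> g"
  shows "\<exists>t. run W N step (1700 + L * (1100 + 52 * L)) s t \<and>
    invariant (g * (1 + 1 / (12 * (Er * Er)))) F t"
proof -
  define x where "x = rmem s 1"
  define l where "l = rmem s 12"
  define U where "U = rmem s 13"
  define D where "D = rmem s 14"
  define H where "H = rmem s 3"
  have env: "env s" "tab s" "imem s 11 0 = 32 * (k + L)"
    and zero: "\<forall>a\<ge>z. rmem s 9 a = 0" "\<forall>a\<ge>m. rmem s 21 a = 0" "\<forall>a\<ge>n. rmem s 22 a = 0"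
      "rmem s 6 0 = 0" "rmem s 7 0 = 0" "rmem s 8 0 = 0"
    and data: "\<forall>e<z. rmem s 0 e = av e" "\<forall>i<m. rmem s 2 i = \<Delta> i"
    and xH: "\<forall>j<n. 0 \<le> x j \<and> x j \<le> 1 \<and> sqrt (x j * (1 - x j)) * g \<le> H j"
    and rows: "\<And>i. i < m \<Longrightarrow> rmem s 15 i = dev x i"
      "\<And>i. i < m \<Longrightarrow> row_inv x i (imem s 4 i) (l i) (U i) (D i)"
    and F: "(\<Sum>i<m. U i + D i) + (\<Sum>j<n. H j) \<le> F"
    using inv unfolding invariant_def x_def l_def U_def D_def H_def by blast+
  have x01: "\<forall>j<n. 0 \<le> x j \<and> x j \<le> 1" using xH by blast
  obtain s1 \<sigma> where s1: "run W N choose_signs (400 + L * (928 + 52 * L)) s s1"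
    "\<forall>a\<ge>z. rmem s1 9 a = 0" "rmem s1 6 0 = 0" "rmem s1 7 0 = 0" "rmem s1 8 0 = 0"
    "\<forall>j<n. rmem s1 4 j = del x j" "\<forall>j<n. rmem s1 5 j = \<sigma> j" and \<sigma>: "\<forall>j. \<sigma> j = 1 \<or> \<sigma> j = -1"
    and roots: "\<forall>i. rmem s1 6 (lead L i 0) = rX x \<sigma> i" "\<forall>i. rmem s1 7 (lead L i 0) = rY x \<sigma> i"
    "\<forall>i. rmem s1 8 (lead L i 0) = rV x i"
    and Q: "(\<Sum>i<m. (U i + D i) * (2 * (l i * l i) * (rX x \<sigma> i)\<^sup>2 +
      128 * (l i * l i * l i * l i) * (rY x \<sigma> i)\<^sup>2))
      \<le> (\<Sum>i<m. (U i + D i) * (\<Sum>e\<in>ents i. 2 * (l i * l i) * (av e * del x (cl e))\<^sup>2 +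
        128 * (l i * l i * l i * l i) * (av e * av e * x (cl e) * del x (cl e))\<^sup>2))"
    using run_choose_signs[OF env data(1) zero(1,4,5,6)]
    unfolding x_def[symmetric] l_def[symmetric] U_def[symmetric] D_def[symmetric] del_def[symmetric]
      rX_def[symmetric] rY_def[symmetric] rV_def[symmetric]
    by (elim exE conjE) (rule that; assumption)
  have r1: "y \<notin> {4, 5, 6, 7, 8, 9, 16, 17} \<Longrightarrow> rmem s1 y = rmem s y"
    "y \<notin> {6, 7, 8, 9} \<Longrightarrow> imem s1 y = imem s y" for y
    using run_rmem[OF s1(1)] run_imem[OF s1(1)] by auto
  have env1: "env s1" "tab s1" "imem s1 11 0 = 32 * (k + L)" using env by (auto simp: env_def tab_def r1)
  have same: "rmem s1 1 = x" "rmem s1 12 = l" "rmem s1 13 = U" "rmem s1 14 = D" "rmem s1 3 = H"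
    unfolding x_def l_def U_def D_def H_def by (rule r1(1); simp)+
  define X where "X = rX x \<sigma>"
  define Y where "Y = rY x \<sigma>"
  define V where "V = rV x"
  have roots': "rmem s1 6 (lead L i 0) = X i" "rmem s1 7 (lead L i 0) = Y i"
    "rmem s1 8 (lead L i 0) = V i" for i
    using roots by (simp_all add: X_def Y_def V_def)
  define fR where "fR i = (1 - 2 * (4 * (l i * l i) * V i)) * (U i * (l i * X i - 8 * (l i * l i) *
    Y i) + D i * (- (l i * X i) - 8 * (l i * l i) * Y i))" for i
  define fC where "fC j = H j * ((1 - 2 * x j) / Er * (1 / 2 +
    x j * (1 - x j) / (Er * Er) / 6) * (1 + 1 / (12 * (Er * Er))))" for j
  have zero1: "\<forall>a\<ge>m. rmem s1 21 a = 0" "\<forall>a\<ge>n. rmem s1 22 a = 0" using zero by (auto simp: r1)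
  obtain s2 r where s2: "run W N orient (400 + 104 * L) s1 s2" "r = 1 \<or> r = -1"
    "\<forall>a\<ge>m. rmem s2 21 a = 0" "\<forall>a\<ge>n. rmem s2 22 a = 0"
    "\<forall>i<m. rmem s2 18 i = r * X i \<and> rmem s2 19 i = r * Y i \<and> rmem s2 20 i = V i"
    "\<forall>j<n. rmem s2 5 j = r * rmem s1 5 j"
    and O: "r * ((\<Sum>i<m. fR i) + (\<Sum>j<n. rmem s1 5 j * fC j)) \<le> 0"
    using run_orient[OF env1 zero1]
    unfolding same roots' fR_def[symmetric] fC_def[symmetric]
    by (elim exE conjE) (rule that; assumption)
  have r2: "y \<notin> {5, 18, 19, 20, 21, 22} \<Longrightarrow> rmem s2 y = rmem s1 y"
    "y \<notin> {8, 9} \<Longrightarrow> imem s2 y = imem s1 y" for y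
    using run_rmem[OF s2(1)] run_imem[OF s2(1)] by auto
  have env2: "env s2" "tab s2" "imem s2 11 0 = 32 * (k + L)" using env1
    by (auto simp: env_def tab_def r2)
  have same2: "rmem s2 1 = x" "rmem s2 12 = l" "rmem s2 13 = U" "rmem s2 14 = D" "rmem s2 3 = H"
    unfolding same[symmetric] by (rule r2(1); simp)+
  \<comment> \<open>The signs used for the move: those found digit by digit, times the global
    sign.\<close>
  define \<tau> where "\<tau> j = r * \<sigma> j" for j
  have \<tau>: "\<forall>j. \<tau> j = 1 \<or> \<tau> j = -1"
  proof
    fix j show "\<tau> j = 1 \<or> \<tau> j = -1" using s2(2) \<sigma>[rule_format, of j] by (auto simp: \<tau>_def)
  qed
  have X': "rX x \<tau> i = r * X i" "rY x \<tau> i = r * Y i" for i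
    by (simp_all add: rX_def rY_def X_def Y_def \<tau>_def sum_distrib_left ac_simps)
  define q where "q i = l i * rX x \<tau> i - 8 * (l i * l i) * rY x \<tau> i - 4 * (l i * l i) * rV x i" for i
  define q' where "q' i = - (l i * rX x \<tau> i) - 8 * (l i * l i) * rY x \<tau> i - 4 * (l i * l i) * rV x
    i" for i
  define y where "y j = \<tau> j * ((1 - 2 * x j) / Er) - x j * (1 - x j) / (Er * Er)" for j
  have in2: "i < m \<Longrightarrow> rmem s2 18 i = rX x \<tau> i" "i < m \<Longrightarrow> rmem s2 19 i = rY x \<tau> i"
    "i < m \<Longrightarrow> rmem s2 20 i = rV x i"
    "i < m \<Longrightarrow> rmem s2 15 i = dev x i" "i < m \<Longrightarrow> rmem s2 2 i = \<Delta> i" "j < n \<Longrightarrow> rmem s2 5 j = \<tau> j"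
      "j < n \<Longrightarrow> rmem s2 4 j = del x j" for i j
    using s2(5,6) s1(6,7) rows(1)[of i] data(2) by (auto simp: X' V_def \<tau>_def r2 r1)
  obtain t where t: "run W N move 600 s2 t"
    and rows3: "\<forall>i<m. rmem t 13 i = U i * (1 + q i + q i * q i) \<and>
      rmem t 14 i = D i * (1 + q' i + q' i * q' i) \<and>
       rmem t 15 i = dev x i + rX x \<tau> i \<and>
       imem t 4 i = (if \<Delta> i / 2 < dev x i + rX x \<tau> i \<or> dev x i +
         rX x \<tau> i < - (\<Delta> i / 2) then 1 else imem s 4 i) \<and>
       rmem t 12 i = (if \<Delta> i / 2 < dev x i + rX x \<tau> i \<or> dev x i +
         rX x \<tau> i < - (\<Delta> i / 2) then 0 else l i)"
    and cols3: "\<forall>j<n. rmem t 3 j = H j * ((1 + y j / 2 - y j * y j / 12) * (1 + 1 / (12 * (Er * Er)))) \<and>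
       rmem t 1 j = x j + \<tau> j * del x j"
    using run_move[OF env2(1,3)] in2
    unfolding same2 q_def q'_def y_def by (auto simp: r2 r1)
  have r3: "y \<notin> {1, 3, 12, 13, 14, 15} \<Longrightarrow> rmem t y = rmem s2 y" "y \<noteq> 4 \<Longrightarrow> imem t y = imem s2 y" for y
    using run_rmem[OF t(1)] run_imem[OF t(1)] by auto
  have run: "run W N step (1700 + L * (1100 + 52 * L)) s t"
    unfolding step_def by (rule run_Seq[OF s1(1) run_Seq[OF s2(1) t(1) order_refl]
      ]) (simp add: algebra_simps)
  define \<gamma> where "\<gamma> = 1 / (12 * (Er * Er))"
  have E4: "4 \<le> Er" using Er_ge by simp
  have col: "0 \<le> rmem t 1 j \<and> rmem t 1 j \<le> 1 \<and>
    sqrt (rmem t 1 j * (1 - rmem t 1 j)) * (g * (1 + \<gamma>)) \<le> rmem t 3 j \<and>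
      rmem t 3 j \<le> H j + \<tau> j * fC j" if j: "j < n" for j
  proof -
    have a: "0 \<le> x j" "x j \<le> 1" "sqrt (x j * (1 - x j)) * g \<le> H j" using xH j by auto
    note c = column_step[OF a(1,2) E4 \<tau>[rule_format, of j] a(3) g]
    show ?thesis using c cols3 j unfolding del_def y_def fC_def \<gamma>_def by simp
  qed
  have x'_unit: "\<forall>j<n. rmem t 1 j = x j + \<tau> j * del x j \<and> 0 \<le> rmem t 1 j \<and> rmem t 1 j \<le> 1"
    using col cols3 by simp
  have row: "rmem t 15 i = dev (rmem t 1) i \<and>
    row_inv (rmem t 1) i (imem t 4 i) (rmem t 12 i) (rmem t 13 i) (rmem t 14 i)"
    if i: "i < m" for i
    using row_step[OF x01 \<tau> i rows(2)[OF i] x'_unit] rows3 i unfolding q_def q'_def by simp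
  \<comment> \<open>For a single row the difference of the two second-order terms may be positive;
    only its sum over all rows is controlled, by \<open>Q\<close>. The subtracted term is what
    remains of the drift \<open>v\<close> after it has paid for \<open>v * v\<close>.\<close>
  have rowF: "rmem t 13 i + rmem t 14 i
    \<le> (U i + D i) + (U i + D i) * (2 * (l i * l i) * (X i)\<^sup>2 + 128 * (l i * l i * l i * l i) * (Y i)\<^sup>2)
      - (U i + D i) * (\<Sum>e\<in>ents i. 2 * (l i * l i) * (av e * del x (cl e))\<^sup>2 +
        128 * (l i * l i * l i * l i) * (av e * av e * x (cl e) * del x (cl e))\<^sup>2) +
          r * fR i" if i: "i < m" for i
  proof -
    define Z where "Z = (\<Sum>e\<in>ents i. 2 * (l i * l i) * (av e * del x (cl e))\<^sup>2 +
        128 * (l i * l i * l i * l i) * (av e * av e * x (cl e) * del x (cl e))\<^sup>2)"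
    define v where "v = 4 * (l i * l i) * V i"
    have U0: "0 \<le> U i" "0 \<le> D i" using row_inv_nonneg[OF rows(2)[OF i]] by auto
    have qe: "q i = r * (l i * X i - 8 * (l i * l i) * Y i) - v"
      "q' i = r * (- (l i * X i) - 8 * (l i * l i) * Y i) - v"
      by (simp_all add: q_def q'_def X' V_def v_def algebra_simps)
    have "rmem t 13 i + rmem t 14 i = U i * (1 + q i + q i * q i) + D i * (1 + q' i + q' i * q' i)"
      using rows3 i by simp
    also have "\<dots> \<le> (U i + D i) * (1 - v + v * v) + (U i + D i) * (2 * (l i * l i) * (X i)\<^sup>2 +
      128 * (l i * l i * l i * l i) * (Y i)\<^sup>2) + r * fR i"
      unfolding qe fR_def v_def by (rule row_average[OF U0 s2(2)])
    also have "(U i + D i) * (1 - v + v * v) \<le> (U i + D i) * (1 - Z)"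
      using row_second_order[OF x01 \<tau> i rows(2)[OF i]] U0 unfolding Z_def v_def V_def
      by (intro mult_left_mono) auto
    also have "(U i + D i) * (1 - Z) = (U i + D i) - (U i + D i) * Z" by (simp add: algebra_simps)
    finally show ?thesis unfolding Z_def by simp
  qed
  have "(\<Sum>i<m. rmem t 13 i + rmem t 14 i) + (\<Sum>j<n. rmem t 3 j) \<le>
     (\<Sum>i<m. (U i + D i) + (U i + D i) * (2 * (l i * l i) * (X i)\<^sup>2 +
       128 * (l i * l i * l i * l i) * (Y i)\<^sup>2)
      - (U i + D i) * (\<Sum>e\<in>ents i. 2 * (l i * l i) * (av e * del x (cl e))\<^sup>2 +
        128 * (l i * l i * l i * l i) * (av e * av e * x (cl e) * del x (cl e))\<^sup>2) + r * fR i) +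
          (\<Sum>j<n. H j + \<tau> j * fC j)"
    by (rule add_mono; rule sum_mono) (use rowF col in auto)
  \<comment> \<open>Here \<open>Q\<close> cancels the second-order terms. What is left besides the
    old total is linear in the signs and is nonpositive by \<open>O\<close>.\<close>
  also have "\<dots> \<le> (\<Sum>i<m. U i + D i) + (\<Sum>i<m. r * fR i) + ((\<Sum>j<n. H j) + (\<Sum>j<n. \<tau> j * fC j))"
    using Q unfolding X_def Y_def sum.distrib sum_subtractf by linarith
  also have "\<dots> = ((\<Sum>i<m. U i + D i) + (\<Sum>j<n. H j)) + r * ((\<Sum>i<m. fR i) + (\<Sum>j<n. rmem s1 5 j * fC j))"
  proof -
    have "(\<Sum>j<n. \<tau> j * fC j) = r * (\<Sum>j<n. rmem s1 5 j * fC j)"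
      unfolding sum_distrib_left by (rule sum.cong) (use s1(7) in \<open>auto simp: \<tau>_def\<close>)
    thus ?thesis by (simp add: sum_distrib_left[symmetric] distrib_left)
  qed
  also have "\<dots> \<le> F" using O F by linarith
  finally have F': "(\<Sum>i<m. rmem t 13 i + rmem t 14 i) + (\<Sum>j<n. rmem t 3 j) \<le> F" .
  have "invariant (g * (1 + \<gamma>)) F t" unfolding invariant_def
  proof (intro conjI)
    show "env t" "tab t" using env2 by (auto simp: env_def tab_def r3)
    show "\<forall>j<n. 0 \<le> rmem t 1 j \<and> rmem t 1 j \<le> 1 \<and>
      sqrt (rmem t 1 j * (1 - rmem t 1 j)) * (g * (1 + \<gamma>)) \<le> rmem t 3 j"
      using col by blast
    show "\<forall>i<m. rmem t 15 i = dev (rmem t 1) i \<and>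
      row_inv (rmem t 1) i (imem t 4 i) (rmem t 12 i) (rmem t 13 i) (rmem t 14 i)"
      using row by blast
  qed (use F' env2 s1 s2 data in \<open>auto simp: r1 r2 r3\<close>)
  thus ?thesis using run unfolding \<gamma>_def by blast
qed

end

section \<open>The algorithm\<close>

definition sizeE :: iexp where "sizeE = IMul (IMul (IConst 64) nn) mm"

definition find_log :: com where
  "find_log = Seq (setI 6 (IConst 1)) (While (ILess (sc 6) sizeE)
     (Seq (setI 6 (IMul (IConst 2) (sc 6))) (setI 5 (IAdd (sc 5) (IConst 1)))))"

definition row_stats :: com where
  "row_stats = Seq (parR1 zz TT 6 (RMul rA (RLoad 1 COL))) (Seq (parR1 zz TT 7 rA)
     (Seq (for_loop 5 7 6 (Seq (merge 6) (merge_max 7)))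
     (Seq (parR mm TT 10 (RLoad 6 rootE)) (parR mm TT 11 (RLoad 7 rootE)))))"

abbreviation rt :: rexp where "rt \<equiv> RMul (RN 256) (ROfNat (IAdd (sc 7) (IConst 1)))"

definition condG :: bexp where
  "condG = BAnd (eqE (ILoad 14 Pid) (sc 7))
    (BAnd (BNot (RLess (RMul (RLoad 2 Pid) (RLoad 2 Pid)) (RMul (RMul rt (RLoad 10 Pid)) (RLoad 11
      Pid))))
    (BAnd (BNot (RLess (RLoad 2 Pid) (RMul rt (RLoad 11 Pid))))
      (BNot (RLess (RMul (RLoad 2 Pid) (ROfNat kk)) (RMul rt (RLoad 10 Pid))))))"

text \<open>A row takes part in round \<open>b\<close> only if it has passed all earlier rounds, so
  array 14 ends at the first \<open>h\<close> whose successor violates \<open>cond\<close>, or at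
  \<open>L\<close>. A row with \<open>h = 0\<close> is marked at once; its \<open>prob_bad\<close>
  with constant 1024 is at least 4 anyway. The column potentials add up to
  \<open>1 / 4\<close>.\<close>

definition weights :: com where
  "weights = Seq (parR mm TT 13 (RN 1))
    (Seq (for_loop 5 7 6 (Seq (parR mm condG 13 (RDiv (RN 1) (RMul (RN 2) (ROfNat (sc 6)))))
       (parI mm condG 14 (IAdd (sc 7) (IConst 1)))))
    (Seq (parR mm TT 14 (RLoad 13 Pid))
    (Seq (parR mm TT 12 (RDiv (RMul (RN 8) (ROfNat (ILoad 14 Pid))) (RLoad 2 Pid)))
    (Seq (parI mm (eqE (ILoad 14 Pid) (IConst 0)) 4 (IConst 1))
      (parR nn TT 3 (RDiv (RN 1) (RMul (RN 4) (ROfNat nn))))))))"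

definition rounding_loop :: com where
  "rounding_loop = While (ILess (sc 10) (sc 12)) (Seq step (setI 10 (IAdd (sc 10) (IConst 1))))"

definition round_com :: com where
  "round_com = parI nn (RLess (RDiv (RN 1) (RN 2)) rx) 3 (IConst 1)"

definition main_com :: com where
  "main_com = Seq find_log
    (Seq (setI 11 (IMul (IConst 32) (IAdd kk (sc 5))))
    (Seq (setI 12 (IMul (IMul (IMul (IConst 12) (sc 11)) (sc 11)) (sc 5)))
    (Seq tab_init (Seq row_stats (Seq weights (Seq rounding_loop round_com))))))"

lemma setup_mods [simp]:
  "imods find_log = {5, 6}" "rmods find_log = {}"
  "imods row_stats = {6, 7}" "rmods row_stats = {6, 7, 10, 11}"
  "imods weights = {4, 6, 7, 14}" "rmods weights = {3, 12, 13, 14}"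
  "imods rounding_loop = {4, 6, 7, 8, 9, 10}"
  by (auto simp: find_log_def row_stats_def weights_def rounding_loop_def)

context rounding
begin

definition data :: "mem \<Rightarrow> bool" where
  "data s \<longleftrightarrow> imem s 0 0 = n \<and> imem s 0 (Suc 0) = m \<and> imem s 0 2 = k \<and> imem s 0 3 = z \<and>
     (\<forall>e<z. imem s (Suc 0) e = rw e) \<and> (\<forall>e<z. imem s 2 e = cl e)"

lemma run_find_log:
  assumes d: "data s" and z5: "imem s 5 = (\<lambda>_. 0)" and least: "\<And>i. i < L \<Longrightarrow> 2 ^ i < 64 * n * m"
  shows "\<exists>t. run W N find_log (20 + L * 40) s t \<and> env t"
proof -
  obtain s1 where s1: "run W N (setI 6 (IConst 1)) 8 s s1"
      "imem s1 = (imem s)(6 := (imem s 6)(0 := 1))" "rmem s1 = rmem s"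
    using run_setI[OF N(1), of W s "IConst 1" 8 6] W_512 by auto
  define J where "J i s \<longleftrightarrow> data s \<and> imem s 6 0 = 2 ^ i \<and> imem s 5 0 = i" for i and s :: mem
  have sz: "ifits W s 0 sizeE" "ival s 0 sizeE = 64 * n * m" if "data s" for s
  proof -
    have "64 * n \<le> 64 * n * m" using mpos by simp
    hence "64 * n \<le> W" "64 * n * m \<le> W" using L W_small(4) by linarith+
    thus "ifits W s 0 sizeE" "ival s 0 sizeE = 64 * n * m"
      using that W_small W_512 by (auto simp: sizeE_def data_def)
  qed
  have "\<exists>t. run W N (While (ILess (sc 6) sizeE)
     (Seq (setI 6 (IMul (IConst 2) (sc 6))) (setI 5 (IAdd (sc 5) (IConst 1))))) (L * 33 +
       11) s1 t \<and> J L t"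
  proof (rule run_While_count[OF N(1)])
    fix i and s :: mem
    assume i: "i < L" and J: "J i s"
    have pw: "2 * 2 ^ i \<le> W" "2 ^ i \<le> W" using two_pow_W i by auto
    obtain t1 where t1: "run W N (setI 6 (IMul (IConst 2) (sc 6))) 11 s t1"
      "imem t1 = (imem s)(6 := (imem s 6)(0 := ival s 0 (IMul (IConst 2) (sc 6))))" "rmem t1 = rmem s"
      using run_setI[OF N(1), of W s "IMul (IConst 2) (sc 6)" 11 6] J pw W_512 by (auto simp: J_def)
    obtain t2 where t2: "run W N (setI 5 (IAdd (sc 5) (IConst 1))) 11 t1 t2"
      "imem t2 = (imem t1)(5 := (imem t1 5)(0 := ival t1 0 (IAdd (sc 5) (IConst 1))))"
        "rmem t2 = rmem t1"
      using run_setI[OF N(1), of W t1 "IAdd (sc 5) (IConst 1)" 11 5] J i W_small W_512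
        by (auto simp: J_def t1)
    have "run W N (Seq (setI 6 (IMul (IConst 2) (sc 6))) (setI 5 (IAdd (sc 5) (IConst 1)))) 22 s t2"
      by (rule run_Seq[OF t1(1) t2(1)]) simp
    moreover have "J (Suc i) t2" using J by (auto simp: J_def data_def t1 t2)
    moreover have "bfits W s 0 (ILess (sc 6) sizeE) \<and> bval s 0 (ILess (sc 6) sizeE)"
      using J sz[of s] pw least[OF i] W_512 by (simp add: J_def)
    ultimately show "bfits W s 0 (ILess (sc 6) sizeE) \<and> bval s 0 (ILess (sc 6) sizeE) \<and>
      (\<exists>t. run W N (Seq (setI 6 (IMul (IConst 2) (sc 6))) (setI 5 (IAdd (sc 5) (IConst 1)))) 22 s t
        \<and> J (Suc i) t)"
      by blast
  next
    fix s :: mem assume "J L s"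
    thus "bfits W s 0 (ILess (sc 6) sizeE) \<and> \<not> bval s 0 (ILess (sc 6) sizeE)"
      using sz[of s] L W_small W_512 by (auto simp: J_def)
  next
    show "J 0 s1" using d z5 by (auto simp: J_def data_def s1)
  qed (simp add: sizeE_def)
  then obtain t where t: "run W N (While (ILess (sc 6) sizeE)
     (Seq (setI 6 (IMul (IConst 2) (sc 6))) (setI 5 (IAdd (sc 5) (IConst 1))))) (L * 33 +
       11) s1 t" "J L t"
    by blast
  have "run W N find_log (20 + L * 40) s t" unfolding find_log_def by (rule run_Seq[OF s1(1) t(1)]) simp
  moreover have "env t" using t(2) by (simp add: J_def data_def env_def)
  ultimately show ?thesis by blast
qed

lemma run_row_stats:
  assumes env: "env s" "tab s" and A: "\<forall>e<z. rmem s 0 e = av e" and P: "\<forall>j<n. rmem s 1 j = p j"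
    and zero: "rmem s 6 0 = 0" "rmem s 7 0 = 0"
  shows "\<exists>t. run W N row_stats (200 + L * 428) s t \<and> rmem t 6 0 = 0 \<and> rmem t 7 0 = 0 \<and>
    (\<forall>i<m. rmem t 10 i = mu i \<and> rmem t 11 i = am i)"
proof -
  have cW: "e < z \<Longrightarrow> imem s 2 e = cl e \<and> cl e \<le> W \<and> cl e < n" for e
    using env cl[of e] W_small by (auto simp: env_def)
  note fits = Pid_fits const_fits
  obtain s1 where s1: "run W N (parR1 zz TT 6 (RMul rA (RLoad 1 COL))) 30 s s1" "imem s1 = imem s"
    "rmem s1 = (rmem s)(6 := (\<lambda>a. if 0 < a \<and>
      a - 1 < z then av (a - 1) * p (cl (a - 1)) else rmem s 6 a))"
    using run_zz1[OF env(1), of "RMul rA (RLoad 1 COL)" "\<lambda>e. av e * p (cl e)" 30 6] fits cW A P by auto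
  have env1: "env s1" using env by (auto simp: env_def s1)
  obtain s2 where s2: "run W N (parR1 zz TT 7 rA) 30 s1 s2" "imem s2 = imem s1"
    "rmem s2 = (rmem s1)(7 := (\<lambda>a. if 0 < a \<and> a - 1 < z then av (a - 1) else rmem s1 7 a))"
    using run_zz1[OF env1, of rA av 30 7] fits A by (auto simp: s1)
  have env2: "env s2" "tab s2" using env by (auto simp: env_def tab_def s1 s2)
  \<comment> \<open>The entries are nonnegative, so inserting 0 does not change the maximum at a
    leaf, and cell 0 can again stand for the empty class.\<close>
  define g where "g M = Max (insert 0 (av ` M))" for M :: "nat set"
  define J where "J b s \<longleftrightarrow> env s \<and> tab s \<and>
    (\<forall>i c. rmem s 6 (lead b i c) = (\<Sum>e\<in>cls b i c. av e * p (cl e))) \<and>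
    (\<forall>i c. rmem s 7 (lead b i c) = g (cls b i c))" for b s
  have "\<exists>t. run W N (for_loop 5 7 6 (Seq (merge 6) (merge_max 7))) (22 + L * (400 + 28)) s2 t \<and> J L t"
  proof (rule run_for[OF N(1) W_pow])
    show "J 0 s2" unfolding J_def
    proof (intro conjI allI env2)
      fix i c
      have "(cls 0 i c = {} \<and> lead 0 i c = 0) \<or> (\<exists>e<z. cls 0 i c = {e} \<and> lead 0 i c = Suc e)"
      proof (cases "cls 0 i c = {}")
        case False
        then obtain e where "e \<in> cls 0 i c" by blast
        hence "e < z" "cls 0 i c = {e}" using cls_0 by (auto simp: cls_def)
        thus ?thesis by simp
      qed simp
      thus "rmem s2 6 (lead 0 i c) = (\<Sum>e\<in>cls 0 i c. av e * p (cl e))"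
        "rmem s2 7 (lead 0 i c) = g (cls 0 i c)"
        using zero av by (auto simp: s1 s2 g_def)
    qed
    show "imem s2 5 0 = L" using env2 by (simp add: env_def)
  next
    fix i and s s' :: mem
    assume "J i s" "\<And>x. x \<noteq> 7 \<Longrightarrow> x \<noteq> 6 \<Longrightarrow> imem s' x = imem s x" "rmem s' = rmem s"
    thus "J i s'" by (auto simp: J_def env_def tab_def)
  next
    fix b and s :: mem
    assume b: "b < L" and J: "J b s" and s: "imem s 7 0 = b" "imem s 6 0 = 2 ^ b"
    have bL: "b \<le> L" using b by simp
    have env: "env s" "tab s" using J by (auto simp: J_def)
    have lev: "level s b" using env s by (simp add: level_def)
    have V6: "\<And>i c. rmem s 6 (lead b i c) = (\<Sum>e\<in>cls b i c. av e * p (cl e))"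
      and V7: "\<And>i c. rmem s 7 (lead b i c) = g (cls b i c)" using J by (auto simp: J_def)
    from run_merge_sum[of s b 6 "\<lambda>e. av e * p (cl e)", OF lev bL env(2) V6]
    obtain t1 where t1: "run W N (merge 6) 200 s t1" "imem t1 = imem s"
      "\<forall>y. y \<noteq> 6 \<longrightarrow> rmem t1 y = rmem s y"
      "\<forall>i c. rmem t1 6 (lead (Suc b) i c) = (\<Sum>e\<in>cls (Suc b) i c. av e * p (cl e))" by blast
    have lev1: "level t1 b" "tab t1" using lev env by (auto simp: level_def env_def tab_def t1)
    obtain t where t: "run W N (merge_max 7) 200 t1 t" "imem t = imem t1"
      "rmem t = (rmem t1)(7 := (\<lambda>a. if 0 < a \<and> a - 1 < z \<and> left_leader b (a - 1) \<and>
        rmem t1 7 (Suc (a - 1)) < rmem t1 7 (sib b (a - 1))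
      then rmem t1 7 (sib b (a - 1)) else rmem t1 7 a))"
      using run_merge_max[OF lev1(1) bL lev1(2), of 7] by blast
    have "rmem t 7 (lead (Suc b) i c) = g (cls (Suc b) i c)" for i c
    proof (rule merge_step[where V = "rmem s 7" and f = max, OF V7])
      fix i c
      show "g (cls b i (2 * c) \<union> cls b i (2 * c + 1))
        = max (g (cls b i (2 * c))) (g (cls b i (2 * c + 1)))"
      proof -
        have "insert 0 (av ` (cls b i (2 * c) \<union> cls b i (2 * c + 1))) =
          insert 0 (av ` cls b i (2 * c)) \<union> insert 0 (av ` cls b i (2 * c + 1))" by auto
        thus ?thesis unfolding g_def by (simp only:) (rule Max_Un, auto)
      qed
    qed (use t1(3) in \<open>auto simp: t\<close>)
    hence "J (Suc b) t" using env t1(4) unfolding J_def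
      by (auto simp: t t1 env_def tab_def simp del: lead.simps)
    moreover have "run W N (Seq (merge 6) (merge_max 7)) 400 s t" by (rule run_Seq[OF t1(1) t(1)]) simp
    ultimately show "\<exists>t. run W N (Seq (merge 6) (merge_max 7)) 400 s t \<and> J (Suc b) t" by blast
  qed auto
  then obtain s3 where s3: "run W N (for_loop 5 7 6 (Seq (merge 6) (merge_max 7))) (22 + L * (400 +
    28)) s2 s3" "J L s3" by blast
  have env3: "env s3" "tab s3" using s3(2) by (auto simp: J_def)
  have out: "lead L 0 n = 0" "cls L 0 n = {}" using lead_out[of n L 0] cls_out[of n L 0] by auto
  have "rmem s3 6 (lead L 0 n) = (\<Sum>e\<in>cls L 0 n. av e * p (cl e))"
    "rmem s3 7 (lead L 0 n) = g (cls L 0 n)"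
    using s3(2) unfolding J_def by blast+
  hence z3: "rmem s3 6 0 = 0" "rmem s3 7 0 = 0" by (simp_all add: out g_def)
  have "rmem s3 6 (lead L i 0) = (\<Sum>e\<in>cls L i 0. av e * p (cl e))"
    "rmem s3 7 (lead L i 0) = g (cls L i 0)" for i
    using s3(2) unfolding J_def by blast+
  hence v3: "rmem s3 6 (lead L i 0) = mu i" "rmem s3 7 (lead L i 0) = am i" for i
    by (simp_all add: cls_root_ents mu_def am_def g_def)
  obtain s4 where s4: "run W N (parR mm TT 10 (RLoad 6 rootE)) 30 s3 s4" "imem s4 = imem s3"
    "rmem s4 = (rmem s3)(10 := (\<lambda>a. if a < m then mu a else rmem s3 10 a))"
    using run_mm[OF env3(1), of "RLoad 6 rootE" mu 30 10] rootE_eval[OF env3] v3 by auto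
  have env4: "env s4" "tab s4" using env3 by (auto simp: env_def tab_def s4)
  obtain t where t: "run W N (parR mm TT 11 (RLoad 7 rootE)) 30 s4 t" "imem t = imem s4"
    "rmem t = (rmem s4)(11 := (\<lambda>a. if a < m then am a else rmem s4 11 a))"
    using run_mm[OF env4(1), of "RLoad 7 rootE" am 30 11] rootE_eval[OF env4] v3 by (auto simp: s4)
  have "run W N row_stats (200 + L * 428) s t" unfolding row_stats_def
    by (rule run_Seq[OF s1(1) run_Seq[OF s2(1) run_Seq[OF s3(1) run_Seq[OF s4(1) t(1) order_refl]
      order_refl] order_refl]]) simp
  thus ?thesis using z3 by (intro exI[of _ t]) (simp add: t s4)
qed

lemma cond_0: "i < m \<Longrightarrow> cond i 0"
  using \<Delta>[of i] by (simp add: cond_def)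

lemma run_weights:
  assumes env: "env s" "tab s" and M: "\<forall>i<m. rmem s 10 i = mu i \<and>
    rmem s 11 i = am i" and D: "\<forall>i<m. rmem s 2 i = \<Delta> i"
    and zero: "imem s 14 = (\<lambda>_. 0)" "imem s 4 = (\<lambda>_. 0)"
  shows "\<exists>t h. run W N weights (400 + L * 428) s t \<and>
    (\<forall>i<m. h i \<le> L \<and> cond i (h i) \<and> (h i < L \<longrightarrow> \<not> cond i (Suc (h i))) \<and> rmem t 13 i = 1 / 2 ^ h i \<and>
      rmem t 14 i = 1 / 2 ^ h i \<and>
      rmem t 12 i = 8 * real (h i) / \<Delta> i \<and> imem t 4 i = (if h i = 0 then 1 else 0)) \<and>
    (\<forall>j<n. rmem t 3 j = 1 / (4 * real n))"
proof -
  note fits = Pid_fits const_fits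
  obtain s1 where s1: "run W N (parR mm TT 13 (RN 1)) 20 s s1" "imem s1 = imem s"
    "rmem s1 = (rmem s)(13 := (\<lambda>a. if a < m then 1 else rmem s 13 a))"
    using run_mm[OF env(1), of "RN 1" "\<lambda>_. 1" 20 13] fits by auto
  define K where "K b s \<longleftrightarrow> env s \<and> (\<forall>i<m. rmem s 10 i = mu i \<and> rmem s 11 i = am i \<and>
    rmem s 2 i = \<Delta> i) \<and> imem s 4 = (\<lambda>_. 0) \<and>
    (\<forall>i<m. imem s 14 i \<le> b \<and> cond i (imem s 14 i) \<and> (imem s 14 i < b \<longrightarrow> \<not> cond i (Suc (imem s 14 i))) \<and>
       rmem s 13 i = 1 / 2 ^ imem s 14 i)" for b and s :: mem
  let ?r = "RDiv (RN 1) (RMul (RN 2) (ROfNat (sc 6)))"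
  have cG: "bcost condG \<le> 100" by (simp add: condG_def eqE_def)
  have "\<exists>t. run W N (for_loop 5 7 6 (Seq (parR mm condG 13 ?r) (parI mm condG 14 (IAdd (sc 7)
    (IConst 1))))) (22 + L * (400 + 28)) s1 t \<and> K L t"
  proof (rule run_for[OF N(1) W_pow])
    show "K 0 s1" using env M D zero cond_0 by (auto simp: K_def env_def s1)
    show "imem s1 5 0 = L" using env by (simp add: env_def s1)
  next
    fix i and s s' :: mem
    assume "K i s" "\<And>x. x \<noteq> 7 \<Longrightarrow> x \<noteq> 6 \<Longrightarrow> imem s' x = imem s x" "rmem s' = rmem s"
    thus "K i s'" by (auto simp: K_def env_def)
  next
    fix b and s :: mem
    assume b: "b < L" and K: "K b s" and s: "imem s 7 0 = b" "imem s 6 0 = 2 ^ b"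
    have env: "env s" using K by (auto simp: K_def)
    define G where "G i \<longleftrightarrow> imem s 14 i = b \<and> cond i (Suc b)" for i
    have pw: "2 ^ b \<le> W" using two_pow_W b by simp
    have hb: "i < m \<Longrightarrow> imem s 14 i \<le> W" for i using K b W_small by (fastforce simp: K_def)
    have Gv: "bfits W s' i condG \<and> bval s' i condG = G i"
      if "i < m" "imem s' = imem s" "\<And>x. x \<noteq> 13 \<Longrightarrow> rmem s' x = rmem s x" for s' i
    proof
      have kW: "imem s 0 2 \<le> W" using env W_small by (simp add: env_def)
      show "bfits W s' i condG" using that s b kW hb W_small W_512 by (auto simp: condG_def eqE_fits)
      have "rmem s 10 i = mu i" "rmem s 11 i = am i" "rmem s 2 i = \<Delta> i" "imem s 0 2 = k"
        using K that(1) env by (auto simp: K_def env_def)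
      thus "bval s' i condG = G i" using that s unfolding condG_def G_def cond_def
        by (auto simp: eqE_val power2_eq_square not_less)
    qed
    have "\<exists>t. run W N (parR mm condG 13 ?r) 150 s t \<and> imem t = imem s \<and>
      rmem t = (rmem s)(13 := (\<lambda>i. if i < m \<and> G i then (\<lambda>_. 1 / 2 ^ Suc b) i else rmem s 13 i))"
      by (rule run_parR[OF N(1) less_imp_le[OF W_small(2)] mm_eval(1)[OF env] mm_eval(2)[OF env] N(3)])
        (use fits Gv[of _ s] s pw cG in auto)
    then obtain t1 where t1: "run W N (parR mm condG 13 ?r) 150 s t1" "imem t1 = imem s"
      "rmem t1 = (rmem s)(13 := (\<lambda>i. if i < m \<and> G i then 1 / 2 ^ Suc b else rmem s 13 i))" by blast
    have env1: "env t1" using env by (auto simp: env_def t1)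
    have "\<exists>t. run W N (parI mm condG 14 (IAdd (sc 7) (IConst 1))) 150 t1 t \<and> rmem t = rmem t1 \<and>
      imem t = (imem t1)(14 := (\<lambda>i. if i < m \<and> G i then (\<lambda>_. Suc b) i else imem t1 14 i))"
      by (rule run_parI[OF N(1) less_imp_le[OF W_small(2)] mm_eval(1)[OF env1] mm_eval(2)[OF env1] N(3)])
        (use fits Gv[of _ t1] s b W_small cG in \<open>auto simp: t1\<close>)
    then obtain t where t: "run W N (parI mm condG 14 (IAdd (sc 7) (IConst 1))) 150 t1 t"
      "rmem t = rmem t1"
      "imem t = (imem t1)(14 := (\<lambda>i. if i < m \<and> G i then Suc b else imem t1 14 i))" by blast
    have "run W N (Seq (parR mm condG 13 ?r) (parI mm condG 14 (IAdd (sc 7) (IConst 1)))) 400 s t"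
      by (rule run_Seq[OF t1(1) t(1)]) simp
    moreover have "K (Suc b) t" unfolding K_def
    proof (intro conjI allI impI)
      show "env t" using env1 by (auto simp: env_def t)
      show "imem t 4 = (\<lambda>_. 0)" using K by (simp add: K_def t t1)
      fix i assume i: "i < m"
      have Ki: "imem s 14 i \<le> b" "cond i (imem s 14 i)" "imem s 14 i < b \<longrightarrow> \<not> cond i (Suc (imem s 14 i))"
        "rmem s 13 i = 1 / 2 ^ imem s 14 i" using K i by (auto simp: K_def)
      show "rmem t 10 i = mu i" "rmem t 11 i = am i" "rmem t 2 i = \<Delta> i" using K i
        by (auto simp: K_def t t1)
      have t14: "imem t 14 i = (if G i then Suc b else imem s 14 i)" using i by (simp add: t t1)
      have t13: "rmem t 13 i = (if G i then 1 / 2 ^ Suc b else rmem s 13 i)" using i by (simp add: t t1)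
      show "imem t 14 i \<le> Suc b" using Ki by (simp add: t14)
      show "cond i (imem t 14 i)" using Ki by (simp add: t14 G_def)
      show "\<not> cond i (Suc (imem t 14 i))" if "imem t 14 i < Suc b"
      proof -
        have nG: "\<not> G i" using that t14 by (cases "G i") simp_all
        show ?thesis
        proof (cases "imem s 14 i = b")
          case True thus ?thesis using nG by (simp add: t14 G_def)
        next
          case False thus ?thesis using nG Ki by (simp add: t14)
        qed
      qed
      show "rmem t 13 i = 1 / 2 ^ imem t 14 i" using Ki by (simp add: t13 t14)
    qed
    ultimately show "\<exists>t. run W N (Seq (parR mm condG 13 ?r) (parI mm condG 14 (IAdd (sc 7) (IConst
      1)))) 400 s t \<and> K (Suc b) t"
      by blast
  qed auto
  then obtain s2 where s2: "run W N (for_loop 5 7 6 (Seq (parR mm condG 13 ?r) (parI mm condG 14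
    (IAdd (sc 7) (IConst 1))))) (22 + L * (400 + 28)) s1 s2" "K L s2"
    by blast
  define h where "h = imem s2 14"
  have env2: "env s2" using s2 by (simp add: K_def)
  have hW: "i < m \<Longrightarrow> h i \<le> W" for i using s2(2) W_small by (fastforce simp: K_def h_def)
  have D2: "i < m \<Longrightarrow> rmem s2 2 i = \<Delta> i" for i using s2(2) by (simp add: K_def)
  obtain s3 where s3: "run W N (parR mm TT 14 (RLoad 13 Pid)) 20 s2 s3" "imem s3 = imem s2"
    "rmem s3 = (rmem s2)(14 := (\<lambda>i. if i < m then rmem s2 13 i else rmem s2 14 i))"
    using run_mm[OF env2, of "RLoad 13 Pid" "rmem s2 13" 20 14] fits by auto
  have env3: "env s3" using env2 by (auto simp: env_def s3)
  let ?l = "RDiv (RMul (RN 8) (ROfNat (ILoad 14 Pid))) (RLoad 2 Pid)"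
  obtain s4 where s4: "run W N (parR mm TT 12 ?l) 30 s3 s4" "imem s4 = imem s3"
    "rmem s4 = (rmem s3)(12 := (\<lambda>i. if i < m then 8 * real (h i) / \<Delta> i else rmem s3 12 i))"
    using run_mm[OF env3, of ?l "\<lambda>i. 8 * real (h i) / \<Delta> i" 30 12] fits hW D2 by (auto simp: s3 h_def)
  have env4: "env s4" using env3 by (auto simp: env_def s4)
  have "\<exists>t. run W N (parI mm (eqE (ILoad 14 Pid) (IConst 0)) 4 (IConst 1)) 40 s4 t \<and> rmem t = rmem s4 \<and>
    imem t = (imem s4)(4 := (\<lambda>i. if i < m \<and> h i = 0 then (\<lambda>_. 1) i else imem s4 4 i))"
    by (rule run_parI[OF N(1) less_imp_le[OF W_small(2)] mm_eval(1)[OF env4] mm_eval(2)[OF env4] N(3)])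
      (use fits hW in \<open>auto simp: eqE_val eqE_fits s4 s3 h_def eqE_def\<close>)
  then obtain s5 where s5: "run W N (parI mm (eqE (ILoad 14 Pid) (IConst 0)) 4 (IConst 1)) 40 s4
    s5" "rmem s5 = rmem s4"
    "imem s5 = (imem s4)(4 := (\<lambda>i. if i < m \<and> h i = 0 then 1 else imem s4 4 i))" by blast
  have env5: "env s5" using env4 by (auto simp: env_def s5)
  let ?h = "RDiv (RN 1) (RMul (RN 4) (ROfNat nn))"
  obtain t where t: "run W N (parR nn TT 3 ?h) 30 s5 t" "imem t = imem s5"
    "rmem t = (rmem s5)(3 := (\<lambda>i. if i < n then 1 / (4 * real n) else rmem s5 3 i))"
    using run_nn[OF env5, of ?h "\<lambda>_. 1 / (4 * real n)" 30 3] fits W_small env5 by (auto simp: env_def)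
  have "run W N weights (400 + L * 428) s t" unfolding weights_def
    by (rule run_Seq[OF s1(1) run_Seq[OF s2(1) run_Seq[OF s3(1) run_Seq[OF s4(1) run_Seq[OF s5(1)
      t(1) order_refl] order_refl] order_refl] order_refl]]) simp
  moreover have "\<forall>i<m. h i \<le> L \<and> cond i (h i) \<and> (h i < L \<longrightarrow> \<not> cond i (Suc (h i))) \<and>
    rmem t 13 i = 1 / 2 ^ h i \<and> rmem t 14 i = 1 / 2 ^ h i \<and>
      rmem t 12 i = 8 * real (h i) / \<Delta> i \<and> imem t 4 i = (if h i = 0 then 1 else 0)"
    using s2(2) by (auto simp: K_def h_def t s5 s4 s3)
  moreover have "\<forall>j<n. rmem t 3 j = 1 / (4 * real n)" by (simp add: t)
  ultimately show ?thesis by blast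
qed

end

section \<open>The complete walk and the final rounding\<close>

context rounding
begin

definition steps :: nat where "steps = 12 * (32 * (k + L)) * (32 * (k + L)) * L"

text \<open>By Bernoulli's inequality \<open>12 * (Er * Er)\<close> steps at least double the
  inflation, and \<open>steps\<close> consists of \<open>L\<close> such blocks.\<close>

lemma growth: "2 ^ L \<le> (1 + 1 / (12 * (Er * Er))) ^ steps"
proof -
  define K where "K = 12 * (32 * (k + L)) * (32 * (k + L))"
  have K: "real K = 12 * (Er * Er)" by (simp add: K_def Er_def)
  have K0: "0 < real K" using L_pos by (simp add: K_def)
  have "1 + real K * (1 / real K) \<le> (1 + 1 / real K) ^ K"
    using K0 by (intro Bernoulli_inequality) (simp add: order_trans[of _ 0])
  hence "2 \<le> (1 + 1 / real K) ^ K" using K0 by simp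
  hence "2 ^ L \<le> ((1 + 1 / real K) ^ K) ^ L" by (intro power_mono) auto
  thus ?thesis unfolding steps_def K_def[symmetric] K[symmetric] by (simp only: power_mult)
qed

lemma run_rounding_loop:
  assumes inv: "invariant g F s" and g: "0 \<le> g" and s: "imem s 10 0 = 0" "imem s 12 0 = steps"
  shows "\<exists>t. run W N rounding_loop (steps * (1720 + L * (1100 + 52 * L)) + 10) s t \<and>
    invariant (g * (1 + 1 / (12 * (Er * Er))) ^ steps) F t"
proof -
  define c where "c = 1 + 1 / (12 * (Er * Er))"
  have c0: "0 \<le> c" by (simp add: c_def)
  have T: "steps < W" using W_steps by (simp add: steps_def)
  define J where "J i s \<longleftrightarrow> invariant (g * c ^ i) F s \<and> imem s 10 0 = i \<and> imem s 12 0 = steps" for i s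
  have "\<exists>t. run W N rounding_loop (steps * (1720 + L * (1100 + 52 * L)) + 10) s t \<and> J steps t"
    unfolding rounding_loop_def
  proof (rule run_While_count[OF N(1), where D = "1700 + L * (1100 + 52 * L) + 11"])
    fix i s assume i: "i < steps" and J: "J i s"
    have "0 \<le> g * c ^ i" using g c0 by simp
    with run_step[of "g * c ^ i" F s] J obtain t1 where
      t1: "run W N step (1700 + L * (1100 + 52 * L)) s t1" "invariant (g * c ^ i * c) F t1"
      unfolding J_def c_def[symmetric] by blast
    have f: "imem t1 10 = imem s 10" "imem t1 12 = imem s 12" using run_imem[OF t1(1)] by auto
    obtain t2 where t2: "run W N (setI 10 (IAdd (sc 10) (IConst 1))) 11 t1 t2"
      "imem t2 = (imem t1)(10 := (imem t1 10)(0 := ival t1 0 (IAdd (sc 10) (IConst 1))))"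
        "rmem t2 = rmem t1"
      using run_setI[OF N(1), of W t1 "IAdd (sc 10) (IConst 1)" 11 10] J f i T W_512
        by (auto simp: J_def)
    have "invariant (g * c ^ Suc i) F t2"
      using t1(2) by (simp add: invariant_def env_def tab_def t2 mult.assoc mult.commute[of c])
    hence "J (Suc i) t2" using J f by (simp add: J_def t2)
    moreover have "run W N (Seq step (setI 10 (IAdd (sc 10) (IConst 1)))) (1700 + L * (1100 +
      52 * L) + 11) s t2"
      by (rule run_Seq[OF t1(1) t2(1)]) simp
    moreover have "bfits W s 0 (ILess (sc 10) (sc 12)) \<and> bval s 0 (ILess (sc 10) (sc 12))"
      using J i T W_512 by (auto simp: J_def)
    ultimately show "bfits W s 0 (ILess (sc 10) (sc 12)) \<and> bval s 0 (ILess (sc 10) (sc 12)) \<and>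
      (\<exists>t. run W N (Seq step (setI 10 (IAdd (sc 10) (IConst 1)))) (1700 + L * (1100 + 52 * L) +
        11) s t \<and> J (Suc i) t)"
      by blast
  next
    fix s assume "J steps s"
    thus "bfits W s 0 (ILess (sc 10) (sc 12)) \<and> \<not> bval s 0 (ILess (sc 10) (sc 12))"
      using T W_512 by (auto simp: J_def)
  next
    show "J 0 s" using inv s by (simp add: J_def)
  next
    have *: "a \<le> b \<Longrightarrow> c \<le> 9 \<Longrightarrow> a + c + 1 \<le> b + 10" for a b c :: nat by simp
    show "steps * (1700 + L * (1100 + 52 * L) + 11 + bcost (ILess (sc 10) (sc 12)) + 1) +
      bcost (ILess (sc 10) (sc 12)) + 1
      \<le> steps * (1720 + L * (1100 + 52 * L)) + 10"
      by (rule *[OF mult_le_mono2]) simp_all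
  qed
  thus ?thesis by (auto simp: J_def c_def)
qed

definition nearest :: "real \<Rightarrow> nat" where "nearest x = (if 1 / 2 < x then 1 else 0)"

text \<open>The distance is the smaller one of \<open>x\<close> and \<open>1 - x\<close>, whose
  square is at most their product. This is why the column potential tracks
  \<open>sqrt (x * (1 - x))\<close>.\<close>

lemma nearest_dist:
  assumes "0 \<le> x" "x \<le> 1"
  shows "\<bar>x - real (nearest x)\<bar> \<le> sqrt (x * (1 - x))"
proof (rule real_le_rsqrt)
  show "\<bar>x - real (nearest x)\<bar>\<^sup>2 \<le> x * (1 - x)"
  proof (cases "1 / 2 < x")
    case True
    have "(1 - x) * (1 - x) \<le> x * (1 - x)" using True assms by (intro mult_right_mono) auto
    thus ?thesis using True by (simp add: nearest_def power2_eq_square algebra_simps)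
  next
    case False
    have "x * x \<le> x * (1 - x)" using False assms by (intro mult_left_mono) auto
    thus ?thesis using False by (simp add: nearest_def power2_eq_square)
  qed
qed

text \<open>A marked row carries potential at least 1, so the total potential counts the marked
  rows. The same total bounds the inflated column potentials, whence the distances to 0 and 1 sum to
  at most \<open>6 * m * n / 2 ^ L \<le> 1 / 8\<close>. Rounding therefore moves a row sum by at
  most \<open>am i / 8\<close>, within \<open>\<Delta> i / 2\<close> by \<open>cond\<close>; an
  unmarked row has spent no more than the other half of \<open>\<Delta> i\<close>.\<close>

lemma final_bounds:
  assumes inv: "invariant g F t" and g: "2 ^ L / (2 * real n) \<le> g" and F: "F \<le> 3 * real m"
  shows "real (card {i. i < m \<and> imem t 4 i = 1}) \<le> F"
    and "i < m \<Longrightarrow> imem t 4 i \<noteq> 1 \<Longrightarrow>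
      \<bar>\<Sum>e\<in>ents i. av e * (p (cl e) - real (nearest (rmem t 1 (cl e))))\<bar> \<le> \<Delta> i"
proof -
  define x where "x = rmem t 1"
  have rows: "\<And>i. i < m \<Longrightarrow> row_inv x i (imem t 4 i) (rmem t 12 i) (rmem t 13 i) (rmem t 14 i)"
    and cols: "\<And>j. j < n \<Longrightarrow> 0 \<le> x j \<and> x j \<le> 1 \<and> sqrt (x j * (1 - x j)) * g \<le> rmem t 3 j"
    and tot: "(\<Sum>i<m. rmem t 13 i + rmem t 14 i) + (\<Sum>j<n. rmem t 3 j) \<le> F"
    using inv unfolding invariant_def x_def by blast+
  have n0: "0 < real n" using npos by simp
  have g0: "0 < g" using g n0 by (meson divide_pos_pos less_le_trans mult_pos_pos zero_less_numeral
    zero_less_power)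
  have H0: "0 \<le> rmem t 3 j" if "j < n" for j
    using cols[OF that] g0 by (meson mult_nonneg_nonneg real_sqrt_ge_zero order_trans less_imp_le
      diff_ge_0_iff_ge)
  have U0: "0 \<le> rmem t 13 i + rmem t 14 i" if "i < m" for i
    using row_inv_nonneg[OF rows[OF that]] by simp
  have "real (card {i. i < m \<and> imem t 4 i = 1}) = (\<Sum>i | i < m \<and> imem t 4 i = 1. 1)" by simp
  also have "\<dots> \<le> (\<Sum>i | i < m \<and> imem t 4 i = 1. rmem t 13 i + rmem t 14 i)"
  proof (rule sum_mono)
    fix i assume "i \<in> {i. i < m \<and> imem t 4 i = 1}"
    thus "1 \<le> rmem t 13 i + rmem t 14 i" using rows[of i] by (auto simp: row_inv_def)
  qed
  also have "\<dots> \<le> (\<Sum>i<m. rmem t 13 i + rmem t 14 i)"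
    by (rule sum_mono2) (use U0 in auto)
  also have "\<dots> \<le> F" using tot sum_nonneg[of "{..<n}" "rmem t 3"] H0 by force
  finally show "real (card {i. i < m \<and> imem t 4 i = 1}) \<le> F" .
  have "(\<Sum>j<n. rmem t 3 j) \<le> F"
    using tot sum_nonneg[of "{..<m}" "\<lambda>i. rmem t 13 i + rmem t 14 i"] U0 by force
  moreover have "(\<Sum>j<n. sqrt (x j * (1 - x j)) * g) \<le> (\<Sum>j<n. rmem t 3 j)"
    by (rule sum_mono) (use cols in auto)
  ultimately have "(\<Sum>j<n. sqrt (x j * (1 - x j))) * g \<le> 3 * real m" using F
    by (simp add: sum_distrib_right)
  moreover have "0 \<le> (\<Sum>j<n. sqrt (x j * (1 - x j)))" by (rule sum_nonneg) (use cols in auto)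
  hence "(\<Sum>j<n. sqrt (x j * (1 - x j))) * (2 ^ L / (2 * real n)) \<le> (\<Sum>j<n. sqrt (x j * (1 - x j))) * g"
    using g by (intro mult_left_mono)
  ultimately have "(\<Sum>j<n. sqrt (x j * (1 - x j))) * (2 ^ L / (2 * real n)) \<le> 3 * real m" by linarith
  hence "(\<Sum>j<n. sqrt (x j * (1 - x j))) * 2 ^ L \<le> 6 * real m * real n" using n0
    by (simp add: field_simps)
  also have "\<dots> \<le> 1 / 8 * 2 ^ L"
  proof -
    have "real (64 * n * m) \<le> real (2 ^ L)" using L by (rule of_nat_mono)
    hence "64 * (real m * real n) \<le> 2 ^ L" by (simp add: ac_simps)
    moreover have "0 \<le> real m * real n" by simp
    ultimately show ?thesis unfolding mult.assoc by linarith
  qed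
  finally have small: "(\<Sum>j<n. sqrt (x j * (1 - x j))) \<le> 1 / 8" by simp
  assume i: "i < m" and nb: "imem t 4 i \<noteq> 1"
  obtain h where h: "1 \<le> h" "cond i h" "\<bar>dev x i\<bar> \<le> \<Delta> i / 2"
    using rows[OF i] nb unfolding row_inv_def by blast
  have am: "256 * am i \<le> \<Delta> i"
  proof -
    have "256 * 1 * am i \<le> 256 * real h * am i" using h am_nonneg
      by (intro mult_right_mono mult_left_mono) auto
    thus ?thesis using h by (simp add: cond_def)
  qed
  \<comment> \<open>Entries of one row lie in distinct columns, so their distances are part of the
    sum over all columns.\<close>
  have inj: "inj_on cl (ents i)" by (rule inj_onI) (use inj in \<open>auto simp: ents_def\<close>)
  have "(\<Sum>e\<in>ents i. \<bar>x (cl e) - real (nearest (x (cl e)))\<bar>)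
    = (\<Sum>j\<in>cl ` ents i. \<bar>x j - real (nearest (x j))\<bar>)"
    by (simp add: sum.reindex[OF inj])
  also have "\<dots> \<le> (\<Sum>j<n. \<bar>x j - real (nearest (x j))\<bar>)"
    by (rule sum_mono2) (use ents_lt in auto)
  also have "\<dots> \<le> (\<Sum>j<n. sqrt (x j * (1 - x j)))" by (rule sum_mono) (use nearest_dist cols in auto)
  finally have near: "(\<Sum>e\<in>ents i. \<bar>x (cl e) - real (nearest (x (cl e)))\<bar>) \<le> 1 / 8"
    using small by linarith
  have "\<bar>\<Sum>e\<in>ents i. av e * (x (cl e) - real (nearest (x (cl e))))\<bar>
    \<le> (\<Sum>e\<in>ents i. \<bar>av e * (x (cl e) - real (nearest (x (cl e))))\<bar>)"
    by (rule sum_abs)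
  also have "\<dots> \<le> (\<Sum>e\<in>ents i. am i * \<bar>x (cl e) - real (nearest (x (cl e)))\<bar>)"
  proof (rule sum_mono)
    fix e assume e: "e \<in> ents i"
    have "\<bar>av e\<bar> \<le> am i" using am_ge[OF e] av[of e] ents_lt[OF e] by simp
    thus "\<bar>av e * (x (cl e) - real (nearest (x (cl e))))\<bar>
      \<le> am i * \<bar>x (cl e) - real (nearest (x (cl e)))\<bar>"
      unfolding abs_mult by (rule mult_right_mono) simp
  qed
  also have "\<dots> \<le> am i * (1 / 8)" unfolding sum_distrib_left[symmetric] using near am_nonneg
    by (rule mult_left_mono)
  also have "\<dots> \<le> \<Delta> i / 2" using am am_nonneg[of i] by linarith
  finally have "\<bar>\<Sum>e\<in>ents i. av e * (x (cl e) - real (nearest (x (cl e))))\<bar> \<le> \<Delta> i / 2" .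
  moreover have "(\<Sum>e\<in>ents i. av e * (p (cl e) - real (nearest (x (cl e))))) =
      (\<Sum>e\<in>ents i. av e * (x (cl e) - real (nearest (x (cl e))))) - dev x i"
    by (simp add: dev_def sum_subtractf[symmetric] algebra_simps)
  ultimately show "\<bar>\<Sum>e\<in>ents i. av e * (p (cl e) - real (nearest (rmem t 1 (cl e))))\<bar> \<le> \<Delta> i"
    using h(3) unfolding x_def by linarith
qed

definition start :: "mem \<Rightarrow> bool" where
  "start s \<longleftrightarrow> data s \<and> (\<forall>x\<in>{3, 4, 5, 10, 13, 14}. imem s x = (\<lambda>_. 0)) \<and>
    (\<forall>x\<in>{6, 7, 8, 9, 15, 21, 22}. rmem s x = (\<lambda>_. 0)) \<and>
    (\<forall>e<z. rmem s 0 e = av e) \<and> (\<forall>j<n. rmem s 1 j = p j) \<and> (\<forall>i<m. rmem s 2 i = \<Delta> i)"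

lemma run_main:
  assumes start: "start s" and least: "\<And>i. i < L \<Longrightarrow> 2 ^ i < 64 * n * m"
  shows "\<exists>t h q. run W N main_com (1000 + L * 1200 + steps * (1720 + L * (1100 + 52 * L))) s t \<and>
    (\<forall>i<m. h i \<le> L \<and> (h i < L \<longrightarrow> \<not> cond i (Suc (h i)))) \<and>
    (\<forall>j<n. imem t 3 j = q j \<and> (q j = 0 \<or> q j = (1::nat))) \<and>
    real (card {i. i < m \<and> imem t 4 i = 1}) \<le> (\<Sum>i<m. 2 / 2 ^ h i) + 1 / 4 \<and>
    (\<forall>i<m. imem t 4 i \<noteq> 1 \<longrightarrow> \<bar>\<Sum>e\<in>ents i. av e * (p (cl e) - real (q (cl e)))\<bar> \<le> \<Delta> i)"
proof -
  have st: "data s" "\<And>x. x \<in> {3, 4, 5, 10, 13, 14} \<Longrightarrow> imem s x = (\<lambda>_. 0)"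
    "\<And>x. x \<in> {6, 7, 8, 9, 15, 21, 22} \<Longrightarrow> rmem s x = (\<lambda>_. 0)"
    "\<forall>e<z. rmem s 0 e = av e" "\<forall>j<n. rmem s 1 j = p j" "\<forall>i<m. rmem s 2 i = \<Delta> i"
    using start unfolding start_def by blast+
  obtain s1 where s1: "run W N find_log (20 + L * 40) s s1" "env s1"
    using run_find_log[OF st(1) st(2)[of 5] least] by auto
  have f1: "x \<notin> {5, 6} \<Longrightarrow> imem s1 x = imem s x" "rmem s1 x = rmem s x" for x
    using run_imem[OF s1(1)] run_rmem[OF s1(1)] by auto
  have T: "steps < W" using W_steps by (simp add: steps_def)
  have EW: "32 * (k + L) \<le> W" "12 * (32 * (k + L)) \<le> W" "12 * (32 * (k + L)) * (32 * (k + L)) \<le> W"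
  proof -
    show "32 * (k + L) \<le> W" by (rule E_le_W)
    have "12 * (32 * (k + L)) * (32 * (k + L)) * 1 \<le> steps"
      unfolding steps_def using L_pos by (intro mult_le_mono2)
    thus 1: "12 * (32 * (k + L)) * (32 * (k + L)) \<le> W" using T by simp
    have "12 * (32 * (k + L)) * 1 \<le> 12 * (32 * (k + L)) * (32 * (k + L))"
      using L_pos by (intro mult_le_mono2) simp
    thus "12 * (32 * (k + L)) \<le> W" using 1 by linarith
  qed
  have kL: "k + L \<le> W" using EW by simp
  let ?e = "IMul (IConst 32) (IAdd kk (sc 5))"
  have "ifits W s1 0 ?e" "ival s1 0 ?e = 32 * (k + L)"
    using s1(2) EW kL W_small W_512 by (auto simp: env_def)
  then obtain s2 where s2: "run W N (setI 11 ?e) 14 s1 s2"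
      "imem s2 = (imem s1)(11 := (imem s1 11)(0 := 32 * (k + L)))" "rmem s2 = rmem s1"
    using run_setI[OF N(1), of W s1 ?e 14 11] W_512 by auto
  have env2: "env s2" using s1(2) by (auto simp: env_def s2)
  let ?t = "IMul (IMul (IMul (IConst 12) (sc 11)) (sc 11)) (sc 5)"
  have "ifits W s2 0 ?t" "ival s2 0 ?t = steps"
    using env2 EW T W_small W_512 by (auto simp: env_def s2 steps_def)
  then obtain s3 where s3: "run W N (setI 12 ?t) 17 s2 s3"
      "imem s3 = (imem s2)(12 := (imem s2 12)(0 := steps))" "rmem s3 = rmem s2"
    using run_setI[OF N(1), of W s2 ?t 17 12] W_512 by auto
  have env3: "env s3" using env2 by (auto simp: env_def s3)
  have "imem s3 13 = (\<lambda>_. 0)" using st(2)[of 13] by (simp add: s3 s2 f1)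
  from run_tab_init[OF env3 this]
  obtain s4 where s4: "run W N tab_init (200 + L * 200) s3 s4" "tab s4" by blast
  have f4: "x \<notin> {6, 7, 13} \<Longrightarrow> imem s4 x = imem s3 x" "rmem s4 x = rmem s3 x" for x
    using run_imem[OF s4(1)] run_rmem[OF s4(1)] by auto
  have env4: "env s4" using env3 by (auto simp: env_def f4)
  have r4: "rmem s4 x = rmem s x" for x by (simp add: f4 s3 s2 f1)
  have d4: "\<forall>e<z. rmem s4 0 e = av e" "\<forall>j<n. rmem s4 1 j = p j" "\<forall>i<m. rmem s4 2 i = \<Delta> i"
      "rmem s4 6 0 = 0" "rmem s4 7 0 = 0"
    unfolding r4 using st(3-6) by auto
  obtain s5 where s5: "run W N row_stats (200 + L * 428) s4 s5" "rmem s5 6 0 = 0" "rmem s5 7 0 = 0"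
    "\<forall>i<m. rmem s5 10 i = mu i \<and> rmem s5 11 i = am i"
    using run_row_stats[OF env4 s4(2) d4(1,2,4,5)] by blast
  have f5: "x \<notin> {6, 7} \<Longrightarrow> imem s5 x = imem s4 x" "x \<notin> {6, 7, 10, 11} \<Longrightarrow> rmem s5 x = rmem s4 x" for x
    using run_imem[OF s5(1)] run_rmem[OF s5(1)] by auto
  have env5: "env s5" "tab s5" using env4 s4(2) by (auto simp: env_def tab_def f5)
  have i5: "imem s5 14 = (\<lambda>_. 0)" "imem s5 4 = (\<lambda>_. 0)" using st(2) by (simp_all add: f5 f4 s3 s2 f1)
  have D5: "\<forall>i<m. rmem s5 2 i = \<Delta> i" using d4(3) by (simp add: f5)
  obtain s6 h where s6: "run W N weights (400 + L * 428) s5 s6"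
    and h: "\<forall>i<m. h i \<le> L \<and> cond i (h i) \<and> (h i < L \<longrightarrow> \<not> cond i (Suc (h i))) \<and>
      rmem s6 13 i = 1 / 2 ^ h i \<and> rmem s6 14 i = 1 / 2 ^ h i \<and>
      rmem s6 12 i = 8 * real (h i) / \<Delta> i \<and> imem s6 4 i = (if h i = 0 then 1 else 0)"
    and H: "\<forall>j<n. rmem s6 3 j = 1 / (4 * real n)"
    using run_weights[OF env5 s5(4) D5 i5] by blast
  have f6: "x \<notin> {4, 6, 7, 14} \<Longrightarrow> imem s6 x = imem s5 x"
    "x \<notin> {3, 12, 13, 14} \<Longrightarrow> rmem s6 x = rmem s5 x" for x
    using run_imem[OF s6(1)] run_rmem[OF s6(1)] by auto
  have env6: "env s6" "tab s6" using env5 by (auto simp: env_def tab_def f6)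
  define F where "F = (\<Sum>i<m. 2 / 2 ^ h i) + 1 / (4::real)"
  have x6: "rmem s6 1 j = p j" if "j < n" for j
  proof -
    have "rmem s6 1 = rmem s4 1" using f6(2)[of 1] f5(2)[of 1] by simp
    thus ?thesis using d4(2) that by simp
  qed
  have dev0: "dev (rmem s6 1) i = 0" "dev2 (rmem s6 1) i = 0" for i
    unfolding dev_def dev2_def by (rule sum.neutral; use x6 ents_lt in auto)+
  have n0: "0 < real n" using npos by simp
  \<comment> \<open>The start value \<open>1 / (2 * n)\<close> of the inflation factor matches the
    column potential \<open>1 / (4 * n)\<close>, because
    \<open>sqrt (p * (1 - p)) \<le> 1 / 2\<close>. Both deviations start at 0, so the row potentials
    equal their lower bounds \<open>1 / 2 ^ h\<close>.\<close>
  have inv6: "invariant (1 / (2 * real n)) F s6" unfolding invariant_def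
  proof (intro conjI)
    show "imem s6 11 0 = 32 * (k + L)" by (simp add: f6 f5 f4 s3 s2)
    show "\<forall>a\<ge>z. rmem s6 9 a = 0" "\<forall>a\<ge>m. rmem s6 21 a = 0" "\<forall>a\<ge>n. rmem s6 22 a = 0" "rmem s6 8 0 = 0"
      using st(3) by (simp_all add: f6 f5 r4)
    show "\<forall>e<z. rmem s6 0 e = av e" "\<forall>i<m. rmem s6 2 i = \<Delta> i" "rmem s6 6 0 = 0" "rmem s6 7 0 = 0"
      using d4 s5 D5 by (simp_all add: f6 f5)
    show "\<forall>j<n. 0 \<le> rmem s6 1 j \<and> rmem s6 1 j \<le> 1 \<and>
      sqrt (rmem s6 1 j * (1 - rmem s6 1 j)) * (1 / (2 * real n)) \<le> rmem s6 3 j"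
    proof (intro allI impI)
      fix j assume j: "j < n"
      have "0 \<le> (1 - 2 * p j)\<^sup>2" by simp
      hence "p j * (1 - p j) \<le> (1 / 2)\<^sup>2" by (simp add: power2_eq_square algebra_simps)
      hence "sqrt (p j * (1 - p j)) \<le> 1 / 2" by (intro real_le_lsqrt) auto
      hence "sqrt (p j * (1 - p j)) * (1 / (2 * real n)) \<le> 1 / 2 * (1 / (2 * real n))"
        by (rule mult_right_mono) simp
      thus "0 \<le> rmem s6 1 j \<and> rmem s6 1 j \<le> 1 \<and>
        sqrt (rmem s6 1 j * (1 - rmem s6 1 j)) * (1 / (2 * real n)) \<le> rmem s6 3 j"
        using p j H x6[OF j] by simp
    qed
    show "\<forall>i<m. rmem s6 15 i = dev (rmem s6 1) i \<and>
      row_inv (rmem s6 1) i (imem s6 4 i) (rmem s6 12 i) (rmem s6 13 i) (rmem s6 14 i)"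
    proof (intro allI impI conjI)
      fix i assume i: "i < m"
      have "rmem s6 15 = (\<lambda>_. 0)" using st(3)[of 15] by (simp add: f6 f5 r4)
      thus "rmem s6 15 i = dev (rmem s6 1) i" by (simp only: dev0)
      show "row_inv (rmem s6 1) i (imem s6 4 i) (rmem s6 12 i) (rmem s6 13 i) (rmem s6 14 i)"
      proof (cases "h i = 0")
        \<comment> \<open>Such a row starts marked, with \<open>l = 0\<close> and
          \<open>U + D = 2\<close>.\<close>
        case True thus ?thesis using h i by (simp add: row_inv_def)
      next
        case False
        thus ?thesis using h i \<Delta>[OF i] unfolding row_inv_def dev0
          by (intro disjI2 conjI exI[of _ "h i"]) auto
      qed
    qed
    have "(\<Sum>i<m. rmem s6 13 i + rmem s6 14 i) = (\<Sum>i<m. 2 / 2 ^ h i)" by (rule sum.cong) (use h in auto)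
    moreover have "(\<Sum>j<n. rmem s6 3 j) = (\<Sum>j<n. 1 / (4 * real n))" by (rule sum.cong) (use H in auto)
    hence "(\<Sum>j<n. rmem s6 3 j) = 1 / 4" using n0 by simp
    ultimately show "(\<Sum>i<m. rmem s6 13 i + rmem s6 14 i) + (\<Sum>j<n. rmem s6 3 j) \<le> F" by (simp add: F_def)
  qed (use env6 in auto)
  have i6: "imem s6 10 0 = 0" "imem s6 12 0 = steps" using st(2)[of 10]
    by (simp_all add: f6 f5 f4 s3 s2 f1)
  have "0 \<le> 1 / (2 * real n)" by simp
  from run_rounding_loop[OF inv6 this i6]
  obtain s7 where s7: "run W N rounding_loop (steps * (1720 + L * (1100 + 52 * L)) + 10) s6 s7"
    "invariant (1 / (2 * real n) * (1 + 1 / (12 * (Er * Er))) ^ steps) F s7" by blast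
  have env7: "env s7" using s7(2) by (simp add: invariant_def)
  have "imem s7 3 = imem s6 3" using run_imem[OF s7(1)] by simp
  hence i7: "imem s7 3 = (\<lambda>_. 0)" using st(2)[of 3] by (simp add: f6 f5 f4 s3 s2 f1)
  define q where "q j = nearest (rmem s7 1 j)" for j
  have "\<exists>t. run W N round_com 20 s7 t \<and> rmem t = rmem s7 \<and>
    imem t = (imem s7)(3 := (\<lambda>j. if j < n \<and> 1 / 2 < rmem s7 1 j then (\<lambda>_. 1) j else imem s7 3 j))"
    unfolding round_com_def
    by (rule run_parI[OF N(1) less_imp_le[OF W_small(1)] nn_eval(1)[OF env7] nn_eval(2)[OF env7] N(2)])
      (use Pid_fits const_fits in auto)
  then obtain t where t: "run W N round_com 20 s7 t"
    "imem t = (imem s7)(3 := (\<lambda>j. if j < n \<and> 1 / 2 < rmem s7 1 j then 1 else imem s7 3 j))" by blast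
  have run: "run W N main_com (1000 + L * 1200 + steps * (1720 + L * (1100 + 52 * L))) s t"
    unfolding main_com_def
    by (rule run_Seq[OF s1(1) run_Seq[OF s2(1) run_Seq[OF s3(1) run_Seq[OF s4(1) run_Seq[OF s5(1)
          run_Seq[OF s6(1) run_Seq[OF s7(1) t(1) order_refl] order_refl] order_refl] order_refl]
            order_refl] order_refl]]) simp
  have g: "2 ^ L / (2 * real n) \<le> 1 / (2 * real n) * (1 + 1 / (12 * (Er * Er))) ^ steps"
    using growth n0 by (simp add: divide_right_mono)
  have "2 / 2 ^ h i \<le> (2::real)" for i by (simp add: divide_le_eq)
  hence "(\<Sum>i<m. 2 / 2 ^ h i) \<le> (\<Sum>i<m. (2::real))" by (intro sum_mono)
  hence F3: "F \<le> 3 * real m" using mpos by (simp add: F_def)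
  have "\<forall>j<n. imem t 3 j = q j \<and> (q j = 0 \<or> q j = 1)" using i7 by (simp add: t q_def nearest_def)
  moreover have "imem t 4 = imem s7 4" by (simp add: t)
  ultimately show ?thesis
    using run h final_bounds[OF s7(2) g F3]
      by (intro exI[of _ t] exI[of _ h] exI[of _ q]) (auto simp: F_def q_def)
qed

end

section \<open>Failure probabilities and costs\<close>

text \<open>If \<open>n\<close> or \<open>m\<close> is 0, the initial memory already encodes a
  correct output; the main program needs both to be positive.\<close>

definition program :: com where
  "program = If (ILess (IConst 0) (IMul nn mm)) main_com Skip"

lemma prob_bad_nonneg: "0 \<le> c \<Longrightarrow> 0 \<le> prob_bad c n k A p \<Delta> i"
  by (simp add: prob_bad_def Let_def)

text \<open>Failure of the test for \<open>h + 1\<close> bounds the exponent by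
  \<open>256 * (h + 1)\<close>. The division by \<open>c = 1024\<close> turns this into
  \<open>(h + 1) / 4\<close>, and \<open>exp (1 / 4) \<le> 2\<close> makes the exponential at least
  \<open>1 / 2 ^ (h + 1)\<close>. The result is twice the start potential \<open>2 / 2 ^ h\<close>
  of the row; this slack absorbs the additive errors in the final count.\<close>

lemma prob_bad_ge:
  assumes A: "\<forall>j<n. 0 \<le> A i j" and p: "\<forall>j<n. 0 \<le> p j" and d: "0 < \<Delta> i"
    and fail: "\<not> (256 * real (Suc h) * row_mean n A p i * row_max n A i \<le> (\<Delta> i)\<^sup>2 \<and>
      256 * real (Suc h) * row_max n A i \<le> \<Delta> i \<and> 256 * real (Suc h) * row_mean n A p i \<le> \<Delta> i * real k)"
  shows "4 / 2 ^ h \<le> prob_bad 1024 n k A p \<Delta> i"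
proof -
  define t where "t = 256 * real (Suc h)"
  have t0: "0 < t" by (simp add: t_def)
  have mu0: "0 \<le> row_mean n A p i" using A p by (auto simp: row_mean_def intro!: sum_nonneg)
  have a0: "0 \<le> row_max n A i" by (simp add: row_max_def)
  \<comment> \<open>A failed test has a positive denominator, since otherwise its right side would
    be 0; so the quotient concerned is finite.\<close>
  have q: "ereal x / ereal y < ereal t" if "x < t * y" "0 \<le> x" "0 \<le> y" for x y
  proof -
    have y: "0 < y" using that t0 by (cases "y = 0") auto
    hence "x / y < t" using that by (simp add: divide_less_eq)
    thus ?thesis using y by simp
  qed
  have "bad_exponent n k A p \<Delta> i < ereal t"
    using fail unfolding t_def[symmetric] de_Morgan_conj not_le
  proof (elim disjE)
    assume "(\<Delta> i)\<^sup>2 < t * row_mean n A p i * row_max n A i"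
    hence "ereal ((\<Delta> i)\<^sup>2) / ereal (row_mean n A p i * row_max n A i) < ereal t"
      using mu0 a0 by (intro q) (auto simp: mult.assoc)
    thus ?thesis unfolding bad_exponent_def by (simp add: min_less_iff_disj)
  next
    assume "\<Delta> i < t * row_max n A i"
    hence "ereal (\<Delta> i) / ereal (row_max n A i) < ereal t" using a0 d by (intro q) auto
    thus ?thesis unfolding bad_exponent_def by (simp add: min_less_iff_disj)
  next
    assume "\<Delta> i * real k < t * row_mean n A p i"
    hence "ereal (\<Delta> i * real k) / ereal (row_mean n A p i) < ereal t" using mu0 d by (intro q) auto
    thus ?thesis unfolding bad_exponent_def by (simp add: min_less_iff_disj)
  qed
  then obtain x where x: "x = bad_exponent n k A p \<Delta> i" "x < ereal t" by blast
  have xt: "x \<noteq> \<infinity>" "real_of_ereal x \<le> t" using x(2) t0 by (cases x; simp)+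
  have "exp (1 / 4) \<le> (2::real)" using exp_bound[of "1 / 4"] by (simp add: power2_eq_square)
  hence "exp (1 / 4) ^ Suc h \<le> (2::real) ^ Suc h" by (intro power_mono) auto
  moreover have "real (Suc h) / 4 = of_nat (Suc h) * (1 / 4)" by simp
  ultimately have e: "exp (real (Suc h) / 4) \<le> 2 ^ Suc h" by (simp only: exp_of_nat_mult)
  have "4 / 2 ^ h \<le> 1024 * inverse (2 ^ Suc h :: real)" by (simp add: field_simps)
  also have "\<dots> \<le> 1024 * inverse (exp (real (Suc h) / 4))"
    by (intro mult_left_mono le_imp_inverse_le[OF e]) simp_all
  also have "\<dots> = 1024 * exp (- (real (Suc h) / 4))" by (simp only: exp_minus)
  also have "\<dots> \<le> 1024 * exp (- (1 / 1024) * real_of_ereal x)" using xt(2) by (simp add: t_def)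
  also have "\<dots> = prob_bad 1024 n k A p \<Delta> i" using xt x by (simp add: prob_bad_def)
  finally show ?thesis .
qed

text \<open>What the theorem claims of one instance, with \<open>c\<close> and the program fixed; it
  is shared by the empty and the proper instances.\<close>

definition solvable :: "nat \<Rightarrow> nat \<Rightarrow> nat \<Rightarrow> nat \<Rightarrow> (nat \<Rightarrow> nat \<Rightarrow> real) \<Rightarrow> (nat \<Rightarrow> real) \<Rightarrow> (nat \<Rightarrow> real) \<Rightarrow>
    (nat \<times> nat) list \<Rightarrow> bool" where
  "solvable C n m k A p \<Delta> es \<longleftrightarrow> (\<exists>work depth t q Ibad.
         exec ((n + m + k + 2) ^ C) program (initial_mem n m k A p \<Delta> es) work depth t \<and>
         real work \<le> real C * real (Max {1, nnz m n A, n, m}) * log_size n m ^ C * (1 + real k) ^ C \<and>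
         real depth \<le> real C * (log_size n m + real k) ^ C \<and>
         outputs n m t q Ibad \<and> (\<forall>j<n. q j \<in> {0, 1}) \<and> Ibad \<subseteq> {..<m} \<and>
         real (card Ibad) \<le> (\<Sum>i<m. prob_bad 1024 n k A p \<Delta> i) \<and>
         (\<forall>i \<in> {..<m} - Ibad. \<bar>\<Sum>j<n. A i j * (p j - q j)\<bar> \<le> \<Delta> i))"

lemma trivial_instance:
  assumes nm: "n * m = 0" and \<Delta>: "\<forall>i<m. 0 < \<Delta> i" and C: "100 \<le> C"
  shows "solvable C n m k A p \<Delta> es"
proof -
  let ?s = "initial_mem n m k A p \<Delta> es"
  let ?b = "ILess (IConst 0) (IMul nn mm)"
  have s: "imem ?s 0 0 = n" "imem ?s 0 (Suc 0) = m" "imem ?s 3 = (\<lambda>_. 0)" "imem ?s 4 = (\<lambda>_. 0)"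
    by (simp_all add: initial_mem_def array_of_def)
  have W: "(n + m + k + 2) ^ 1 \<le> (n + m + k + 2) ^ C" using C by (intro power_increasing) auto
  have fits: "bfits ((n + m + k + 2) ^ C) ?s 0 ?b" "\<not> bval ?s 0 ?b" using W nm by (auto simp: s)
  have ex: "exec ((n + m + k + 2) ^ C) program ?s (bcost ?b + 1 + 0) (bcost ?b + 1 + 0) ?s"
    unfolding program_def by (rule exec_IfFalse[OF fits exec_Skip])
  have ls: "log_size n m = 1" using nm by (simp add: log_size_def)
  have k1: "1 \<le> (1 + real k) ^ C" by (rule one_le_power) simp
  have M: "1 \<le> real (Max {1, nnz m n A, n, m})" by simp
  have "8 * 1 * 1 \<le> real C * real (Max {1, nnz m n A, n, m}) * (1 + real k) ^ C"
    by (intro mult_mono k1 M) (use C in auto)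
  moreover have "8 * 1 \<le> real C * (1 + real k) ^ C" by (intro mult_mono k1) (use C in auto)
  moreover have "0 \<le> (\<Sum>i<m. prob_bad 1024 n k A p \<Delta> i)" by (intro sum_nonneg prob_bad_nonneg) simp
  moreover have "\<bar>\<Sum>j<n. A i j * (p j - 0)\<bar> \<le> \<Delta> i" if "i < m" for i
    using nm \<Delta> that by (auto simp: less_imp_le)
  ultimately show ?thesis unfolding solvable_def using ex
    by (intro exI[of _ "bcost ?b + 1 + 0"] exI[of _ ?s] exI[of _ "\<lambda>_. 0"] exI[of _ "{}"] conjI)
      (simp_all add: ls outputs_def s)
qed

text \<open>There are \<open>12 * E\<^sup>2 * L\<close> steps, each of depth of order
  \<open>L\<^sup>2\<close>: a step runs through \<open>L\<close> levels with a reduction in every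
  level. The leading 8 is the cost of the test in \<open>program\<close>.\<close>

lemma cost_bound:
  fixes L k :: nat and ls :: real
  assumes L: "real L \<le> 7 * ls" "1 \<le> L" and ls: "1 \<le> ls"
  shows "real (8 + (1000 + L * 1200 + (12 * (32 * (k + L)) * (32 * (k + L)) * L) * (1720 +
    L * (1100 + 52 * L))))
    \<le> 10 ^ 12 * (ls + real k) ^ 5"
proof -
  define e where "e = real (k + L)"
  have e: "1 \<le> e" "real L \<le> e" "1 \<le> real L" using L by (auto simp: e_def)
  have "real L * real L \<le> e * e" using e by (intro mult_mono) auto
  moreover have "e \<le> e * e" using mult_left_mono[of 1 e e] e by simp
  hence "1 \<le> e * e" "real L \<le> e * e" using e by linarith+
  moreover have "1720 + real L * (1100 + 52 * real L) = 1720 + 1100 * real L + 52 * (real L * real L)"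
    by (simp add: algebra_simps)
  ultimately have 1: "1720 + real L * (1100 + 52 * real L) \<le> 2872 * (e * e)" by linarith
  have 2: "12 * (32 * e) * (32 * e) * real L \<le> 12288 * (e * e * e)"
    using mult_left_mono[OF e(2), of "e * e"] e by simp
  have "12 * (32 * e) * (32 * e) * real L * (1720 + real L * (1100 + 52 * real L))
    \<le> (12288 * (e * e * e)) * (2872 * (e * e))"
    using e by (intro mult_mono 1 2) auto
  also have "\<dots> = 35291136 * e ^ 5" by (simp add: eval_nat_numeral)
  finally have 3: "12 * (32 * e) * (32 * e) * real L * (1720 + real L * (1100 + 52 * real L))
    \<le> 35291136 * e ^ 5" .
  have 4: "e \<le> e ^ 5" "1 \<le> e ^ 5" using e power_increasing[of 1 5 e] by auto
  have "real (8 + (1000 + L * 1200 + (12 * (32 * (k + L)) * (32 * (k + L)) * L) * (1720 +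
    L * (1100 + 52 * L))))
    = 1008 + 1200 * real L + 12 * (32 * e) * (32 * e) * real L * (1720 + real L * (1100 + 52 * real L))"
    by (simp add: e_def)
  also have "\<dots> \<le> 1008 * e ^ 5 + 1200 * e ^ 5 + 35291136 * e ^ 5"
    using 3 4 e by (intro add_mono) auto
  also have "\<dots> = 35293344 * e ^ 5" by simp
  also have "e ^ 5 \<le> (7 * (ls + real k)) ^ 5"
    using L e by (intro power_mono) (auto simp: e_def)
  \<comment> \<open>\<open>35293344 * 7 ^ 5\<close> is below \<open>10 ^ 12\<close>.\<close>
  also have "35293344 * (7 * (ls + real k)) ^ 5 = (35293344 * 7 ^ 5) * (ls + real k) ^ 5"
    unfolding power_mult_distrib by (simp only: mult.assoc)
  also have "\<dots> \<le> 10 ^ 12 * (ls + real k) ^ 5" using ls by (intro mult_right_mono) auto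
  finally show ?thesis by simp
qed

lemma nontrivial_instance:
  assumes nm: "0 < n" "0 < m" and A: "\<forall>i<m. \<forall>j<n. 0 \<le> A i j" and p: "\<forall>j<n. 0 \<le> p j \<and> p j \<le> 1"
    and \<Delta>: "\<forall>i<m. 0 < \<Delta> i" and es: "enumerates_nonzeros m n A es" and C: "10 ^ 13 \<le> C"
  shows "solvable C n m k A p \<Delta> es"
proof -
  define z where "z = length es"
  define rw where "rw e = fst (es ! e)" for e
  define cl where "cl e = snd (es ! e)" for e
  define av where "av e = A (rw e) (cl e)" for e
  define L where "L = (LEAST i. 64 * n * m \<le> (2::nat) ^ i)"
  define W where "W = (n + m + k + 2) ^ C"
  define N where "N = z + n + m"
  have dist: "distinct es" and set: "set es = nonzeros m n A" using es
    by (auto simp: enumerates_nonzeros_def)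
  have z: "z = nnz m n A" using distinct_card[OF dist] set by (simp add: z_def nnz_def)
  have ent: "rw e < m \<and> cl e < n \<and> A (rw e) (cl e) \<noteq> 0" if "e < z" for e
    using nth_mem[of e es] that set by (auto simp: z_def rw_def cl_def nonzeros_def case_prod_beta)
  have ex: "\<exists>e<z. rw e = i \<and> cl e = j" if "i < m" "j < n" "A i j \<noteq> 0" for i j
  proof -
    have "(i, j) \<in> set es" using that set by (simp add: nonzeros_def)
    then obtain e where "e < length es" "es ! e = (i, j)" by (auto simp: in_set_conv_nth)
    thus ?thesis by (intro exI[of _ e]) (simp add: z_def rw_def cl_def)
  qed
  have znm: "z \<le> n * m"
  proof -
    have "z \<le> card ({..<m} \<times> {..<n})" unfolding z nnz_def by (rule card_mono) (auto simp: nonzeros_def)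
    thus ?thesis by (simp add: mult.commute)
  qed
  have exL: "64 * n * m \<le> 2 ^ (64 * n * m)" by simp
  have L: "64 * n * m \<le> 2 ^ L" unfolding L_def
    by (rule LeastI[where P = "\<lambda>i. 64 * n * m \<le> 2 ^ i", OF exL])
  have least: "2 ^ i < 64 * n * m" if "i < L" for i using not_less_Least[OF that[unfolded L_def]] by simp
  have nm1: "1 \<le> n * m" using nm by (simp add: Suc_leI)
  have L1: "1 \<le> L"
  proof (rule ccontr)
    assume "\<not> 1 \<le> L"
    hence "L = 0" by simp
    hence "64 * (n * m) \<le> 1" using L by (simp add: mult.assoc)
    thus False using nm1 by simp
  qed
  \<comment> \<open>Minimality of \<open>L\<close>: the previous power is still below
    \<open>64 * n * m\<close>.\<close>
  have L128: "2 ^ L \<le> 128 * (n * m)"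
  proof -
    have "2 ^ (L - 1) < 64 * n * m" using least[of "L - 1"] L1 by simp
    moreover have "(2::nat) ^ L = 2 * 2 ^ (L - 1)" using L1 by (cases L) auto
    ultimately show ?thesis by (simp add: mult.assoc mult.commute[of m])
  qed
  \<comment> \<open>The word bound is \<open>b ^ C\<close>. All integers of the computation are
    estimated by powers of \<open>b\<close>, where numerical constants are absorbed through
    \<open>2 ^ i \<le> b ^ i\<close>; exponent 44 suffices for all of them.\<close>
  define b where "b = n + m + k + 2"
  have b: "2 \<le> b" "n \<le> b" "m \<le> b" "n + 1 \<le> b" "k \<le> b" by (auto simp: b_def)
  have two: "2 ^ i \<le> b ^ i" for i using b by (intro power_mono) auto
  have bmono: "i \<le> j \<Longrightarrow> b ^ i \<le> b ^ j" for i j using b by (intro power_increasing) auto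
  have CW: "b ^ 44 \<le> W" unfolding W_def b_def[symmetric] using C by (intro bmono) simp
  have L9: "2 ^ L \<le> b ^ 9"
  proof -
    have "128 * (n * m) \<le> b ^ 7 * (b * b)" using two[of 7] b by (intro mult_le_mono) auto
    also have "\<dots> = b ^ 9" by (simp add: eval_nat_numeral)
    finally show ?thesis using L128 by simp
  qed
  have LL: "L + 1 \<le> b ^ 9" using less_exp[of L] L9 by linarith
  have E: "32 * (k + L) \<le> b ^ 15"
  proof -
    have "k + L \<le> b ^ 10"
    proof -
      have "b ^ 1 \<le> b ^ 9" by (rule bmono) simp
      hence "k + L \<le> 2 * b ^ 9" using LL b by simp
      also have "\<dots> \<le> b * b ^ 9" using b by (intro mult_le_mono1)
      finally show ?thesis by (simp add: eval_nat_numeral)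
    qed
    hence "32 * (k + L) \<le> b ^ 5 * b ^ 10" using two[of 5] by (intro mult_le_mono) auto
    thus ?thesis by (simp add: power_add[symmetric])
  qed
  interpret rounding n m z rw cl k L W N av p \<Delta>
  proof
    fix e e' assume "e < z" "e' < z" "rw e = rw e'" "cl e = cl e'"
    thus "e = e'" using dist by (auto simp: z_def rw_def cl_def distinct_conv_nth prod_eq_iff)
  next
    have "(L + 1) * m * (n + 1) \<le> b ^ 9 * b * b" using LL b by (intro mult_le_mono)
    also have "\<dots> = b ^ 11" by (simp add: eval_nat_numeral)
    also have "\<dots> \<le> b ^ 44" by (rule bmono) simp
    finally show "(L + 1) * m * (n + 1) \<le> W" using CW by linarith
    have "2 * 2 ^ L \<le> b * b ^ 9" using L9 b by (intro mult_le_mono)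
    also have "\<dots> = b ^ 10" by (simp add: eval_nat_numeral)
    also have "\<dots> \<le> b ^ 44" by (rule bmono) simp
    finally show "2 * 2 ^ L \<le> W" using CW by linarith
    have "512 \<le> b ^ 9" using two[of 9] by simp
    also have "\<dots> \<le> b ^ 44" by (rule bmono) simp
    finally show "512 \<le> W" using CW by linarith
    have "12 * (32 * (k + L)) * (32 * (k + L)) * L \<le> b ^ 4 * b ^ 15 * b ^ 15 * b ^ 9"
      using E LL two[of 4] by (intro mult_le_mono) auto
    also have "\<dots> = b ^ 43" by (simp add: power_add[symmetric])
    finally have "12 * (32 * (k + L)) * (32 * (k + L)) * L + 1 \<le> b ^ 43 + b ^ 43"
      using one_le_power[of b 43] b by linarith
    also have "\<dots> = 2 * b ^ 43" by simp
    also have "\<dots> \<le> b * b ^ 43" using b by (intro mult_le_mono1)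
    also have "\<dots> = b ^ 44" by (simp add: power_Suc[symmetric] del: power_Suc)
    finally show "12 * (32 * (k + L)) * (32 * (k + L)) * L + 1 \<le> W" using CW by linarith
  qed (use ent nm L znm A p \<Delta> in \<open>auto simp: N_def av_def\<close>)
  \<comment> \<open>The link between matrix rows and lists of entries: every nonzero position of the
    row is listed exactly once, and the other columns contribute 0.\<close>
  have row_sum: "(\<Sum>j<n. A i j * f j)
    = (\<Sum>e\<in>ents i. av e * f (cl e))" if i: "i < m" for i and f :: "nat \<Rightarrow> real"
  proof -
    have inj: "inj_on cl (ents i)" by (rule inj_onI) (use inj in \<open>auto simp: ents_def\<close>)
    have "(\<Sum>e\<in>ents i. av e * f (cl e)) = (\<Sum>e\<in>ents i. A i (cl e) * f (cl e))"
      by (rule sum.cong) (auto simp: ents_def av_def)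
    also have "\<dots> = (\<Sum>j\<in>cl ` ents i. A i j * f j)" by (simp add: sum.reindex[OF inj])
    also have "\<dots> = (\<Sum>j<n. A i j * f j)"
    proof (rule sum.mono_neutral_left)
      show "\<forall>j\<in>{..<n} - cl ` ents i. A i j * f j = 0"
      proof
        fix j assume j: "j \<in> {..<n} - cl ` ents i"
        have "A i j = 0"
        proof (rule ccontr)
          assume "A i j \<noteq> 0"
          then obtain e where "e < z" "rw e = i" "cl e = j" using ex[OF i, of j] j by blast
          thus False using j by (auto simp: ents_def)
        qed
        thus "A i j * f j = 0" by simp
      qed
    qed (use ents_lt in auto)
    finally show ?thesis ..
  qed
  have mean: "row_mean n A p i = mu i" if "i < m" for i
    using row_sum[OF that, of p] by (simp add: row_mean_def mu_def mult.commute)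
  have max: "row_max n A i = am i" if i: "i < m" for i
  proof -
    have "insert 0 (A i ` {..<n}) = insert 0 (av ` ents i)"
    proof (intro equalityI subsetI)
      fix y assume "y \<in> insert 0 (A i ` {..<n})"
      then consider "y = 0" | j where "j < n" "y = A i j" "A i j \<noteq> 0" by auto
      thus "y \<in> insert 0 (av ` ents i)"
      proof cases
        case (2 j)
        then obtain e where "e < z" "rw e = i" "cl e = j" using ex i by blast
        thus ?thesis using 2 by (auto simp: ents_def av_def)
      qed simp
    next
      fix y assume "y \<in> insert 0 (av ` ents i)"
      thus "y \<in> insert 0 (A i ` {..<n})" using ent by (auto simp: ents_def av_def)
    qed
    thus ?thesis by (simp add: row_max_def am_def)
  qed
  let ?s = "initial_mem n m k A p \<Delta> es"
  have "start ?s"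
    unfolding start_def data_def
    by (auto simp: initial_mem_def array_of_def z_def rw_def cl_def av_def case_prod_beta)
  from run_main[OF this least] obtain t h q where
    t: "run W N main_com (1000 + L * 1200 + steps * (1720 + L * (1100 + 52 * L))) ?s t"
    and h: "\<forall>i<m. h i \<le> L \<and> (h i < L \<longrightarrow> \<not> cond i (Suc (h i)))"
    and q: "\<forall>j<n. imem t 3 j = q j \<and> (q j = 0 \<or> q j = (1::nat))"
    and bad: "real (card {i. i < m \<and> imem t 4 i = 1}) \<le> (\<Sum>i<m. 2 / 2 ^ h i) + 1 / 4"
    and good: "\<forall>i<m. imem t 4 i \<noteq> 1 \<longrightarrow> \<bar>\<Sum>e\<in>ents i. av e * (p (cl e) - real (q (cl e)))\<bar> \<le> \<Delta> i"
    by blast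
  let ?b = "ILess (IConst 0) (IMul nn mm)"
  have "n * m \<le> W"
  proof -
    have "n * m \<le> b * b" using b by (intro mult_le_mono)
    also have "\<dots> = b ^ 2" by (simp add: power2_eq_square)
    also have "\<dots> \<le> b ^ 44" by (rule bmono) simp
    finally show ?thesis using CW by linarith
  qed
  hence fits: "bfits W ?s 0 ?b" "bval ?s 0 ?b" using W_small W_512 nm
    by (auto simp: initial_mem_def array_of_def)
  define D where "D = 8 + (1000 + L * 1200 + steps * (1720 + L * (1100 + 52 * L)))"
  have "run W N program D ?s t" unfolding program_def D_def
    by (rule run_If[OF N(1) fits(1) t]) (use fits in auto)
  then obtain work depth where wd: "exec W program ?s work depth t" "depth \<le> D" "work \<le> N * D"
    unfolding run_def by blast
  define ls where "ls = log_size n m"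
  have ls: "ls = 1 + log 2 (real (n * m))" using nm1 by (simp add: ls_def log_size_def max_def)
  have nm1': "1 \<le> real (n * m)" using of_nat_mono[OF nm1, where 'a = real] by (simp only: of_nat_1)
  have ls1: "1 \<le> ls" unfolding ls using zero_le_log_cancel_iff[of 2 "real (n * m)"] nm1' by linarith
  have Lls: "real L \<le> 7 * ls"
  proof -
    have "real (2 ^ L) \<le> real (128 * (n * m))" using L128 by (rule of_nat_mono)
    hence "2 ^ L \<le> 2 ^ 7 * real (n * m)" by simp
    hence "log 2 (2 ^ L) \<le> log 2 (2 ^ 7 * real (n * m))" by (intro log_mono) (use nm in auto)
    also have "\<dots> = log 2 (2 ^ 7) + log 2 (real (n * m))" by (rule log_mult_pos) (use nm in auto)
    finally have "real L \<le> 7 + log 2 (real (n * m))"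
      using log_pow_cancel[of "2::real" L] log_pow_cancel[of "2::real" 7] by linarith
    thus ?thesis using ls ls1 by linarith
  qed
  have DK: "real D \<le> 10 ^ 12 * (ls + real k) ^ 5"
    unfolding D_def steps_def by (rule cost_bound[OF Lls L1 ls1])
  have C': "(10::real) ^ 13 \<le> real C"
  proof -
    have "real (10 ^ 13) \<le> real C" using C by (rule of_nat_mono)
    thus ?thesis by simp
  qed
  have C5: "5 \<le> C" using C by simp
  have depth: "real depth \<le> real C * (ls + real k) ^ C"
  proof -
    have "real depth \<le> real D" using wd by simp
    also have "\<dots> \<le> real C * (ls + real k) ^ C"
      by (rule order_trans[OF DK]) (intro mult_mono power_increasing C5, use ls1 C' in auto)
    finally show ?thesis .
  qed
  define M where "M = real (Max {1, nnz m n A, n, m})"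
  have work: "real work \<le> real C * M * ls ^ C * (1 + real k) ^ C"
  proof -
    have NM: "real N \<le> 3 * M"
    proof -
      have "z \<le> Max {1, nnz m n A, n, m}" "n \<le> Max {1, nnz m n A, n, m}" "m \<le> Max {1, nnz m n A, n, m}"
        by (auto simp: z)
      thus ?thesis by (simp add: N_def M_def)
    qed
    have M0: "0 \<le> M" by (simp add: M_def)
    \<comment> \<open>The work bound is a product of a power of the logarithm and a power of
      \<open>1 + k\<close>, so the sum is replaced by the larger product.\<close>
    have "(ls + real k) ^ 5 \<le> (ls * (1 + real k)) ^ 5"
      using ls1 mult_right_mono[of 1 ls "real k"] by (intro power_mono) (auto simp: distrib_left)
    also have "\<dots> = ls ^ 5 * (1 + real k) ^ 5" by (rule power_mult_distrib)
    also have "\<dots> \<le> ls ^ C * (1 + real k) ^ C"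
      using ls1 by (intro mult_mono power_increasing C5) auto
    finally have e: "(ls + real k) ^ 5 \<le> ls ^ C * (1 + real k) ^ C" .
    have "real work \<le> real (N * D)" using wd(3) by (rule of_nat_mono)
    also have "\<dots> = real N * real D" by simp
    also have "\<dots> \<le> (3 * M) * (10 ^ 12 * (ls ^ C * (1 + real k) ^ C))"
      using NM M0 order_trans[OF DK mult_left_mono[OF e]] by (intro mult_mono) auto
    also have "\<dots> = (3 * 10 ^ 12) * (M * (ls ^ C * (1 + real k) ^ C))" by simp
    also have "\<dots> \<le> real C * (M * (ls ^ C * (1 + real k) ^ C))"
      using C' M0 ls1 by (intro mult_right_mono mult_nonneg_nonneg) auto
    finally show ?thesis by (simp add: mult.assoc)
  qed
  define Ibad where "Ibad = {i. i < m \<and> imem t 4 i = 1}"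
  have count: "real (card Ibad) \<le> (\<Sum>i<m. prob_bad 1024 n k A p \<Delta> i)"
  proof -
    \<comment> \<open>The rows with \<open>h i = L\<close> are split off: no lower bound on their
      failure probability is available, but each of them starts with only
      \<open>2 / 2 ^ L\<close>.\<close>
    define a where "a = (\<Sum>i<m. if h i < L then 2 / 2 ^ h i else (0::real))"
    have "(\<Sum>i<m. 2 / 2 ^ h i) \<le> (\<Sum>i<m. (if h i < L then 2 / 2 ^ h i else (0::real)) + 2 / 2 ^ L)"
    proof (rule sum_mono)
      fix i assume "i \<in> {..<m}"
      hence "h i \<le> L" using h by simp
      thus "2 / 2 ^ h i \<le> (if h i < L then 2 / 2 ^ h i else 0) + (2 / 2 ^ L :: real)"
        by (cases "h i = L") auto
    qed
    also have "\<dots> = a + real m * (2 / 2 ^ L)" by (simp add: sum.distrib a_def)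
    also have "real m * (2 / 2 ^ L) \<le> 1 / 32"
    proof -
      have "64 * 1 * m \<le> 64 * n * m" using nm by (intro mult_le_mono) auto
      hence "64 * m \<le> 2 ^ L" using L by linarith
      hence "real (64 * m) \<le> real (2 ^ L)" by (rule of_nat_mono)
      thus ?thesis by (simp add: field_simps)
    qed
    finally have c: "real (card Ibad) \<le> a + 1 / 32 + 1 / 4" using bad unfolding Ibad_def by linarith
    have P: "2 * a \<le> (\<Sum>i<m. prob_bad 1024 n k A p \<Delta> i)"
      unfolding a_def sum_distrib_left
    proof (rule sum_mono)
      fix i assume "i \<in> {..<m}"
      hence i: "i < m" by simp
      show "2 * (if h i < L then 2 / 2 ^ h i else 0) \<le> prob_bad 1024 n k A p \<Delta> i"
      proof (cases "h i < L")
        case True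
        have "4 / 2 ^ h i \<le> prob_bad 1024 n k A p \<Delta> i"
          by (rule prob_bad_ge) (use A p \<Delta> i h True mean max in \<open>auto simp: cond_def\<close>)
        thus ?thesis using True by simp
      qed (simp add: prob_bad_nonneg)
    qed
    \<comment> \<open>A count below 1 vanishes, so the additive error only matters if \<open>a\<close> is large enough to absorb it.\<close>
    show ?thesis
    proof (cases "1 / 2 \<le> a")
      case True thus ?thesis using c P by linarith
    next
      case False
      hence "real (card Ibad) < 1" using c by linarith
      hence "card Ibad = 0" by simp
      moreover have "0 \<le> (\<Sum>i<m. prob_bad 1024 n k A p \<Delta> i)" by (intro sum_nonneg prob_bad_nonneg) simp
      ultimately show ?thesis by simp
    qed
  qed
  have "outputs n m t (\<lambda>j. real (q j)) Ibad" using q by (simp add: outputs_def Ibad_def)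
  moreover have "\<forall>j<n. real (q j) \<in> {0, 1}" using q by auto
  moreover have "Ibad \<subseteq> {..<m}" by (auto simp: Ibad_def)
  moreover have "\<forall>i \<in> {..<m} - Ibad. \<bar>\<Sum>j<n. A i j * (p j - real (q j))\<bar> \<le> \<Delta> i"
  proof
    fix i assume i: "i \<in> {..<m} - Ibad"
    hence "\<bar>\<Sum>e\<in>ents i. av e * (p (cl e) - real (q (cl e)))\<bar> \<le> \<Delta> i" using good by (auto simp: Ibad_def)
    thus "\<bar>\<Sum>j<n. A i j * (p j - real (q j))\<bar> \<le> \<Delta> i" using row_sum[of i "\<lambda>j. p j - real (q j)"] i by simp
  qed
  ultimately show ?thesis
    using wd(1) work depth count unfolding W_def M_def ls_def solvable_def
    by (intro exI[of _ work] exI[of _ depth] exI[of _ t] exI[of _ "\<lambda>j. real (q j)"] exI[of _ Ibad] conjI)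
qed

theorem theorem3:
  shows "\<exists>(c::real) > 0. \<exists>(prog::com) (C::nat).
    \<forall>(n::nat) (m::nat) (k::nat) (A::nat \<Rightarrow> nat \<Rightarrow> real) (p::nat \<Rightarrow> real) (\<Delta>::nat \<Rightarrow> real)
      (es::(nat \<times> nat) list).
      (\<forall>i<m. \<forall>j<n. 0 \<le> A i j) \<and> (\<forall>j<n. 0 \<le> p j \<and> p j \<le> 1) \<and> (\<forall>i<m. 0 < \<Delta> i) \<and>
      enumerates_nonzeros m n A es \<longrightarrow>
      (\<exists>work depth t q Ibad.
         exec ((n + m + k + 2) ^ C) prog (initial_mem n m k A p \<Delta> es) work depth t \<and>
         real work \<le> real C * real (Max {1, nnz m n A, n, m}) * log_size n m ^ C * (1 + real k) ^ C \<and>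
         real depth \<le> real C * (log_size n m + real k) ^ C \<and>
         outputs n m t q Ibad \<and>
         (\<forall>j<n. q j \<in> {0, 1}) \<and>
         Ibad \<subseteq> {..<m} \<and>
         real (card Ibad) \<le> (\<Sum>i<m. prob_bad c n k A p \<Delta> i) \<and>
         (\<forall>i \<in> {..<m} - Ibad. \<bar>\<Sum>j<n. A i j * (p j - q j)\<bar> \<le> \<Delta> i))"
proof -
  \<comment> \<open>An opaque number of this size, so that powers with exponent \<open>C\<close>
    stay symbolic. The bound leaves room for the factor 3 between the processor count and the
    maximum in the work bound.\<close>
  obtain C :: nat where C: "10 ^ 13 \<le> C" by blast
  show ?thesis
  proof (rule exI[of _ 1024], rule conjI, simp, rule exI[of _ program], rule exI[of _ C], intro allI impI, goal_cases)
    case (1 n m k A p \<Delta> es)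
    have "100 \<le> C" using C by simp
    show ?case
    proof (cases "n * m = 0")
      case True
      show ?thesis
        by (rule trivial_instance[OF True, unfolded solvable_def]) (use 1 \<open>100 \<le> C\<close> in auto)
    next
      case False
      show ?thesis
        by (rule nontrivial_instance[OF _ _ _ _ _ _ C, unfolded solvable_def]) (use 1 False in auto)
    qed
  qed
qed

end
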